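(* Let $G$ be a planar (bipartite) graph, with $n$ white vertices, and let $P_G(q,t)$ be its singular $q$-polynomial. Then $$P_G(q,t)=\sum_{\nu}(-1)^{|\nu|}\,q^{A(\nu)}\,t^{\,n-|\nu|}\,\eta(\mathbf{p}(\nu)),$$ where $\nu$ ranges over all pipe systems of $G$.
   Context: Graphs are finite, simple, bipartite (vertices coloured white and black, edges joining white to black), drawn in the plane, and viewed as 1-dimensional CW-complexes; subgraphs inherit the drawing. Let $G$ have white vertices numbered $1,\dots,n$ and black vertices numbered $1,\dots,n'$. Ring and groups. $\mathbb{C}_q=\mathbb{C}[q,q^{-1}]$, with complex conjugation extended by $\bar q=q^{-1}$; $A^\ast$ is the conjugate transpose with respect to this conjugation. $\mathbb{S}^1$ is the additive group $\mathbb{R}/\mathbb{Z}$, $\mathbb{S}_q=\mathbb{S}^1\oplus\mathbb{Z}$, and $\mathbf{q}=(0,1)$ is the canonical generator of the $\mathbb{Z}$ component. $\eta:\mathbb{S}_q\to\mathbb{C}_q$ is $\eta(x,k)=\exp(2\pi i x)\,q^k$, so $\eta(\mathbf{q})=q$. The group $\mathbb{Z}/(2)$ is included in $\mathbb{S}^1\subseteq\mathbb{S}_q$ by $m\mapsto m/2$, so $\eta(m)=(-1)^m$ on $\mathbb{Z}/(2)$. Kasteleyn class. $\mathbf{k}_G\in H^1(G,\mathbb{Z}/(2))$ is the unique class such that for every graph-theoretic cycle $C$ in $G$, $\mathbf{k}_G(C)\equiv m_C+l_C+1\pmod 2$, where $m_C$ is the number of vertices of $G$ in the interior of $C$ and $2l_C$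 is the length of $C$. For $H\subseteq G$, $\mathbf{p}_{G,H}=\pi_{G,H}(\mathbf{k}_G)-\mathbf{k}_H\in H^1(H,\mathbb{Z}/(2))$, where $\pi_{G,H}$ is the restriction map induced by the inclusion. Kasteleyn $q$-matrix. A generalized Kasteleyn $q$-matrix for $G$ is an $n\times n'$ matrix $A$ over $\mathbb{C}_q$ with $a_{ij}\bar a_{ij}=1$ if the $i$-th white and $j$-th black vertices are adjacent and $a_{ij}\bar a_{ij}=0$ otherwise. It is identified with the 1-cochain $\mathbf{A}\in C^1(G,\mathbb{S}_q)$ with $a_{ij}=\eta(\mathbf{A}(e_{ij}))$, $e_{ij}$ being the edge oriented from the $j$-th black to the $i$-th white vertex, and so defines a class $\mathbf{a}\in H^1(G,\mathbb{S}_q)$. Bounded connected components of the complement of $G$ in the plane have well defined positively oriented boundaries $\beta\in H_1(G,\mathbb{Z})$. A Kasteleyn $q$-matrix is a generalized Kasteleyn $q$-matrix $A$ such that $\mathbf{a}(\beta)=\mathbf{q}$ for all such boundaries $\beta$. The singular $q$-polynomial of $G$ is $P_G(q,t)=\det(tI-AA^\ast)\in\mathbb{C}_q[t]$, the characteristic polynomial of $AA^\ast$, for a Kasteleyn $q$-matrix $A$ of $G$ (it does not depend on the choice of $A$). Pipe systems. Matchings are perfect matchings. A pipe system of $G$ is an ordered pair $\nu=(\mu_1,\mu_2)$ of matchings of a (vertex-induced, possibly empty) subgraph $H$ of $G$, called its support; the size $|\nu|$ is half the number of vertices of $H$. The pipe system defines the closed 1-chain (also denoted $\nu$) obtained by adding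 the edges of $\mu_2$ oriented from black to white and the edges of $\mu_1$ oriented from white to black. Put $\mathbf{p}(\nu)=\mathbf{p}_{G,H}(\nu)\in\mathbb{Z}/(2)$. The area $A(\nu)\in\mathbb{Z}$ is the number of bounded connected components of the complement of $G$ positively surrounded by $\nu$, counted with sign and multiplicity (i.e. the sum over these components of the winding number of $\nu$ around a point of the component).
   Formalization: A Kasteleyn q-matrix is taken to satisfy a(β) = k_G(β) + q on each bounded face boundary β instead of a(β) = q; with the latter the formula fails for a single square (constant term 2 − q − 1/q versus 2 + q + 1/q). *)

theory Defs
  imports
    "HOL-Complex_Analysis.Complex_Analysis"
    "HOL-Library.Poly_Mapping"
    "HOL-Library.Product_Plus"
    "HOL-Library.Z2"
    "Jordan_Normal_Form.Char_Poly"
begin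

section \<open>The ring of Laurent polynomials and the coefficient groups\<close>

text \<open>\<open>\<complex>[q, q\<inverse>]\<close> is the group algebra of the integers: finitely supported functions from
  exponents to coefficients, with convolution product.\<close>

type_synonym laurent = "int \<Rightarrow>\<^sub>0 complex"

definition q_power :: "int \<Rightarrow> laurent" where
  "q_power k = Poly_Mapping.single k 1"

text \<open>The conjugation with \<open>q \<mapsto> q\<inverse>\<close>.\<close>

lift_definition laurent_cnj :: "laurent \<Rightarrow> laurent" is "\<lambda>f k. cnj (f (- k))"
proof -
  fix f :: "int \<Rightarrow> complex"
  assume "finite {k. f k \<noteq> 0}"
  then have "finite (uminus ` {k. f k \<noteq> 0})" by blast
  moreover have "{k. cnj (f (- k)) \<noteq> 0} \<subseteq> uminus ` {k. f k \<noteq> 0}"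
    by (auto intro: image_eqI[where x = "- k" for k])
  ultimately show "finite {k. cnj (f (- k)) \<noteq> 0}"
    by (rule rev_finite_subset)
qed

definition adjoint_mat :: "laurent mat \<Rightarrow> laurent mat" where
  "adjoint_mat A = map_mat laurent_cnj (transpose_mat A)"

text \<open>The group \<open>\<real>/\<int>\<close>.\<close>

quotient_type circle = real / "\<lambda>x y. x - y \<in> \<int>"
  morphisms rep_circle circle_of_real
proof (rule equivpI)
  show "reflp (\<lambda>x y :: real. x - y \<in> \<int>)" by (simp add: reflp_def)
  show "symp (\<lambda>x y :: real. x - y \<in> \<int>)"
    by (rule sympI) (metis Ints_minus minus_diff_eq)
  show "transp (\<lambda>x y :: real. x - y \<in> \<int>)"
  proof (rule transpI)
    fix x y z :: real
    assume "x - y \<in> \<int>" "y - z \<in> \<int>"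
    then have "(x - y) + (y - z) \<in> \<int>" by (rule Ints_add)
    then show "x - z \<in> \<int>" by simp
  qed
qed

instantiation circle :: ab_group_add
begin

lift_definition zero_circle :: circle is 0 .

lift_definition plus_circle :: "circle \<Rightarrow> circle \<Rightarrow> circle" is "(+)"
proof -
  fix a b c d :: real
  assume "a - b \<in> \<int>" "c - d \<in> \<int>"
  then have "(a - b) + (c - d) \<in> \<int>" by (rule Ints_add)
  then show "a + c - (b + d) \<in> \<int>" by (simp add: algebra_simps)
qed

lift_definition uminus_circle :: "circle \<Rightarrow> circle" is uminus
proof -
  fix a b :: real
  assume "a - b \<in> \<int>"
  then have "- (a - b) \<in> \<int>" by (rule Ints_minus)
  then show "- a - (- b) \<in> \<int>" by simp
qed

definition minus_circle :: "circle \<Rightarrow> circle \<Rightarrow> circle" where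
  "minus_circle x y = x + (- y)"

instance
  by standard (simp_all add: minus_circle_def, (transfer, simp)+)

end

lift_definition circle_exp :: "circle \<Rightarrow> complex" is "\<lambda>x. exp (2 * of_real pi * \<i> * of_real x)"
proof -
  fix x y :: real
  assume "x - y \<in> \<int>"
  then obtain k :: int where k: "x = y + of_int k"
    by (metis Ints_cases add.commute diff_add_cancel)
  show "exp (2 * of_real pi * \<i> * of_real x) = exp (2 * of_real pi * \<i> * of_real y)"
    unfolding exp_eq by (rule exI[of _ k]) (simp add: k algebra_simps)
qed

type_synonym q_circle = "circle \<times> int"

definition gen_q :: q_circle where
  "gen_q = (0, 1)"

definition eta :: "q_circle \<Rightarrow> laurent" where
  "eta s = Poly_Mapping.single (snd s) (circle_exp (fst s))"

text \<open>The inclusion of \<open>\<int>/(2)\<close> given by \<open>m \<mapsto> m/2\<close>.\<close>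

definition q_circle_of_bit :: "bit \<Rightarrow> q_circle" where
  "q_circle_of_bit m = ((if m = 0 then 0 else circle_of_real (1 / 2)), 0)"

definition int_scale :: "int \<Rightarrow> 'a::ab_group_add \<Rightarrow> 'a" where
  "int_scale k x = (\<Sum>_<nat k. x) - (\<Sum>_<nat (- k). x)"


section \<open>Plane bipartite graphs\<close>

datatype vertex = White nat | Black nat

text \<open>The pair \<open>(i, j)\<close> is the edge joining the white vertex \<open>i\<close> to the black vertex \<open>j\<close>;
  its curve runs from the black to the white end.\<close>

record bigraph =
  whites :: "nat set"
  blacks :: "nat set"
  edges :: "(nat \<times> nat) set"
  place :: "vertex \<Rightarrow> complex"
  curve :: "nat \<times> nat \<Rightarrow> real \<Rightarrow> complex"

definition vertices :: "bigraph \<Rightarrow> vertex set" where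
  "vertices G = White ` whites G \<union> Black ` blacks G"

definition plane_bigraph :: "bigraph \<Rightarrow> bool" where
  "plane_bigraph G \<longleftrightarrow>
     finite (whites G) \<and> finite (blacks G) \<and> edges G \<subseteq> whites G \<times> blacks G \<and>
     inj_on (place G) (vertices G) \<and>
     (\<forall>(i, j) \<in> edges G.
        arc (curve G (i, j)) \<and>
        pathstart (curve G (i, j)) = place G (Black j) \<and>
        pathfinish (curve G (i, j)) = place G (White i) \<and>
        path_image (curve G (i, j)) \<inter> place G ` vertices G
          = {place G (White i), place G (Black j)}) \<and>
     (\<forall>e \<in> edges G. \<forall>e' \<in> edges G. e \<noteq> e' \<longrightarrow>
        path_image (curve G e) \<inter> path_image (curve G e') \<subseteq> place G ` vertices G)"

definition support :: "bigraph \<Rightarrow> complex set" where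
  "support G = place G ` vertices G \<union> (\<Union>e \<in> edges G. path_image (curve G e))"

definition bounded_faces :: "bigraph \<Rightarrow> complex set set" where
  "bounded_faces G = {F \<in> components (- support G). bounded F}"

definition induced_subgraph :: "bigraph \<Rightarrow> nat set \<Rightarrow> nat set \<Rightarrow> bigraph" where
  "induced_subgraph G W B = G\<lparr>whites := W, blacks := B, edges := edges G \<inter> W \<times> B\<rparr>"


section \<open>Cellular homology and cohomology of the graph\<close>

text \<open>Edges are oriented from black to white. There are no 2-cells, so \<open>H\<^sub>1(G, \<int>)\<close> is the group
  of closed 1-chains, and \<open>H\<^sup>1(G, M)\<close> is the group of 1-cochains modulo coboundaries. A
  cohomology class is represented by the set of its cocycles.\<close>

definition closed_chains :: "bigraph \<Rightarrow> (nat \<times> nat \<Rightarrow> int) set" where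
  "closed_chains G = {c. (\<forall>e. e \<notin> edges G \<longrightarrow> c e = 0) \<and>
     (\<forall>i \<in> whites G. (\<Sum>j | (i, j) \<in> edges G. c (i, j)) = 0) \<and>
     (\<forall>j \<in> blacks G. (\<Sum>i | (i, j) \<in> edges G. c (i, j)) = 0)}"

definition cochains :: "bigraph \<Rightarrow> (nat \<times> nat \<Rightarrow> 'a::ab_group_add) set" where
  "cochains G = {\<phi>. \<forall>e. e \<notin> edges G \<longrightarrow> \<phi> e = 0}"

definition cohomologous ::
    "bigraph \<Rightarrow> ((nat \<times> nat \<Rightarrow> 'a::ab_group_add) \<times> (nat \<times> nat \<Rightarrow> 'a)) set" where
  "cohomologous G = {(\<phi>, \<psi>). \<phi> \<in> cochains G \<and> \<psi> \<in> cochains G \<and>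
     (\<exists>f. \<forall>(i, j) \<in> edges G. \<phi> (i, j) - \<psi> (i, j) = f (White i) - f (Black j))}"

definition cohomology :: "bigraph \<Rightarrow> (nat \<times> nat \<Rightarrow> 'a::ab_group_add) set set" where
  "cohomology G = cochains G // cohomologous G"

definition evaluate ::
    "bigraph \<Rightarrow> (nat \<times> nat \<Rightarrow> 'a::ab_group_add) set \<Rightarrow> (nat \<times> nat \<Rightarrow> int) \<Rightarrow> 'a" where
  "evaluate G X c = (THE v. \<exists>\<phi> \<in> X. v = (\<Sum>e \<in> edges G. int_scale (c e) (\<phi> e)))"

definition class_diff ::
    "(nat \<times> nat \<Rightarrow> 'a::ab_group_add) set \<Rightarrow> (nat \<times> nat \<Rightarrow> 'a) set \<Rightarrow> (nat \<times> nat \<Rightarrow> 'a) set" where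
  "class_diff X Y = {\<lambda>e. \<phi> e - \<psi> e | \<phi> \<psi>. \<phi> \<in> X \<and> \<psi> \<in> Y}"

text \<open>Restriction of classes to a subgraph \<open>H\<close>. The image of a class of the large graph is a
  full class of \<open>H\<close>, because functions on the vertices of \<open>H\<close> extend.\<close>

definition restrict_class ::
    "bigraph \<Rightarrow> (nat \<times> nat \<Rightarrow> 'a::ab_group_add) set \<Rightarrow> (nat \<times> nat \<Rightarrow> 'a) set" where
  "restrict_class H X = (\<lambda>\<phi> e. if e \<in> edges H then \<phi> e else 0) ` X"

text \<open>For a closed chain the winding number is an integer. The library's \<open>winding_number\<close> is
  also defined for curves that are not closed, and it is additive under concatenation, so the
  winding number of a chain is the weighted sum over its edges.\<close>

definition chain_winding :: "bigraph \<Rightarrow> (nat \<times> nat \<Rightarrow> int) \<Rightarrow> complex \<Rightarrow> int" where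
  "chain_winding G c z =
     (THE w. of_int w = (\<Sum>e \<in> edges G. of_int (c e) * winding_number (curve G e) z))"

text \<open>The positively oriented boundary of a face, as an element of \<open>H\<^sub>1(G, \<int>)\<close>: the closed chain
  that winds once around the face and does not wind around any other component of the
  complement. Components of \<open>G\<close> lying inside the face contribute clockwise boundary curves,
  and edges with the face on both sides cancel.\<close>

definition face_boundary :: "bigraph \<Rightarrow> complex set \<Rightarrow> nat \<times> nat \<Rightarrow> int" where
  "face_boundary G F = (THE c. c \<in> closed_chains G \<and>
     (\<forall>z. z \<notin> support G \<longrightarrow> chain_winding G c z = of_bool (z \<in> F)))"


section \<open>The Kasteleyn class\<close>

text \<open>A cycle is given by the list of its vertices in cyclic order.\<close>

fun edge_between :: "vertex \<Rightarrow> vertex \<Rightarrow> (nat \<times> nat) option" where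
  "edge_between (White i) (Black j) = Some (i, j)"
| "edge_between (Black j) (White i) = Some (i, j)"
| "edge_between _ _ = None"

definition next_vertex :: "vertex list \<Rightarrow> nat \<Rightarrow> vertex" where
  "next_vertex C k = C ! (Suc k mod length C)"

definition is_cycle :: "bigraph \<Rightarrow> vertex list \<Rightarrow> bool" where
  "is_cycle G C \<longleftrightarrow> length C \<ge> 3 \<and> distinct C \<and>
     (\<forall>k < length C. \<exists>e \<in> edges G. edge_between (C ! k) (next_vertex C k) = Some e)"

definition cycle_chain :: "vertex list \<Rightarrow> nat \<times> nat \<Rightarrow> int" where
  "cycle_chain C = (\<lambda>(i, j).
     int (card {k. k < length C \<and> C ! k = Black j \<and> next_vertex C k = White i})
     - int (card {k. k < length C \<and> C ! k = White i \<and> next_vertex C k = Black j}))"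

definition cycle_image :: "bigraph \<Rightarrow> vertex list \<Rightarrow> complex set" where
  "cycle_image G C = (\<Union>k < length C.
     path_image (curve G (the (edge_between (C ! k) (next_vertex C k)))))"

definition interior_vertices :: "bigraph \<Rightarrow> vertex list \<Rightarrow> vertex set" where
  "interior_vertices G C = {v \<in> vertices G. place G v \<in> inside (cycle_image G C)}"

definition kasteleyn_class :: "bigraph \<Rightarrow> (nat \<times> nat \<Rightarrow> bit) set" where
  "kasteleyn_class G = (THE k. k \<in> cohomology G \<and>
     (\<forall>C. is_cycle G C \<longrightarrow>
        evaluate G k (cycle_chain C)
          = of_nat (card (interior_vertices G C) + length C div 2 + 1)))"

definition restriction_defect :: "bigraph \<Rightarrow> bigraph \<Rightarrow> (nat \<times> nat \<Rightarrow> bit) set" where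
  "restriction_defect G H =
     class_diff (restrict_class H (kasteleyn_class G)) (kasteleyn_class H)"


section \<open>Kasteleyn \<open>q\<close>-matrices and the singular \<open>q\<close>-polynomial\<close>

text \<open>The vertices are numbered from 0, to agree with the indexing of matrices: the white
  vertices are \<open>0, \<dots>, n - 1\<close> and the black ones \<open>0, \<dots>, n' - 1\<close>.\<close>

definition generalized_kasteleyn_q_matrix :: "bigraph \<Rightarrow> laurent mat \<Rightarrow> bool" where
  "generalized_kasteleyn_q_matrix G A \<longleftrightarrow>
     A \<in> carrier_mat (card (whites G)) (card (blacks G)) \<and>
     (\<forall>i < card (whites G). \<forall>j < card (blacks G).
        A $$ (i, j) * laurent_cnj (A $$ (i, j)) = (if (i, j) \<in> edges G then 1 else 0))"

definition matrix_cochain :: "bigraph \<Rightarrow> laurent mat \<Rightarrow> nat \<times> nat \<Rightarrow> q_circle" where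
  "matrix_cochain G A e = (if e \<in> edges G then (THE s. eta s = A $$ e) else 0)"

definition matrix_class :: "bigraph \<Rightarrow> laurent mat \<Rightarrow> (nat \<times> nat \<Rightarrow> q_circle) set" where
  "matrix_class G A = cohomologous G `` {matrix_cochain G A}"

text \<open>The class of a Kasteleyn \<open>q\<close>-matrix has the value \<open>k\<^sub>G(\<beta>) + q\<close> on the boundary \<open>\<beta>\<close> of a
  bounded face, so that it specializes at \<open>q = 1\<close> to the Kasteleyn class. The sign \<open>k\<^sub>G(\<beta>)\<close>
  cannot be omitted: for a single square, the class with value \<open>q\<close> on the boundary gives
  \<open>det (A A\<^sup>*) = 2 - q - q\<inverse>\<close>, whereas the pairs of perfect matchings are counted by
  \<open>2 + q + q\<inverse>\<close>.\<close>

definition kasteleyn_q_matrix :: "bigraph \<Rightarrow> laurent mat \<Rightarrow> bool" where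
  "kasteleyn_q_matrix G A \<longleftrightarrow> generalized_kasteleyn_q_matrix G A \<and>
     (\<forall>F \<in> bounded_faces G.
        evaluate G (matrix_class G A) (face_boundary G F)
          = q_circle_of_bit (evaluate G (kasteleyn_class G) (face_boundary G F)) + gen_q)"

definition singular_q_polynomial :: "bigraph \<Rightarrow> laurent poly" where
  "singular_q_polynomial G =
     (THE P. \<exists>A. kasteleyn_q_matrix G A \<and> P = char_poly (A * adjoint_mat A))"


section \<open>Pipe systems\<close>

definition perfect_matching :: "bigraph \<Rightarrow> (nat \<times> nat) set \<Rightarrow> bool" where
  "perfect_matching H M \<longleftrightarrow> M \<subseteq> edges H \<and>
     (\<forall>i \<in> whites H. \<exists>!j. (i, j) \<in> M) \<and> (\<forall>j \<in> blacks H. \<exists>!i. (i, j) \<in> M)"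

type_synonym pipe_system = "(nat \<times> nat) set \<times> (nat \<times> nat) set"

definition pipe_systems :: "bigraph \<Rightarrow> pipe_system set" where
  "pipe_systems G = {(M1, M2). \<exists>W \<subseteq> whites G. \<exists>B \<subseteq> blacks G.
     perfect_matching (induced_subgraph G W B) M1 \<and>
     perfect_matching (induced_subgraph G W B) M2}"

text \<open>The vertices of the support are those covered by either one of the two matchings.\<close>

definition pipe_support :: "bigraph \<Rightarrow> pipe_system \<Rightarrow> bigraph" where
  "pipe_support G \<nu> = induced_subgraph G (fst ` fst \<nu>) (snd ` fst \<nu>)"

definition pipe_size :: "bigraph \<Rightarrow> pipe_system \<Rightarrow> nat" where
  "pipe_size G \<nu> = card (vertices (pipe_support G \<nu>)) div 2"

definition pipe_chain :: "pipe_system \<Rightarrow> nat \<times> nat \<Rightarrow> int" where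
  "pipe_chain \<nu> e = of_bool (e \<in> snd \<nu>) - of_bool (e \<in> fst \<nu>)"

definition pipe_parity :: "bigraph \<Rightarrow> pipe_system \<Rightarrow> bit" where
  "pipe_parity G \<nu> =
     evaluate (pipe_support G \<nu>) (restriction_defect G (pipe_support G \<nu>)) (pipe_chain \<nu>)"

definition pipe_area :: "bigraph \<Rightarrow> pipe_system \<Rightarrow> int" where
  "pipe_area G \<nu> = (\<Sum>F \<in> bounded_faces G. chain_winding G (pipe_chain \<nu>) (SOME z. z \<in> F))"

end

theory Submission
  imports Defs "HOL-Combinatorics.Cycles"
begin

text \<open>By the Schur complement, \<open>det (t I - A A\<^sup>*)\<close> is the determinant of the block matrix with rows
  \<open>(t I, A)\<close> and \<open>(A\<^sup>*, I)\<close>. In its Leibniz expansion, the permutations with a nonzero contribution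
  either fix a vertex or move it along an edge, so they are the pipe systems \<open>\<nu>\<close>: \<open>\<mu>\<^sub>2\<close> is followed
  from white to black and \<open>\<mu>\<^sub>1\<close> from black to white. The contribution of \<open>\<nu>\<close> is the sign of its
  permutation times \<open>\<eta>(a(\<nu>))\<close>, where \<open>a\<close> is the class of \<open>A\<close>. Every closed chain is the sum of
  the face boundaries weighted by its winding numbers, hence \<open>a(\<nu>) = k\<^sub>G(\<nu>) + A(\<nu>) q\<close>. A cycle of the
  permutation contributes \<open>-1\<close> to its sign; since the support \<open>H\<close> is perfectly matched, a cycle of \<open>H\<close>
  formed by \<open>\<nu>\<close> has an even number of vertices of \<open>H\<close> in its interior, and the product of the signs
  is \<open>(-1)\<^bsup>|\<nu>|\<^esup> \<eta>(k\<^sub>H(\<nu>))\<close>.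

  The face boundaries are found by inserting the edges one at a time: by Janiszewski's theorem an edge
  splits a face only if it closes a cycle, and then two points of the old face are separated only if
  that cycle separates them. The Kasteleyn class exists because \<open>m\<^sub>C + l\<^sub>C + 1\<close> is additive modulo 2 on
  theta graphs, which suffices for it to be linear on cycles.\<close>

section \<open>Chains and cochains\<close>

text \<open>Two Kasteleyn classes meet in the formula because they have different sources: that of
  the graph comes from the matrix entries, that of the support from the sign of the permutation. The
  sign has to be computed in the support, since the parity argument for a cycle requires every
  vertex in its interior to be moved by the permutation. Modulo 2 a difference is a sum, so the two
  values combine to \<open>pipe_parity\<close>. Faces are handled through winding numbers instead of
  combinatorial data: these are additive in the chain, constant on each component of the complement,
  and determine a closed chain. Cohomology classes, face boundaries and the polynomial itself are
  given by definite descriptions, so existence and uniqueness have to be settled for each before it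
  can be computed with. The basic notions \<open>pairing\<close>, \<open>closed_chain\<close>,
  \<open>is_cyc\<close> and \<open>supp\<close> take a set of edges rather than a graph, because
  nearly every argument removes or adds one edge. Such an edge either is a bridge, on which every
  closed chain vanishes, or lies on a cycle, which can be used to clear its coefficient.\<close>

lemma int_scale_simps [simp]:
  "int_scale 0 x = 0" "int_scale 1 x = x" "int_scale k 0 = 0"
  by (simp_all add: int_scale_def)

lemma int_scale_minus: "int_scale (- k) x = - int_scale k x"
  by (simp add: int_scale_def)

lemma int_scale_succ: "int_scale (k + 1) x = int_scale k x + x"
proof (cases "k \<ge> 0")
  case True
  then have "nat (k + 1) = Suc (nat k)" "nat (- k) = 0" "nat (- (k + 1)) = 0" by auto
  then show ?thesis by (simp add: int_scale_def)
next
  case False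
  then have "nat (- k) = Suc (nat (- (k + 1)))" "nat k = 0" "nat (k + 1) = 0" by auto
  then show ?thesis by (simp add: int_scale_def algebra_simps)
qed

lemma int_scale_add: "int_scale (a + b) x = int_scale a x + int_scale b x"
proof (induction b rule: int_induct[where k = 0])
  case (step1 i)
  have "int_scale (a + (i + 1)) x = int_scale (a + i + 1) x" by (simp add: algebra_simps)
  with step1 show ?case by (simp only: int_scale_succ) (simp add: algebra_simps)
next
  case (step2 i)
  have "int_scale (a + i) x = int_scale (a + (i - 1)) x + x"
    using int_scale_succ[of "a + (i - 1)" x] by (simp add: algebra_simps)
  moreover have "int_scale i x = int_scale (i - 1) x + x"
    using int_scale_succ[of "i - 1" x] by simp
  ultimately show ?case using step2 by (metis add.assoc add_right_cancel)
qed simp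

lemma int_scale_diff: "int_scale (a - b) x = int_scale a x - int_scale b x"
  using int_scale_add[of a "- b" x] by (simp add: int_scale_minus)

lemma int_scale_add_right: "int_scale k (x + y) = int_scale k x + int_scale k y"
  by (simp add: int_scale_def sum.distrib)

lemma int_scale_minus_right: "int_scale k (- x) = - int_scale k x"
  by (simp add: int_scale_def sum_negf)

lemma int_scale_diff_right: "int_scale k (x - y) = int_scale k x - int_scale k y"
  using int_scale_add_right[of k x "- y"] by (simp add: int_scale_minus_right)

lemma int_scale_mult: "int_scale (k * l) x = int_scale k (int_scale l x)"
proof (induction k rule: int_induct[where k = 0])
  case (step1 i)
  then show ?case by (simp add: int_scale_add distrib_right)
next
  case (step2 i)
  then show ?case by (simp add: int_scale_diff left_diff_distrib)
qed simp

lemma int_scale_sum: "int_scale (\<Sum>a\<in>A. f a) x = (\<Sum>a\<in>A. int_scale (f a) x)"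
  by (induction A rule: infinite_finite_induct) (auto simp: int_scale_add)

lemma int_scale_sum_right: "int_scale k (\<Sum>a\<in>A. f a) = (\<Sum>a\<in>A. int_scale k (f a))"
  by (induction A rule: infinite_finite_induct) (auto simp: int_scale_add_right)

lemma int_scale_of_int: "int_scale k (x :: 'a::ring_1) = of_int k * x"
proof (induction k rule: int_induct[where k = 0])
  case (step1 i)
  then show ?case by (simp add: int_scale_add distrib_right)
next
  case (step2 i)
  then show ?case by (simp add: int_scale_diff left_diff_distrib)
qed simp

text \<open>The value of a cochain on a chain, computed on a representative and hence free of the
  definite description in \<open>evaluate\<close>. The edge set is a parameter so that it can vary
  in inductions.\<close>

definition pairing :: "(nat \<times> nat) set \<Rightarrow> (nat \<times> nat \<Rightarrow> 'a::ab_group_add) \<Rightarrow> (nat \<times> nat \<Rightarrow> int) \<Rightarrow> 'a" where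
  "pairing E \<phi> c = (\<Sum>e\<in>E. int_scale (c e) (\<phi> e))"

lemma pairing_add: "pairing E \<phi> (\<lambda>e. c e + d e) = pairing E \<phi> c + pairing E \<phi> d"
  by (simp add: pairing_def int_scale_add sum.distrib)

lemma pairing_diff: "pairing E \<phi> (\<lambda>e. c e - d e) = pairing E \<phi> c - pairing E \<phi> d"
  by (simp add: pairing_def int_scale_diff sum_subtractf)

lemma pairing_mult: "pairing E \<phi> (\<lambda>e. k * c e) = int_scale k (pairing E \<phi> c)"
  by (simp add: pairing_def int_scale_mult int_scale_sum_right)

lemma pairing_zero [simp]: "pairing E \<phi> (\<lambda>e. 0) = 0"
  by (simp add: pairing_def)

lemma pairing_diff_left: "pairing E (\<lambda>e. \<phi> e - \<psi> e) c = pairing E \<phi> c - pairing E \<psi> c"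
  by (simp add: pairing_def int_scale_diff_right sum_subtractf)

lemma pairing_superset:
  assumes "finite E'" "E \<subseteq> E'" "\<And>e. e \<notin> E \<Longrightarrow> c e = 0"
  shows "pairing E' \<phi> c = pairing E \<phi> c"
  unfolding pairing_def by (rule sum.mono_neutral_right) (use assms in auto)

text \<open>Closedness is expressed by duality: the chain pairs to zero with the coboundary of every
  integer function. No vertex set occurs, so the notion makes sense for any set of edges, and the
  test function can be chosen to suit the argument. The condition at each vertex is recovered in
  \<open>closed_chain_iff\<close>.\<close>

definition closed_chain :: "(nat \<times> nat) set \<Rightarrow> (nat \<times> nat \<Rightarrow> int) \<Rightarrow> bool" where
  "closed_chain E c \<longleftrightarrow> (\<forall>e. e \<notin> E \<longrightarrow> c e = 0) \<and>
     (\<forall>f :: vertex \<Rightarrow> int. (\<Sum>e\<in>E. c e * (f (White (fst e)) - f (Black (snd e)))) = 0)"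

lemma closed_chain_zero [simp]: "closed_chain E (\<lambda>e. 0)"
  by (simp add: closed_chain_def)

lemma closed_chain_add: "closed_chain E c \<Longrightarrow> closed_chain E d \<Longrightarrow> closed_chain E (\<lambda>e. c e + d e)"
  by (auto simp: closed_chain_def distrib_right sum.distrib)

lemma closed_chain_mult: "closed_chain E c \<Longrightarrow> closed_chain E (\<lambda>e. k * c e)"
  by (auto simp: closed_chain_def mult.assoc simp flip: sum_distrib_left)

lemma closed_chain_diff: "closed_chain E c \<Longrightarrow> closed_chain E d \<Longrightarrow> closed_chain E (\<lambda>e. c e - d e)"
  using closed_chain_add[of E c "\<lambda>e. (- 1) * d e"] closed_chain_mult[of E d "-1"] by simp

lemma closed_chain_sum:
  "(\<And>a. a \<in> A \<Longrightarrow> closed_chain E (f a)) \<Longrightarrow> closed_chain E (\<lambda>e. \<Sum>a\<in>A. f a e)"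
  by (induction A rule: infinite_finite_induct) (auto intro: closed_chain_add)

lemma closed_chain_superset:
  assumes "finite E'" "E \<subseteq> E'" "\<And>e. e \<notin> E \<Longrightarrow> c e = 0"
  shows "closed_chain E' c \<longleftrightarrow> closed_chain E c"
proof -
  have "(\<Sum>e\<in>E'. c e * (f (White (fst e)) - f (Black (snd e)))) =
     (\<Sum>e\<in>E. c e * (f (White (fst e)) - f (Black (snd e))))" for f :: "vertex \<Rightarrow> int"
    by (rule sum.mono_neutral_right) (use assms in auto)
  then show ?thesis using assms by (auto simp: closed_chain_def)
qed

lemma closed_chain_outside: "closed_chain E c \<Longrightarrow> e \<notin> E \<Longrightarrow> c e = 0"
  unfolding closed_chain_def by blast

lemma closed_chain_mono:
  assumes "finite E'" "closed_chain E c" "E \<subseteq> E'" shows "closed_chain E' c"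
  using closed_chain_superset[of E' E c] assms closed_chain_outside by blast

lemma closed_chain_remove:
  assumes "finite D" "closed_chain (insert e D) c" "c e = 0" shows "closed_chain D c"
proof -
  have "c d = 0" if "d \<notin> D" for d
    using closed_chain_outside[OF assms(2), of d] that assms(3) by (cases "d = e") auto
  then show ?thesis using closed_chain_superset[of "insert e D" D c] assms by blast
qed

lemma sum_by_white:
  assumes "finite E"
  shows "(\<Sum>e\<in>E. int_scale (c e) (f (fst e))) = (\<Sum>i\<in>fst ` E. int_scale (\<Sum>j | (i, j) \<in> E. c (i, j)) (f i))"
proof -
  have "(\<Sum>e\<in>E. int_scale (c e) (f (fst e)))
      = (\<Sum>i\<in>fst ` E. \<Sum>e | e \<in> E \<and> fst e = i. int_scale (c e) (f (fst e)))"
    by (rule sum.image_gen[OF assms])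
  also have "\<dots> = (\<Sum>i\<in>fst ` E. int_scale (\<Sum>j | (i, j) \<in> E. c (i, j)) (f i))"
  proof (rule sum.cong[OF refl])
    fix i
    have *: "{e. e \<in> E \<and> fst e = i} = (\<lambda>j. (i, j)) ` {j. (i, j) \<in> E}" by force
    show "(\<Sum>e | e \<in> E \<and> fst e = i. int_scale (c e) (f (fst e))) = int_scale (\<Sum>j | (i, j) \<in> E. c (i, j)) (f i)"
      unfolding * int_scale_sum by (subst sum.reindex) (auto simp: inj_on_def)
  qed
  finally show ?thesis .
qed

lemma sum_by_black:
  assumes "finite E"
  shows "(\<Sum>e\<in>E. int_scale (c e) (f (snd e))) = (\<Sum>j\<in>snd ` E. int_scale (\<Sum>i | (i, j) \<in> E. c (i, j)) (f j))"
proof -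
  have "(\<Sum>e\<in>E. int_scale (c e) (f (snd e)))
      = (\<Sum>j\<in>snd ` E. \<Sum>e | e \<in> E \<and> snd e = j. int_scale (c e) (f (snd e)))"
    by (rule sum.image_gen[OF assms])
  also have "\<dots> = (\<Sum>j\<in>snd ` E. int_scale (\<Sum>i | (i, j) \<in> E. c (i, j)) (f j))"
  proof (rule sum.cong[OF refl])
    fix j
    have *: "{e. e \<in> E \<and> snd e = j} = (\<lambda>i. (i, j)) ` {i. (i, j) \<in> E}" by force
    show "(\<Sum>e | e \<in> E \<and> snd e = j. int_scale (c e) (f (snd e))) = int_scale (\<Sum>i | (i, j) \<in> E. c (i, j)) (f j)"
      unfolding * int_scale_sum by (subst sum.reindex) (auto simp: inj_on_def)
  qed
  finally show ?thesis .
qed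

text \<open>Tested against the indicator function of one vertex, the sum reduces to the coefficients
  of the edges at that vertex. Conversely, grouping the sum by white and by black ends gives one
  vanishing term for each vertex.\<close>

lemma closed_chain_iff:
  assumes "finite E"
  shows "closed_chain E c \<longleftrightarrow> (\<forall>e. e \<notin> E \<longrightarrow> c e = 0) \<and>
     (\<forall>i. (\<Sum>j | (i, j) \<in> E. c (i, j)) = 0) \<and> (\<forall>j. (\<Sum>i | (i, j) \<in> E. c (i, j)) = 0)"
    (is "_ \<longleftrightarrow> ?s \<and> ?w \<and> ?b")
proof (intro iffI conjI)
  assume cl: "closed_chain E c"
  then show ?s by (simp add: closed_chain_def)
  note cl' = cl[unfolded closed_chain_def, THEN conjunct2, rule_format]
  show ?w
  proof
    fix i
    have "0 = (\<Sum>e\<in>E. c e * (of_bool (White (fst e) = White i) - of_bool (Black (snd e) = White i)))"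
      using cl'[of "\<lambda>v. of_bool (v = White i)"] by (rule sym)
    also have "\<dots> = (\<Sum>e\<in>E. if fst e = i then c e else 0)" by (intro sum.cong) auto
    also have "\<dots> = (\<Sum>e | e \<in> E \<and> fst e = i. c e)" using assms by (simp add: sum.If_cases Int_def)
    also have "{e. e \<in> E \<and> fst e = i} = (\<lambda>j. (i, j)) ` {j. (i, j) \<in> E}" by force
    also have "(\<Sum>e\<in>\<dots>. c e) = (\<Sum>j | (i, j) \<in> E. c (i, j))" by (subst sum.reindex) (auto simp: inj_on_def)
    finally show "(\<Sum>j | (i, j) \<in> E. c (i, j)) = 0" by simp
  qed
  show ?b
  proof
    fix j
    have "0 = (\<Sum>e\<in>E. c e * (- of_bool (White (fst e) = Black j) - - of_bool (Black (snd e) = Black j)))"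
      using cl'[of "\<lambda>v. - of_bool (v = Black j)"] by (rule sym)
    also have "\<dots> = (\<Sum>e\<in>E. if snd e = j then c e else 0)" by (intro sum.cong) auto
    also have "\<dots> = (\<Sum>e | e \<in> E \<and> snd e = j. c e)" using assms by (simp add: sum.If_cases Int_def)
    also have "{e. e \<in> E \<and> snd e = j} = (\<lambda>i. (i, j)) ` {i. (i, j) \<in> E}" by force
    also have "(\<Sum>e\<in>\<dots>. c e) = (\<Sum>i | (i, j) \<in> E. c (i, j))" by (subst sum.reindex) (auto simp: inj_on_def)
    finally show "(\<Sum>i | (i, j) \<in> E. c (i, j)) = 0" by simp
  qed
next
  assume *: "?s \<and> ?w \<and> ?b"
  have "(\<Sum>e\<in>E. c e * (f (White (fst e)) - f (Black (snd e)))) = 0" for f :: "vertex \<Rightarrow> int"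
    using sum_by_white[OF assms, of c "\<lambda>i. f (White i)"] sum_by_black[OF assms, of c "\<lambda>j. f (Black j)"] *
    by (simp add: right_diff_distrib sum_subtractf int_scale_of_int)
  then show "closed_chain E c" using * by (simp add: closed_chain_def)
qed

text \<open>The cochain has values in an arbitrary abelian group, so the defining property of
  \<open>closed_chain\<close>, which is about integer functions, does not apply directly; its form
  at the vertices does.\<close>

lemma pairing_coboundary:
  assumes "finite E" "closed_chain E c" "\<And>i j. (i, j) \<in> E \<Longrightarrow> \<phi> (i, j) = f (White i) - f (Black j)"
  shows "pairing E \<phi> c = 0"
proof -
  have "pairing E \<phi> c = (\<Sum>e\<in>E. int_scale (c e) (f (White (fst e)))) - (\<Sum>e\<in>E. int_scale (c e) (f (Black (snd e))))"
    unfolding pairing_def sum_subtractf[symmetric]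
    by (rule sum.cong) (auto simp: assms(3) int_scale_diff_right)
  also have "\<dots> = 0"
    using assms(2) unfolding sum_by_white[OF assms(1), of c "\<lambda>i. f (White i)"]
      sum_by_black[OF assms(1), of c "\<lambda>j. f (Black j)"]
    by (simp add: closed_chain_iff[OF assms(1)])
  finally show ?thesis .
qed

lemma closed_chains_eq:
  assumes "finite (edges G)" "edges G \<subseteq> whites G \<times> blacks G"
  shows "closed_chains G = {c. closed_chain (edges G) c}"
proof -
  have 1: "{j. (i, j) \<in> edges G} = {}" if "i \<notin> whites G" for i using that assms by blast
  have 2: "{i. (i, j) \<in> edges G} = {}" if "j \<notin> blacks G" for j using that assms by blast
  have "(\<Sum>j | (i, j) \<in> edges G. c (i, j)) = 0" if "i \<notin> whites G" for i and c :: "nat \<times> nat \<Rightarrow> int"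
    by (simp add: 1[OF that])
  moreover have "(\<Sum>i | (i, j) \<in> edges G. c (i, j)) = 0" if "j \<notin> blacks G" for j and c :: "nat \<times> nat \<Rightarrow> int"
    by (simp add: 2[OF that])
  ultimately show ?thesis
    unfolding closed_chains_def closed_chain_iff[OF assms(1)] by blast
qed

section \<open>Paths and cycles as vertex lists\<close>

lemma edge_between_sym: "edge_between u v = edge_between v u"
  by (cases u; cases v) auto

lemma edge_between_Some:
  "edge_between u v = Some e \<longleftrightarrow>
     (u = White (fst e) \<and> v = Black (snd e)) \<or> (u = Black (snd e) \<and> v = White (fst e))"
  by (cases u; cases v; cases e) auto

definition adj :: "(nat \<times> nat) set \<Rightarrow> vertex \<Rightarrow> vertex \<Rightarrow> bool" where
  "adj E u v \<longleftrightarrow> (\<exists>e\<in>E. edge_between u v = Some e)"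

lemma adj_sym: "adj E u v \<longleftrightarrow> adj E v u"
  by (simp add: adj_def edge_between_sym)

lemma adj_mono: "adj E u v \<Longrightarrow> E \<subseteq> E' \<Longrightarrow> adj E' u v"
  by (auto simp: adj_def)

lemma adj_iff: "adj E u v \<longleftrightarrow> edge_between u v \<noteq> None \<and> the (edge_between u v) \<in> E"
  by (auto simp: adj_def)

definition upath :: "(nat \<times> nat) set \<Rightarrow> vertex list \<Rightarrow> bool" where
  "upath E p \<longleftrightarrow> p \<noteq> [] \<and> distinct p \<and> successively (adj E) p"

lemma upath_mono: "upath E p \<Longrightarrow> E \<subseteq> E' \<Longrightarrow> upath E' p"
  by (auto simp: upath_def intro: successively_mono adj_mono)

lemma upath_Cons2: "upath E (u # v # p) \<longleftrightarrow> adj E u v \<and> u \<notin> set (v # p) \<and> upath E (v # p)"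
  by (auto simp: upath_def)

lemma upath_single [simp]: "upath E [u]"
  by (simp add: upath_def)

lemma upath_rev: "upath E p \<Longrightarrow> upath E (rev p)"
  using adj_sym by (auto simp: upath_def elim!: successively_mono)

lemma upath_append:
  "p \<noteq> [] \<Longrightarrow> q \<noteq> [] \<Longrightarrow>
   upath E (p @ q) \<longleftrightarrow> upath E p \<and> upath E q \<and> set p \<inter> set q = {} \<and> adj E (last p) (hd q)"
  by (auto simp: upath_def successively_append_iff)

fun path_edges :: "vertex list \<Rightarrow> (nat \<times> nat) set" where
  "path_edges (u # v # p) = insert (the (edge_between u v)) (path_edges (v # p))"
| "path_edges p = {}"

fun list_chain :: "vertex list \<Rightarrow> nat \<times> nat \<Rightarrow> int" where
  "list_chain (u # v # p) e =
     of_bool (u = Black (snd e) \<and> v = White (fst e)) - of_bool (u = White (fst e) \<and> v = Black (snd e))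
     + list_chain (v # p) e"
| "list_chain p e = 0"

lemma path_edges_append:
  "p \<noteq> [] \<Longrightarrow> q \<noteq> [] \<Longrightarrow>
   path_edges (p @ q) = path_edges p \<union> path_edges q \<union> {the (edge_between (last p) (hd q))}"
proof (induction p)
  case (Cons u p)
  show ?case
  proof (cases p)
    case Nil
    with Cons.prems show ?thesis by (cases q) auto
  next
    case (Cons v r)
    with Cons.IH Cons.prems show ?thesis by auto
  qed
qed auto

lemma path_edges_snoc: "p \<noteq> [] \<Longrightarrow> path_edges (p @ [v]) = insert (the (edge_between (last p) v)) (path_edges p)"
  by (simp add: path_edges_append)

lemma path_edges_rev: "path_edges (rev p) = path_edges p"
proof (induction p rule: path_edges.induct)
  case (1 u v p)
  have "path_edges (rev (u # v # p)) = insert (the (edge_between v u)) (path_edges (rev (v # p)))"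
    using path_edges_snoc[of "rev p @ [v]" u] by simp
  then show ?case using 1 by (simp add: edge_between_sym[of v u])
qed auto

lemma path_edges_subset: "successively (adj E) p \<Longrightarrow> path_edges p \<subseteq> E"
  by (induction p rule: path_edges.induct) (auto simp: adj_iff)

lemma upath_edges_subset: "upath E p \<Longrightarrow> path_edges p \<subseteq> E"
  by (simp add: path_edges_subset upath_def)

lemma successively_adj_path_edges:
  "successively (adj E) p \<Longrightarrow> path_edges p \<subseteq> D \<Longrightarrow> successively (adj D) p"
  by (induction p rule: path_edges.induct) (auto simp: adj_iff)

lemma upath_path_edges: "upath E p \<Longrightarrow> path_edges p \<subseteq> D \<Longrightarrow> upath D p"
  using successively_adj_path_edges by (auto simp: upath_def)

lemma path_edges_ends:
  "successively (adj E) p \<Longrightarrow> e \<in> path_edges p \<Longrightarrow> White (fst e) \<in> set p \<and> Black (snd e) \<in> set p"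
proof (induction p rule: path_edges.induct)
  case (1 u v p)
  then obtain f where "edge_between u v = Some f" by (auto simp: adj_def)
  with 1 show ?case by (auto simp: edge_between_Some)
qed auto

lemma finite_path_edges [simp]: "finite (path_edges p)"
  by (induction p rule: path_edges.induct) auto

text \<open>An edge determines its two ends, and a path visits each vertex only once. So the first
  edge does not recur, and no two contributions can cancel.\<close>

lemma list_chain_values:
  assumes "upath E p"
  shows "if e \<in> path_edges p then list_chain p e = 1 \<or> list_chain p e = - 1 else list_chain p e = 0"
  using assms
proof (induction p rule: path_edges.induct)
  case (1 u v p)
  then have *: "adj E u v" "u \<notin> set (v # p)" "upath E (v # p)" by (auto simp: upath_Cons2)
  obtain f where f: "edge_between u v = Some f" using *(1) by (auto simp: adj_def)
  have "f \<notin> path_edges (v # p)"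
    using path_edges_ends[of E "v # p" f] *(2,3) f by (auto simp: upath_def edge_between_Some)
  have step: "list_chain (u # v # p) e = (if e = f then (if u = Black (snd f) then 1 else - 1) else 0)
     + list_chain (v # p) e"
    using f by (auto simp: edge_between_Some prod_eq_iff)
  show ?case
  proof (cases "e = f")
    case True
    with 1(1)[OF *(3)] \<open>f \<notin> _\<close> show ?thesis unfolding step by (simp add: f)
  next
    case False
    with 1(1)[OF *(3)] show ?thesis unfolding step by (simp add: f)
  qed
qed auto

lemma card_path_edges:
  assumes "upath E p" shows "card (path_edges p) = length p - 1"
  using assms
proof (induction p rule: path_edges.induct)
  case (1 u v p)
  then have *: "adj E u v" "u \<notin> set (v # p)" "upath E (v # p)" by (auto simp: upath_Cons2)
  obtain f where f: "edge_between u v = Some f" using *(1) by (auto simp: adj_def)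
  have "f \<notin> path_edges (v # p)"
    using path_edges_ends[of E "v # p" f] *(2,3) f by (auto simp: upath_def edge_between_Some)
  with 1(1)[OF *(3)] f show ?case by auto
qed auto

text \<open>The sum telescopes: a step from \<open>u\<close> to \<open>v\<close> contributes
  \<open>f v - f u\<close>, whichever way its edge is oriented.\<close>

lemma sum_list_chain:
  fixes f :: "vertex \<Rightarrow> int"
  assumes "finite E" "successively (adj E) p" "p \<noteq> []"
  shows "(\<Sum>e\<in>E. list_chain p e * (f (White (fst e)) - f (Black (snd e)))) = f (last p) - f (hd p)"
  using assms(2,3)
proof (induction p rule: path_edges.induct)
  case (1 u v p)
  then obtain e where e: "e \<in> E" "edge_between u v = Some e" by (auto simp: adj_def)
  have *: "(of_bool (u = Black (snd d) \<and> v = White (fst d)) - of_bool (u = White (fst d) \<and> v = Black (snd d)))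
       * (f (White (fst d)) - f (Black (snd d))) = (if d = e then f v - f u else 0)" for d
    using e(2) by (auto simp: edge_between_Some prod_eq_iff)
  show ?case using 1 assms(1) e(1)
    by (simp add: distrib_right sum.distrib *)
qed auto

text \<open>The walk is followed step by step; when it returns to a vertex of the path built so far,
  the path is cut back to that vertex.\<close>

lemma rtranclp_imp_upath:
  assumes "(adj E)\<^sup>*\<^sup>* u v"
  shows "\<exists>p. upath E p \<and> hd p = u \<and> last p = v"
  using assms
proof (induction rule: rtranclp_induct)
  case base
  then show ?case by (intro exI[of _ "[u]"]) simp
next
  case (step y z)
  then obtain p where p: "upath E p" "hd p = u" "last p = y" by blast
  show ?case
  proof (cases "z \<in> set p")
    case True
    then obtain a b where ab: "p = a @ z # b" by (meson split_list)
    have "upath E (a @ [z])"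
      using p(1) unfolding ab upath_def by (auto simp: successively_append_iff)
    then show ?thesis using p(2) unfolding ab
      by (intro exI[of _ "a @ [z]"]) (cases a; simp)
  next
    case False
    then have "upath E (p @ [z])" using p step(2)
      by (subst upath_append) (auto simp: upath_def)
    then show ?thesis using p by (intro exI[of _ "p @ [z]"]) (auto simp: upath_def)
  qed
qed

text \<open>A path together with an edge from its last to its first vertex. Unlike the indexed form
  \<open>is_cycle\<close>, this one can be split, rotated and joined as a list;
  \<open>is_cycle_iff\<close> identifies the two. The bound on the length excludes a single edge run
  to and fro.\<close>

definition is_cyc :: "(nat \<times> nat) set \<Rightarrow> vertex list \<Rightarrow> bool" where
  "is_cyc E C \<longleftrightarrow> length C \<ge> 3 \<and> upath E C \<and> adj E (last C) (hd C)"

definition cyc_edges :: "vertex list \<Rightarrow> (nat \<times> nat) set" where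
  "cyc_edges C = insert (the (edge_between (last C) (hd C))) (path_edges C)"

lemma is_cyc_mono: "is_cyc E C \<Longrightarrow> E \<subseteq> E' \<Longrightarrow> is_cyc E' C"
  by (auto simp: is_cyc_def intro: upath_mono adj_mono)

lemma cyc_edges_subset: "is_cyc E C \<Longrightarrow> cyc_edges C \<subseteq> E"
  by (auto simp: is_cyc_def cyc_edges_def adj_iff dest: upath_edges_subset)

lemma is_cyc_cyc_edges: "is_cyc E C \<Longrightarrow> cyc_edges C \<subseteq> D \<Longrightarrow> is_cyc D C"
  by (auto simp: is_cyc_def cyc_edges_def adj_iff intro: upath_path_edges)

lemma finite_cyc_edges [simp]: "finite (cyc_edges C)"
  by (simp add: cyc_edges_def)

lemma successively_nth: "successively P p \<longleftrightarrow> (\<forall>k. Suc k < length p \<longrightarrow> P (p ! k) (p ! Suc k))"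
  by (auto simp: successively_conv_nth)

lemma path_edges_nth:
  "path_edges p = (\<lambda>k. the (edge_between (p ! k) (p ! Suc k))) ` {k. Suc k < length p}"
proof (induction p rule: path_edges.induct)
  case (1 u v p)
  have "{k. Suc k < length (u # v # p)} = insert 0 (Suc ` {k. Suc k < length (v # p)})"
    by (auto simp: image_iff) (metis Suc_less_eq not0_implies_Suc)
  then show ?case using 1 by (simp add: image_image)
qed auto

lemma list_chain_nth:
  "list_chain p e = (\<Sum>k<length p - 1. of_bool (p ! k = Black (snd e) \<and> p ! Suc k = White (fst e))
      - of_bool (p ! k = White (fst e) \<and> p ! Suc k = Black (snd e)))"
proof (induction p rule: path_edges.induct)
  case (1 u v p)
  then show ?case by (simp add: sum.lessThan_Suc_shift del: sum.lessThan_Suc)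
qed auto

lemma cycle_nth_cases:
  assumes "C \<noteq> []"
  shows "{..<length C} = insert (length C - 1) {k. Suc k < length C}"
    and "next_vertex C (length C - 1) = hd C"
    and "Suc k < length C \<Longrightarrow> next_vertex C k = C ! Suc k"
  using assms by (auto simp: next_vertex_def hd_conv_nth)

lemma is_cycle_iff: "is_cycle G C \<longleftrightarrow> is_cyc (edges G) C"
proof (cases "C = []")
  case False
  have "(\<forall>k<length C. adj (edges G) (C ! k) (next_vertex C k)) \<longleftrightarrow>
    (\<forall>k\<in>{..<length C}. adj (edges G) (C ! k) (next_vertex C k))" by auto
  also have "\<dots> \<longleftrightarrow> adj (edges G) (last C) (hd C) \<and> successively (adj (edges G)) C"
    unfolding cycle_nth_cases(1)[OF False] using cycle_nth_cases(2,3)[OF False] False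
    by (auto simp: successively_nth last_conv_nth)
  finally show ?thesis
    using False by (auto simp: is_cycle_def is_cyc_def upath_def adj_def)
qed (auto simp: is_cycle_def is_cyc_def)

lemma cycle_chain_eq:
  assumes "C \<noteq> []"
  shows "cycle_chain C e = list_chain C e +
    of_bool (last C = Black (snd e) \<and> hd C = White (fst e)) - of_bool (last C = White (fst e) \<and> hd C = Black (snd e))"
proof -
  obtain i j where e: "e = (i, j)" by (cases e)
  have card_sum: "int (card {k. k < length C \<and> P k}) = (\<Sum>k<length C. of_bool (P k))" for P
    by (simp add: sum.If_cases of_bool_def Int_def)
  have "cycle_chain C e = (\<Sum>k<length C. of_bool (C ! k = Black j \<and> next_vertex C k = White i)
      - of_bool (C ! k = White i \<and> next_vertex C k = Black j))"
    unfolding e cycle_chain_def by (simp add: card_sum sum_subtractf)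
  also have "\<dots> = (\<Sum>k<Suc (length C - 1). of_bool (C ! k = Black j \<and> next_vertex C k = White i)
      - of_bool (C ! k = White i \<and> next_vertex C k = Black j))" using assms by simp
  also have "\<dots> = list_chain C e + of_bool (last C = Black j \<and> hd C = White i)
      - of_bool (last C = White i \<and> hd C = Black j)"
  proof -
    have "next_vertex C k = C ! Suc k" if "k < length C - 1" for k
      using that assms by (intro cycle_nth_cases(3)) auto
    then show ?thesis using assms unfolding sum.lessThan_Suc list_chain_nth e fst_conv snd_conv
      by (simp add: cycle_nth_cases(2)[OF assms] last_conv_nth del: One_nat_def)
  qed
  finally show ?thesis by (simp add: e)
qed

text \<open>Only the first edge of the path contains its first vertex, so a repeated closing edge
  would be that one. Then the last vertex would also be the second, which the length
  excludes.\<close>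

lemma closing_edge_notin:
  assumes "is_cyc E C" shows "the (edge_between (last C) (hd C)) \<notin> path_edges C"
proof
  assume *: "the (edge_between (last C) (hd C)) \<in> path_edges C"
  obtain u p v where C: "C = u # p @ [v]" and p: "p \<noteq> []"
  proof -
    from assms have l: "length C \<ge> 3" by (simp add: is_cyc_def)
    then obtain u C' where 1: "C = u # C'" by (cases C) auto
    with l have "C' \<noteq> []" by auto
    then have "C' = butlast C' @ [last C']" by simp
    moreover have "butlast C' \<noteq> []" using l 1 by (cases C'; cases "tl C'") auto
    ultimately show ?thesis using that[of u "butlast C'" "last C'"] 1 by simp
  qed
  obtain e where e: "edge_between v u = Some e" using assms C by (auto simp: is_cyc_def adj_def)
  have up: "upath E (p @ [v])" "u \<notin> set (p @ [v])" "upath E (u # p)" "v \<notin> set (u # p)"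
  proof -
    have "upath E ([u] @ (p @ [v]))" "upath E ((u # p) @ [v])" using assms C by (simp_all add: is_cyc_def)
    then show "upath E (p @ [v])" "u \<notin> set (p @ [v])" "upath E (u # p)" "v \<notin> set (u # p)"
      using p upath_append[of "[u]" "p @ [v]" E] upath_append[of "u # p" "[v]" E] by auto
  qed
  have "path_edges C = insert (the (edge_between u (hd p))) (path_edges (p @ [v]))"
    using C p by (cases p) auto
  moreover have "e \<notin> path_edges (p @ [v])"
    using path_edges_ends[of E "p @ [v]" e] up e by (auto simp: upath_def edge_between_Some)
  ultimately have "e = the (edge_between u (hd p))" using * e C by auto
  moreover have "adj E u (hd p)" using up(3) p by (cases p) (auto simp: upath_def)
  ultimately have "edge_between u (hd p) = Some e" by (auto simp: adj_def)
  then have "v = hd p" using e by (auto simp: edge_between_Some)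
  then show False using up p by (cases p) auto
qed

lemma cycle_chain_values:
  assumes "is_cyc E C"
  shows "if e \<in> cyc_edges C then cycle_chain C e = 1 \<or> cycle_chain C e = - 1 else cycle_chain C e = 0"
proof -
  have C: "C \<noteq> []" "upath E C" using assms by (auto simp: is_cyc_def)
  obtain f where f: "edge_between (last C) (hd C) = Some f"
    using assms by (auto simp: is_cyc_def adj_def)
  show ?thesis
  proof (cases "e = f")
    case True
    then have "list_chain C e = 0"
      using list_chain_values[OF C(2), of e] closing_edge_notin[OF assms] f by auto
    moreover have "e \<in> cyc_edges C" using f True by (simp add: cyc_edges_def)
    moreover have "last C = White (fst e) \<and> hd C = Black (snd e) \<or> last C = Black (snd e) \<and> hd C = White (fst e)"
      using f True edge_between_Some by blast
    ultimately show ?thesis unfolding cycle_chain_eq[OF C(1)] by (elim disjE) simp_all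
  next
    case False
    then have "cycle_chain C e = list_chain C e" using f
      by (auto simp: cycle_chain_eq[OF C(1)] edge_between_Some prod_eq_iff)
    then show ?thesis using list_chain_values[OF C(2), of e] False f by (simp add: cyc_edges_def)
  qed
qed

lemma card_cyc_edges: "is_cyc E C \<Longrightarrow> card (cyc_edges C) = length C"
  using closing_edge_notin[of E C] card_path_edges[of E C]
  by (auto simp: is_cyc_def cyc_edges_def)

text \<open>The path contributes \<open>f (last C) - f (hd C)\<close>, and the closing edge the
  opposite.\<close>

lemma closed_cycle_chain:
  assumes "finite E" "is_cyc E C" shows "closed_chain E (cycle_chain C)"
  unfolding closed_chain_def
proof (intro conjI allI impI)
  fix e assume "e \<notin> E"
  then show "cycle_chain C e = 0"
    using cycle_chain_values[OF assms(2), of e] cyc_edges_subset[OF assms(2)] by (auto split: if_splits)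
next
  fix f :: "vertex \<Rightarrow> int"
  have C: "C \<noteq> []" "successively (adj E) C" using assms by (auto simp: is_cyc_def upath_def)
  obtain e where e: "e \<in> E" "edge_between (last C) (hd C) = Some e"
    using assms by (auto simp: is_cyc_def adj_def)
  have *: "cycle_chain C d * (f (White (fst d)) - f (Black (snd d))) =
     list_chain C d * (f (White (fst d)) - f (Black (snd d))) + (if d = e then f (hd C) - f (last C) else 0)" for d
    using e(2) by (auto simp: cycle_chain_eq[OF C(1)] edge_between_Some prod_eq_iff algebra_simps)
  show "(\<Sum>e\<in>E. cycle_chain C e * (f (White (fst e)) - f (Black (snd e)))) = 0"
    unfolding * using assms(1) e(1) sum_list_chain[OF assms(1) C(2,1), of f]
    by (simp add: sum.distrib)
qed

text \<open>The dichotomy behind the inductions over edges. If the ends of \<open>e\<close> remain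
  connected without \<open>e\<close>, a path between them closes to a cycle through
  \<open>e\<close>; otherwise no closed chain can use \<open>e\<close>. The path runs from the white
  to the black end, so \<open>e\<close> closes it from black to white, with coefficient 1.\<close>

lemma bridge_or_cycle:
  assumes "finite E" "e \<in> E"
  obtains (bridge) "\<not> (adj (E - {e}))\<^sup>*\<^sup>* (White (fst e)) (Black (snd e))" "\<And>c. closed_chain E c \<Longrightarrow> c e = 0"
  | (cycle) p where "upath (E - {e}) p" "hd p = White (fst e)" "last p = Black (snd e)"
      "is_cyc E p" "cycle_chain p e = 1"
proof (cases "(adj (E - {e}))\<^sup>*\<^sup>* (White (fst e)) (Black (snd e))")
  case True
  then obtain p where p: "upath (E - {e}) p" "hd p = White (fst e)" "last p = Black (snd e)"
    using rtranclp_imp_upath by blast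
  \<comment> \<open>With one vertex, ends of different colours would coincide; with two, the path
    would consist of \<open>e\<close>, which has been removed.\<close>
  have "length p \<ge> 3"
  proof (rule ccontr)
    assume "\<not> ?thesis"
    moreover have "p \<noteq> []" using p(1) by (simp add: upath_def)
    ultimately consider u where "p = [u]" | u v where "p = [u, v]"
      by (cases p; cases "tl p"; cases "tl (tl p)") auto
    then show False
    proof cases
      case 2
      then show ?thesis using p by (auto simp: upath_def adj_iff)
    qed (use p in auto)
  qed
  moreover have "adj E (last p) (hd p)" using p assms by (simp add: adj_def)
  ultimately have cyc: "is_cyc E p" using p(1) by (auto simp: is_cyc_def intro: upath_mono)
  have "e \<notin> path_edges p" using upath_edges_subset[OF p(1)] by auto
  then have "cycle_chain p e = 1"
    using list_chain_values[OF p(1), of e] p by (subst cycle_chain_eq) (auto simp: upath_def)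
  then show ?thesis using cycle p cyc by blast
next
  case False
  \<comment> \<open>The indicator of the component of the white end after the removal of
    \<open>e\<close>. Its coboundary is 1 on \<open>e\<close> and 0 on all other edges, so testing
    against it isolates \<open>c e\<close>.\<close>
  define f :: "vertex \<Rightarrow> int" where "f = (\<lambda>v. of_bool ((adj (E - {e}))\<^sup>*\<^sup>* (White (fst e)) v))"
  have "c e = 0" if c: "closed_chain E c" for c
  proof -
    have "c d * (f (White (fst d)) - f (Black (snd d))) = (if d = e then c e else 0)" if "d \<in> E" for d
    proof (cases "d = e")
      case True then show ?thesis using False by (simp add: f_def)
    next
      case neq: False
      then have a: "adj (E - {e}) (White (fst d)) (Black (snd d))" "adj (E - {e}) (Black (snd d)) (White (fst d))"
        using that by (auto simp: adj_def)
      have "f (White (fst d)) = f (Black (snd d))" unfolding f_def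
        using rtranclp.rtrancl_into_rtrancl[of "adj (E - {e})", OF _ a(1)]
          rtranclp.rtrancl_into_rtrancl[of "adj (E - {e})", OF _ a(2)]
        by (intro arg_cong[where f = of_bool]) blast
      with neq show ?thesis by simp
    qed
    then have "(\<Sum>d\<in>E. c d * (f (White (fst d)) - f (Black (snd d)))) = c e"
      using assms by (simp cong: sum.cong)
    then show ?thesis using c by (simp add: closed_chain_def)
  qed
  then show ?thesis using bridge False by blast
qed

text \<open>Cycle chains generate the closed chains: the coefficient at an edge is 0 if the edge is
  a bridge, and otherwise it is cleared by subtracting a multiple of a cycle that has coefficient 1
  there.\<close>

lemma closed_chain_induct [consumes 2, case_names zero add]:
  assumes "finite E" "closed_chain E c" and "P (\<lambda>e. 0)"
    and "\<And>c k C. closed_chain E c \<Longrightarrow> P c \<Longrightarrow> is_cyc E C \<Longrightarrow> P (\<lambda>e. c e + k * cycle_chain C e)"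
  shows "P c"
proof -
  have "finite D \<Longrightarrow> D \<subseteq> E \<Longrightarrow> closed_chain D c \<Longrightarrow> P c" for D c
  proof (induction D arbitrary: c rule: finite_induct)
    case empty
    then have "c = (\<lambda>e. 0)" by (auto simp: closed_chain_def)
    then show ?case using assms(3) by simp
  next
    case (insert e D)
    have fin: "finite (insert e D)" "e \<in> insert e D" using insert by auto
    from fin show ?case
    proof (cases rule: bridge_or_cycle)
      case bridge
      then have "closed_chain D c" using closed_chain_remove insert by blast
      then show ?thesis using insert by blast
    next
      case (cycle p)
      let ?d = "\<lambda>f. c f - c e * cycle_chain p f"
      have cl: "closed_chain (insert e D) ?d"
        using insert cycle fin by (intro closed_chain_diff closed_chain_mult closed_cycle_chain) auto
      then have "closed_chain D ?d"
        by (rule closed_chain_remove[OF insert.hyps(1)]) (simp add: cycle)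
      then have "P ?d" "closed_chain E ?d"
        using insert closed_chain_mono[OF assms(1)] by blast+
      then have "P (\<lambda>f. ?d f + c e * cycle_chain p f)"
        using assms(4) cycle(4) is_cyc_mono insert.prems(1) by blast
      then show ?thesis by simp
    qed
  qed
  then show ?thesis using assms by blast
qed

text \<open>The cycle space is a direct summand of the space of chains.\<close>

lemma hom_closed_chains_extends:
  fixes h :: "(nat \<times> nat \<Rightarrow> int) \<Rightarrow> 'a::ab_group_add"
  assumes "finite E"
    and add: "\<And>c d. closed_chain E c \<Longrightarrow> closed_chain E d \<Longrightarrow> h (\<lambda>e. c e + d e) = h c + h d"
  shows "\<exists>\<phi>. (\<forall>e. e \<notin> E \<longrightarrow> \<phi> e = 0) \<and> (\<forall>c. closed_chain E c \<longrightarrow> pairing E \<phi> c = h c)"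
  using assms
proof (induction E rule: finite_induct)
  case empty
  have "h (\<lambda>e. 0) = 0" using empty[of "\<lambda>e. 0" "\<lambda>e. 0"] by simp
  moreover have "c = (\<lambda>e. 0)" if "closed_chain {} c" for c using that by (auto simp: closed_chain_def)
  ultimately show ?case by (intro exI[of _ "\<lambda>e. 0"]) (auto simp: pairing_def)
next
  case (insert e E)
  have fin: "finite (insert e E)" "e \<in> insert e E" using insert by auto
  have sub: "closed_chain E c \<Longrightarrow> closed_chain (insert e E) c" for c
    using closed_chain_mono[OF fin(1)] by blast
  obtain \<phi> where \<phi>: "\<And>e. e \<notin> E \<Longrightarrow> \<phi> e = 0" "\<And>c. closed_chain E c \<Longrightarrow> pairing E \<phi> c = h c"
  proof -
    have "\<exists>\<phi>. (\<forall>e. e \<notin> E \<longrightarrow> \<phi> e = 0) \<and> (\<forall>c. closed_chain E c \<longrightarrow> pairing E \<phi> c = h c)"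
      by (rule insert.IH) (intro insert.prems sub)
    then show ?thesis using that by blast
  qed
  from fin show ?case
  proof (cases rule: bridge_or_cycle)
    case bridge
    have "pairing (insert e E) \<phi> c = h c" if "closed_chain (insert e E) c" for c
    proof -
      have "closed_chain E c" using closed_chain_remove[OF insert.hyps(1) that] bridge(2)[OF that] by blast
      then show ?thesis using \<phi> insert(1,2) bridge(2)[OF that] by (simp add: pairing_def)
    qed
    then show ?thesis using \<phi>(1) by (intro exI[of _ \<phi>]) auto
  next
    case (cycle p)
    let ?z = "cycle_chain p"
    have z: "closed_chain (insert e E) ?z" using closed_cycle_chain fin cycle by blast
    have h0: "h (\<lambda>e. 0) = 0" using insert.prems[of "\<lambda>e. 0" "\<lambda>e. 0"] by simp
    have hdiff: "h (\<lambda>x. c x - d x) = h c - h d"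
      if "closed_chain (insert e E) c" "closed_chain (insert e E) d" for c d
      using insert.prems[of "\<lambda>x. c x - d x" d] closed_chain_diff[OF that] that by simp
    have hmult: "h (\<lambda>e. k * ?z e) = int_scale k (h ?z)" for k
    proof (induction k rule: int_induct[where k = 0])
      case (step1 i)
      have "h (\<lambda>e. i * ?z e + ?z e) = int_scale i (h ?z) + h ?z"
        using insert.prems closed_chain_mult z step1 by simp
      then show ?case by (simp add: int_scale_add distrib_right)
    next
      case (step2 i)
      have "h (\<lambda>e. i * ?z e - ?z e) = int_scale i (h ?z) - h ?z"
        using hdiff closed_chain_mult z step2 by simp
      then show ?case by (simp add: int_scale_diff left_diff_distrib)
    qed (simp add: h0)
    \<comment> \<open>The value at \<open>e\<close> is forced: the cycle \<open>p\<close>, whose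
      coefficient at \<open>e\<close> is 1, has to obtain the value \<open>h ?z\<close>.\<close>
    define \<psi> where "\<psi> = \<phi>(e := h ?z - pairing E \<phi> ?z)"
    have \<psi>: "pairing (insert e E) \<psi> c = int_scale (c e) (h ?z - pairing E \<phi> ?z) + pairing E \<phi> c" for c
    proof -
      have "pairing (insert e E) \<psi> c = int_scale (c e) (\<psi> e) + pairing E \<psi> c"
        unfolding pairing_def using insert by simp
      moreover have "pairing E \<psi> c = pairing E \<phi> c"
        unfolding pairing_def \<psi>_def by (rule sum.cong) (use insert in auto)
      ultimately show ?thesis by (simp add: \<psi>_def)
    qed
    have "pairing (insert e E) \<psi> c = h c" if c: "closed_chain (insert e E) c" for c
    proof -
      let ?d = "\<lambda>f. c f - c e * ?z f"
      have d: "closed_chain (insert e E) ?d" using c z by (intro closed_chain_diff closed_chain_mult)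
      then have "closed_chain E ?d"
        by (rule closed_chain_remove[OF insert.hyps(1)]) (simp add: cycle)
      then have "pairing E \<phi> ?d = h ?d" using \<phi> by blast
      also have "h ?d = h c - int_scale (c e) (h ?z)" using hdiff[OF c closed_chain_mult[OF z]] hmult by simp
      also have "pairing E \<phi> ?d = pairing E \<phi> c - int_scale (c e) (pairing E \<phi> ?z)"
        by (simp only: pairing_diff pairing_mult)
      finally show ?thesis unfolding \<psi> by (simp add: int_scale_diff_right algebra_simps)
    qed
    moreover have "\<forall>f. f \<notin> insert e E \<longrightarrow> \<psi> f = 0" using \<phi>(1) by (auto simp: \<psi>_def)
    ultimately show ?thesis by blast
  qed
qed

section \<open>Winding numbers of closed chains\<close>

definition ends :: "(nat \<times> nat) set \<Rightarrow> vertex set" where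
  "ends D = (\<Union>e\<in>D. {White (fst e), Black (snd e)})"

lemma ends_mono: "D \<subseteq> D' \<Longrightarrow> ends D \<subseteq> ends D'"
  by (auto simp: ends_def)

lemma ends_insert: "ends (insert e D) = {White (fst e), Black (snd e)} \<union> ends D"
  by (simp add: ends_def)

lemma ends_empty [simp]: "ends {} = {}"
  by (simp add: ends_def)

lemma edge_between_ends: "edge_between u v = Some e \<Longrightarrow> {White (fst e), Black (snd e)} = {u, v}"
  by (auto simp: edge_between_Some)

lemma ends_path_edges:
  "successively (adj E) p \<Longrightarrow> length p \<ge> 2 \<Longrightarrow> ends (path_edges p) = set p"
proof (induction p rule: path_edges.induct)
  case (1 u v p)
  then obtain e where e: "edge_between u v = Some e" by (auto simp: adj_def)
  show ?case
  proof (cases p)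
    case Nil
    then show ?thesis using edge_between_ends[OF e] e by (simp add: ends_insert)
  next
    case (Cons w r)
    then have "ends (path_edges (v # p)) = set (v # p)" using 1 by simp
    then show ?thesis using edge_between_ends[OF e] e by (auto simp: ends_insert)
  qed
qed auto

lemma ends_cyc_edges:
  assumes "is_cyc E C" shows "ends (cyc_edges C) = set C"
proof -
  obtain e where e: "edge_between (last C) (hd C) = Some e" using assms by (auto simp: is_cyc_def adj_def)
  have "C \<noteq> []" "length C \<ge> 2" "successively (adj E) C" using assms by (auto simp: is_cyc_def upath_def)
  then have "ends (path_edges C) = set C" "C \<noteq> []" using ends_path_edges by blast+
  then show ?thesis using edge_between_ends[OF e] e by (simp add: cyc_edges_def ends_insert insert_absorb)
qed

section \<open>Edge sets as subsets of the plane\<close>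

locale plane_graph =
  fixes G :: bigraph
  assumes plane: "plane_bigraph G"
begin

lemma
  shows edges_subset: "edges G \<subseteq> whites G \<times> blacks G"
    and finite_edges: "finite (edges G)"
    and finite_vertices: "finite (vertices G)"
    and inj_place: "inj_on (place G) (vertices G)"
proof -
  note p = plane[unfolded plane_bigraph_def]
  have fin: "finite (whites G)" "finite (blacks G)" and sub: "edges G \<subseteq> whites G \<times> blacks G"
    and inj: "inj_on (place G) (vertices G)"
    by (rule p[THEN conjunct1] p[THEN conjunct2, THEN conjunct1] p[THEN conjunct2, THEN conjunct2, THEN conjunct1]
        p[THEN conjunct2, THEN conjunct2, THEN conjunct2, THEN conjunct1])+
  show "edges G \<subseteq> whites G \<times> blacks G" by (rule sub)
  show "finite (edges G)" by (rule finite_subset[OF sub]) (simp add: fin)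
  show "finite (vertices G)" by (simp add: vertices_def fin)
  show "inj_on (place G) (vertices G)" by (rule inj)
qed

lemma edge_curve:
  assumes "e \<in> edges G"
  shows "arc (curve G e)" "pathstart (curve G e) = place G (Black (snd e))"
    "pathfinish (curve G e) = place G (White (fst e))"
    "path_image (curve G e) \<inter> place G ` vertices G = {place G (White (fst e)), place G (Black (snd e))}"
proof -
  obtain i j where e: "e = (i, j)" by (cases e)
  have "\<forall>(i, j) \<in> edges G.
        arc (curve G (i, j)) \<and>
        pathstart (curve G (i, j)) = place G (Black j) \<and>
        pathfinish (curve G (i, j)) = place G (White i) \<and>
        path_image (curve G (i, j)) \<inter> place G ` vertices G
          = {place G (White i), place G (Black j)}"
    by (rule plane[unfolded plane_bigraph_def, THEN conjunct2, THEN conjunct2, THEN conjunct2, THEN conjunct2, THEN conjunct1])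
  from bspec[OF this assms] show "arc (curve G e)" "pathstart (curve G e) = place G (Black (snd e))"
    "pathfinish (curve G e) = place G (White (fst e))"
    "path_image (curve G e) \<inter> place G ` vertices G = {place G (White (fst e)), place G (Black (snd e))}"
    by (simp_all add: e)
qed

lemma edge_cross:
  "e \<in> edges G \<Longrightarrow> e' \<in> edges G \<Longrightarrow> e \<noteq> e' \<Longrightarrow>
    path_image (curve G e) \<inter> path_image (curve G e') \<subseteq> place G ` vertices G"
  using plane[unfolded plane_bigraph_def, THEN conjunct2, THEN conjunct2, THEN conjunct2, THEN conjunct2, THEN conjunct2]
  by blast

lemma ends_vertices: "D \<subseteq> edges G \<Longrightarrow> ends D \<subseteq> vertices G"
  using edges_subset by (force simp: ends_def vertices_def)

lemma closed_chains_iff: "c \<in> closed_chains G \<longleftrightarrow> closed_chain (edges G) c"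
  using closed_chains_eq[OF finite_edges edges_subset] by simp

definition img :: "(nat \<times> nat) set \<Rightarrow> complex set" where
  "img D = (\<Union>e\<in>D. path_image (curve G e))"

lemma img_mono: "D \<subseteq> D' \<Longrightarrow> img D \<subseteq> img D'"
  by (auto simp: img_def)

lemma img_insert: "img (insert e D) = path_image (curve G e) \<union> img D"
  by (auto simp: img_def)

lemma img_Un: "img (D \<union> D') = img D \<union> img D'"
  by (auto simp: img_def)

lemma img_empty [simp]: "img {} = {}"
  by (simp add: img_def)

lemma compact_img: "D \<subseteq> edges G \<Longrightarrow> compact (img D)"
  unfolding img_def using finite_subset[OF _ finite_edges] edge_curve(1)
  by (intro compact_UN compact_arc_image) blast+

lemma vertex_in_img:
  assumes "D \<subseteq> edges G" "v \<in> vertices G"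
  shows "place G v \<in> img D \<longleftrightarrow> v \<in> ends D"
proof
  assume "place G v \<in> img D"
  then obtain e where e: "e \<in> D" "place G v \<in> path_image (curve G e)" by (auto simp: img_def)
  then have "place G v \<in> {place G (White (fst e)), place G (Black (snd e))}"
    using edge_curve(4)[of e] assms by blast
  moreover have "White (fst e) \<in> vertices G" "Black (snd e) \<in> vertices G"
    using ends_vertices[OF assms(1)] e(1) by (auto simp: ends_def)
  ultimately have "v = White (fst e) \<or> v = Black (snd e)"
    using inj_place assms(2) by (auto simp: inj_on_def)
  then show "v \<in> ends D" using e(1) by (auto simp: ends_def)
next
  assume "v \<in> ends D"
  then obtain e where "e \<in> D" "v = White (fst e) \<or> v = Black (snd e)" by (auto simp: ends_def)
  then show "place G v \<in> img D"
    using edge_curve(4)[of e] assms unfolding img_def by blast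
qed

text \<open>Distinct edges meet only in vertices, and a vertex lying on an edge is one of its
  ends.\<close>

lemma img_Int:
  assumes "D \<subseteq> edges G" "D' \<subseteq> edges G" "D \<inter> D' = {}"
  shows "img D \<inter> img D' \<subseteq> place G ` (ends D \<inter> ends D')"
proof
  fix x assume x: "x \<in> img D \<inter> img D'"
  then obtain e e' where e: "e \<in> D" "x \<in> path_image (curve G e)" and e': "e' \<in> D'" "x \<in> path_image (curve G e')"
    by (auto simp: img_def)
  then have "x \<in> place G ` vertices G" using edge_cross[of e e'] assms by blast
  then obtain v where v: "v \<in> vertices G" "x = place G v" by blast
  then show "x \<in> place G ` (ends D \<inter> ends D')" using x vertex_in_img assms by auto
qed

text \<open>The sum inside \<open>chain_winding\<close>, kept complex because a single arc may
  contribute a number that is not an integer. It is linear in the chain without further conditions,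
  and for closed chains it is an integer by \<open>wind_integer\<close>.\<close>

definition wind :: "(nat \<times> nat \<Rightarrow> int) \<Rightarrow> complex \<Rightarrow> complex" where
  "wind c z = (\<Sum>e\<in>edges G. of_int (c e) * winding_number (curve G e) z)"

lemma wind_add: "wind (\<lambda>e. c e + d e) z = wind c z + wind d z"
  by (simp add: wind_def distrib_right sum.distrib)

lemma wind_mult: "wind (\<lambda>e. k * c e) z = of_int k * wind c z"
  by (simp add: wind_def mult.assoc sum_distrib_left)

lemma wind_diff: "wind (\<lambda>e. c e - d e) z = wind c z - wind d z"
  by (simp add: wind_def left_diff_distrib sum_subtractf)

lemma wind_sum: "wind (\<lambda>e. \<Sum>a\<in>A. f a e) z = (\<Sum>a\<in>A. wind (f a) z)"
  unfolding wind_def of_int_sum sum_distrib_right by (rule sum.swap)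

lemma wind_zero [simp]: "wind (\<lambda>e. 0) z = 0"
  by (simp add: wind_def)

section \<open>Arcs and loops traced by paths and cycles\<close>

definition step_path :: "vertex \<Rightarrow> vertex \<Rightarrow> real \<Rightarrow> complex" where
  "step_path u v = (let e = the (edge_between u v) in
     if u = Black (snd e) then curve G e else reversepath (curve G e))"

lemma step_path:
  assumes "e \<in> edges G" "edge_between u v = Some e"
  shows "arc (step_path u v)" "pathstart (step_path u v) = place G u"
    "pathfinish (step_path u v) = place G v" "path_image (step_path u v) = path_image (curve G e)"
    "z \<notin> path_image (curve G e) \<Longrightarrow> winding_number (step_path u v) z =
       (if u = Black (snd e) then 1 else - 1) * winding_number (curve G e) z"
proof -
  note c = edge_curve(1-3)[OF assms(1)]
  have path: "path (curve G e)" using c(1) by (rule arc_imp_path)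
  have "u = Black (snd e) \<and> v = White (fst e) \<or> u = White (fst e) \<and> v = Black (snd e)"
    using assms(2) edge_between_Some by blast
  then have *: "arc (step_path u v) \<and> pathstart (step_path u v) = place G u \<and>
    pathfinish (step_path u v) = place G v \<and> path_image (step_path u v) = path_image (curve G e) \<and>
    (z \<notin> path_image (curve G e) \<longrightarrow> winding_number (step_path u v) z =
       (if u = Black (snd e) then 1 else - 1) * winding_number (curve G e) z)" (is ?P)
  proof
    assume "u = Black (snd e) \<and> v = White (fst e)"
    then show ?P using c by (simp add: step_path_def assms(2))
  next
    assume "u = White (fst e) \<and> v = Black (snd e)"
    then show ?P using c path
      by (simp add: step_path_def assms(2) arc_reversepath winding_number_reversepath)
  qed
  then show "arc (step_path u v)" "pathstart (step_path u v) = place G u"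
    "pathfinish (step_path u v) = place G v" "path_image (step_path u v) = path_image (curve G e)"
    "z \<notin> path_image (curve G e) \<Longrightarrow> winding_number (step_path u v) z =
       (if u = Black (snd e) then 1 else - 1) * winding_number (curve G e) z" by blast+
qed

text \<open>The recursion stops at a single edge, not at a single vertex: joining a constant path at
  the end would spoil injectivity, and the result has to be an arc.\<close>

fun list_path :: "vertex list \<Rightarrow> real \<Rightarrow> complex" where
  "list_path (u # v # w # p) = step_path u v +++ list_path (v # w # p)"
| "list_path [u, v] = step_path u v"
| "list_path p = undefined"

lemma wind_step:
  assumes "e \<in> edges G" "edge_between u v = Some e"
  shows "wind (\<lambda>d. of_bool (u = Black (snd d) \<and> v = White (fst d))
      - of_bool (u = White (fst d) \<and> v = Black (snd d))) z
    = (if u = Black (snd e) then 1 else - 1) * winding_number (curve G e) z"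
proof -
  have *: "of_bool (u = Black (snd d) \<and> v = White (fst d)) - of_bool (u = White (fst d) \<and> v = Black (snd d))
      = (if d = e then (if u = Black (snd e) then 1 else - 1) else (0 :: int))" for d
    using assms(2) by (auto simp: edge_between_Some prod_eq_iff)
  have "wind (\<lambda>d. if d = e then k else 0) z = of_int k * winding_number (curve G e) z" for k
    unfolding wind_def using assms(1) finite_edges
    by (subst sum.remove[of _ e]) (auto intro!: sum.neutral)
  then show ?thesis unfolding * by simp
qed

text \<open>The first edge meets the image of the remaining path only in the common vertex
  \<open>v\<close>, because \<open>u\<close> does not occur in the rest and distinct edges meet only
  in common ends. So the join is again an arc, and the winding numbers add up.\<close>

lemma list_path:
  assumes "upath (edges G) p" "length p \<ge> 2"
  shows "arc (list_path p) \<and> pathstart (list_path p) = place G (hd p) \<and>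
    pathfinish (list_path p) = place G (last p) \<and> path_image (list_path p) = img (path_edges p) \<and>
    (\<forall>z. z \<notin> img (path_edges p) \<longrightarrow> winding_number (list_path p) z = wind (list_chain p) z)"
  using assms
proof (induction p rule: list_path.induct)
  case (1 u v w p)
  let ?q = "v # w # p"
  have q: "adj (edges G) u v" "u \<notin> set ?q" "upath (edges G) ?q" using 1 by (auto simp: upath_Cons2)
  obtain e where e: "e \<in> edges G" "edge_between u v = Some e" using q(1) by (auto simp: adj_def)
  note s = step_path[OF e]
  have IH: "arc (list_path ?q)" "pathstart (list_path ?q) = place G v"
    "pathfinish (list_path ?q) = place G (last ?q)" "path_image (list_path ?q) = img (path_edges ?q)"
    "\<And>z. z \<notin> img (path_edges ?q) \<Longrightarrow> winding_number (list_path ?q) z = wind (list_chain ?q) z"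
    using 1(1)[OF q(3)] by (simp_all del: path_edges.simps list_chain.simps list_path.simps)
  have qe: "ends (path_edges ?q) = set ?q" "path_edges ?q \<subseteq> edges G"
    using q(3) upath_edges_subset[OF q(3)] ends_path_edges[of "edges G" ?q] by (simp_all add: upath_def del: path_edges.simps)
  have "e \<notin> path_edges ?q"
    using qe(1) q(2) e(2) unfolding ends_def edge_between_Some by blast
  then have "path_image (curve G e) \<inter> img (path_edges ?q) \<subseteq> place G ` ({u, v} \<inter> set ?q)"
    using img_Int[of "{e}" "path_edges ?q"] qe e edge_between_ends[OF e(2)]
    by (simp add: img_insert ends_insert)
  then have cap: "path_image (step_path u v) \<inter> path_image (list_path ?q) \<subseteq> {place G v}"
    using q(2) s IH by auto
  have "arc (list_path (u # ?q))"
    unfolding list_path.simps using s IH cap by (intro arc_join) auto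
  moreover have "path_image (list_path (u # ?q)) = img (path_edges (u # ?q))"
    using s IH e by (simp add: path_image_join img_insert Un_assoc)
  moreover have "winding_number (list_path (u # ?q)) z = wind (list_chain (u # ?q)) z"
    if "z \<notin> img (path_edges (u # ?q))" for z
  proof -
    have z: "z \<notin> path_image (curve G e)" "z \<notin> img (path_edges ?q)" using that e by (auto simp: img_insert)
    have "winding_number (list_path (u # ?q)) z = winding_number (step_path u v) z + winding_number (list_path ?q) z"
      unfolding list_path.simps using s IH z by (intro winding_number_join) (auto simp: arc_imp_path)
    moreover have "wind (list_chain (u # ?q)) z = wind (\<lambda>d. of_bool (u = Black (snd d) \<and> v = White (fst d))
      - of_bool (u = White (fst d) \<and> v = Black (snd d))) z + wind (list_chain ?q) z"
      by (simp only: list_chain.simps(1)[abs_def] wind_add[symmetric])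
    ultimately show ?thesis using IH(5)[OF z(2)] s(5)[OF z(1)] wind_step[OF e, of z] by simp
  qed
  ultimately show ?case using s IH by (simp del: list_chain.simps path_edges.simps)
next
  case (2 u v)
  then obtain e where e: "e \<in> edges G" "edge_between u v = Some e" by (auto simp: adj_def upath_def)
  have "list_chain [u, v] = (\<lambda>d. of_bool (u = Black (snd d) \<and> v = White (fst d))
      - of_bool (u = White (fst d) \<and> v = Black (snd d)))" by auto
  then show ?case using step_path[OF e] wind_step[OF e] e by (simp add: img_insert)
qed auto

definition loop_path :: "vertex list \<Rightarrow> real \<Rightarrow> complex" where
  "loop_path C = list_path C +++ step_path (last C) (hd C)"

lemma loop_path:
  assumes "is_cyc (edges G) C"
  shows "simple_path (loop_path C)" "pathfinish (loop_path C) = pathstart (loop_path C)"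
    "path_image (loop_path C) = img (cyc_edges C)"
    "z \<notin> img (cyc_edges C) \<Longrightarrow> winding_number (loop_path C) z = wind (cycle_chain C) z"
proof -
  have C: "upath (edges G) C" "length C \<ge> 2" "C \<noteq> []" using assms by (auto simp: is_cyc_def)
  obtain e where e: "e \<in> edges G" "edge_between (last C) (hd C) = Some e"
    using assms by (auto simp: is_cyc_def adj_def)
  note l = list_path[OF C(1,2)]
  note s = step_path[OF e]
  have "e \<notin> path_edges C" using closing_edge_notin[OF assms] e by simp
  then have cap: "img (path_edges C) \<inter> path_image (curve G e) \<subseteq> {place G (hd C), place G (last C)}"
    using img_Int[of "path_edges C" "{e}"] upath_edges_subset[OF C(1)] e(1) edge_between_ends[OF e(2)]
    by (auto simp: img_insert ends_insert)
  show "simple_path (loop_path C)" unfolding loop_path_def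
    using l s cap by (intro simple_path_join_loop) auto
  show "pathfinish (loop_path C) = pathstart (loop_path C)" unfolding loop_path_def using l s by simp
  show im: "path_image (loop_path C) = img (cyc_edges C)"
    unfolding loop_path_def cyc_edges_def using l s e by (subst path_image_join) (auto simp: img_insert)
  assume z: "z \<notin> img (cyc_edges C)"
  then have z': "z \<notin> img (path_edges C)" "z \<notin> path_image (curve G e)"
    using e by (auto simp: cyc_edges_def img_insert)
  have "cycle_chain C = (\<lambda>d. list_chain C d + (of_bool (last C = Black (snd d) \<and> hd C = White (fst d))
      - of_bool (last C = White (fst d) \<and> hd C = Black (snd d))))"
    using cycle_chain_eq[OF C(3)] by auto
  then have "wind (cycle_chain C) z = wind (list_chain C) z +
      wind (\<lambda>d. of_bool (last C = Black (snd d) \<and> hd C = White (fst d))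
      - of_bool (last C = White (fst d) \<and> hd C = Black (snd d))) z"
    by (simp only: wind_add)
  moreover have "winding_number (loop_path C) z = winding_number (list_path C) z + winding_number (step_path (last C) (hd C)) z"
    unfolding loop_path_def using l s z' by (intro winding_number_join) (auto simp: arc_imp_path)
  ultimately show "winding_number (loop_path C) z = wind (cycle_chain C) z"
    using l s(5)[OF z'(2)] wind_step[OF e] z' by simp
qed

lemma cycle_image_eq:
  assumes "is_cyc E C" shows "cycle_image G C = img (cyc_edges C)"
proof -
  have ne: "C \<noteq> []" using assms by (auto simp: is_cyc_def)
  show ?thesis unfolding cycle_image_def cyc_edges_def cycle_nth_cases(1)[OF ne] img_insert
    using cycle_nth_cases(2,3)[OF ne] ne
    by (simp add: path_edges_nth img_def last_conv_nth)
qed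

text \<open>A simple loop has winding number 1 throughout its inside or -1 throughout, and 0
  outside. The sign reflects the direction of the vertex list and is left undetermined.\<close>

lemma cycle_wind:
  assumes "is_cyc (edges G) C"
  obtains \<epsilon> :: int where "\<epsilon> = 1 \<or> \<epsilon> = - 1"
    "\<And>z. z \<notin> img (cyc_edges C) \<Longrightarrow> wind (cycle_chain C) z = of_int \<epsilon> * of_bool (z \<in> inside (img (cyc_edges C)))"
proof -
  note l = loop_path[OF assms]
  have out: "wind (cycle_chain C) z = 0" if "z \<notin> img (cyc_edges C)" "z \<notin> inside (img (cyc_edges C))" for z
  proof -
    have "z \<in> inside (img (cyc_edges C)) \<union> outside (img (cyc_edges C))"
      unfolding inside_Un_outside using that(1) by simp
    then have "z \<in> outside (path_image (loop_path C))" using that(2) unfolding l(3) by blast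
    then have "winding_number (loop_path C) z = 0"
      using l by (intro winding_number_zero_in_outside) (auto simp: simple_path_imp_path)
    then show ?thesis using l(4) that by simp
  qed
  consider "\<And>z. z \<in> inside (img (cyc_edges C)) \<Longrightarrow> winding_number (loop_path C) z = 1"
    | "\<And>z. z \<in> inside (img (cyc_edges C)) \<Longrightarrow> winding_number (loop_path C) z = - 1"
    using simple_closed_path_winding_number_inside[OF l(1)] l(3) by metis
  then show ?thesis
  proof cases
    case 1 then show ?thesis using that[of 1] out l(4) by fastforce
  next
    case 2 then show ?thesis using that[of "-1"] out l(4) by fastforce
  qed
qed

section \<open>Winding numbers of closed chains as functions of the point\<close>

lemma connected_inside_iff:
  assumes "connected S" "S \<inter> J = {}" "x \<in> S" "y \<in> S"
  shows "x \<in> inside J \<longleftrightarrow> y \<in> inside J"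
proof -
  have "connected_component (- J) x y"
    unfolding connected_component_def using assms by (intro exI[of _ S]) auto
  then show ?thesis using inside_same_component connected_component_sym by blast
qed

lemma closed_chain_support:
  assumes "closed_chain (edges G) c" shows "closed_chain {e. c e \<noteq> 0} c" "{e. c e \<noteq> 0} \<subseteq> edges G"
proof -
  show "{e. c e \<noteq> 0} \<subseteq> edges G" using closed_chain_outside[OF assms] by blast
  then show "closed_chain {e. c e \<noteq> 0} c"
    using closed_chain_superset[OF finite_edges, of "{e. c e \<noteq> 0}" c] assms by blast
qed

text \<open>Only the edges with nonzero coefficient have to be avoided, so the induction over cycles
  takes place in the set of these edges. The same weak condition in \<open>wind_connected\<close>
  permits crossing an edge of the graph on which the chain vanishes.\<close>

lemma wind_integer:
  assumes "closed_chain (edges G) c" "z \<notin> img {e. c e \<noteq> 0}"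
  shows "\<exists>w :: int. wind c z = of_int w"
proof -
  let ?D = "{e. c e \<noteq> 0}"
  note D = closed_chain_support[OF assms(1)]
  have "wind c z \<in> \<int>"
    using finite_subset[OF D(2) finite_edges] D(1)
  proof (induction rule: closed_chain_induct)
    case (add c k C)
    obtain \<epsilon> :: int where "\<And>z. z \<notin> img (cyc_edges C) \<Longrightarrow> wind (cycle_chain C) z = of_int \<epsilon> * of_bool (z \<in> inside (img (cyc_edges C)))"
      using cycle_wind is_cyc_mono[OF add.hyps(2) D(2)] by blast
    moreover have "z \<notin> img (cyc_edges C)" using assms(2) img_mono[OF cyc_edges_subset[OF add.hyps(2)]] by blast
    ultimately show ?case using add by (simp add: wind_add wind_mult)
  qed simp
  then show ?thesis by (auto elim: Ints_cases)
qed

lemma wind_connected: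
  assumes "closed_chain (edges G) c" "connected S" "S \<inter> img {e. c e \<noteq> 0} = {}" "x \<in> S" "y \<in> S"
  shows "wind c x = wind c y"
proof -
  let ?D = "{e. c e \<noteq> 0}"
  note D = closed_chain_support[OF assms(1)]
  show "wind c x = wind c y"
    using finite_subset[OF D(2) finite_edges] D(1)
  proof (induction rule: closed_chain_induct)
    case (add c k C)
    obtain \<epsilon> :: int where *: "\<And>z. z \<notin> img (cyc_edges C) \<Longrightarrow> wind (cycle_chain C) z = of_int \<epsilon> * of_bool (z \<in> inside (img (cyc_edges C)))"
      using cycle_wind is_cyc_mono[OF add.hyps(2) D(2)] by blast
    have S: "S \<inter> img (cyc_edges C) = {}" using assms(3) img_mono[OF cyc_edges_subset[OF add.hyps(2)]] by blast
    then have "x \<notin> img (cyc_edges C)" "y \<notin> img (cyc_edges C)" using assms by auto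
    then show ?case using add * connected_inside_iff[OF assms(2) S assms(4,5)]
      by (simp add: wind_add wind_mult)
  qed simp
qed

text \<open>An unbounded connected set that avoids a loop cannot meet its inside, which is bounded;
  so every cycle in a decomposition of the chain contributes 0.\<close>

lemma wind_unbounded:
  assumes "closed_chain (edges G) c" "connected S" "S \<inter> img {e. c e \<noteq> 0} = {}" "x \<in> S" "\<not> bounded S"
  shows "wind c x = 0"
proof -
  let ?D = "{e. c e \<noteq> 0}"
  note D = closed_chain_support[OF assms(1)]
  show "wind c x = 0"
    using finite_subset[OF D(2) finite_edges] D(1)
  proof (induction rule: closed_chain_induct)
    case (add c k C)
    have cyc: "is_cyc (edges G) C" using is_cyc_mono[OF add.hyps(2) D(2)] .
    obtain \<epsilon> :: int where *: "\<And>z. z \<notin> img (cyc_edges C) \<Longrightarrow> wind (cycle_chain C) z = of_int \<epsilon> * of_bool (z \<in> inside (img (cyc_edges C)))"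
      using cycle_wind cyc by blast
    have S: "S \<inter> img (cyc_edges C) = {}" using assms(3) img_mono[OF cyc_edges_subset[OF add.hyps(2)]] by blast
    have "x \<notin> inside (img (cyc_edges C))"
    proof
      assume "x \<in> inside (img (cyc_edges C))"
      then have "S \<subseteq> inside (img (cyc_edges C))"
        using connected_inside_iff[OF assms(2) S assms(4)] by blast
      moreover have "bounded (inside (img (cyc_edges C)))"
        using Jordan_inside_outside[OF loop_path(1,2)[OF cyc]] loop_path(3)[OF cyc] by simp
      ultimately show False using assms(5) bounded_subset by blast
    qed
    moreover have "x \<notin> img (cyc_edges C)" using S assms by auto
    ultimately show ?case using add * by (simp add: wind_add wind_mult)
  qed simp
qed

definition supp :: "(nat \<times> nat) set \<Rightarrow> complex set" where
  "supp D = place G ` vertices G \<union> img D"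

lemma support_eq: "Defs.support G = supp (edges G)"
  by (simp add: Defs.support_def supp_def img_def)

lemma compact_supp: "D \<subseteq> edges G \<Longrightarrow> compact (supp D)"
  unfolding supp_def using finite_vertices compact_img by (intro compact_Un) (auto intro: finite_imp_compact)

lemma chain_winding_eq: "wind c z = of_int w \<Longrightarrow> chain_winding G c z = w"
  by (simp add: chain_winding_def wind_def[symmetric])

lemma of_int_chain_winding:
  assumes "closed_chain (edges G) c" "z \<notin> img {e. c e \<noteq> 0}"
  shows "of_int (chain_winding G c z) = wind c z"
  using wind_integer[OF assms] chain_winding_eq by fastforce

text \<open>The points \<open>x\<close> and \<open>y\<close> are taken on the two sides of \<open>e\<close>, where the winding numbers of \<open>c\<close>
  differ by \<open>\<plusminus> c e\<close>: subtracting a multiple of \<open>C\<close> from \<open>c\<close> removes the edge \<open>e\<close>.\<close>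

lemma wind_jump:
  assumes c: "closed_chain (edges G) c" and C: "is_cyc (edges G) C" and e: "e \<in> cyc_edges C" and ce: "c e \<noteq> 0"
  obtains x y where "x \<notin> supp (edges G)" "y \<notin> supp (edges G)" "wind c x \<noteq> wind c y"
proof -
  have eE: "e \<in> edges G" using cyc_edges_subset[OF C] e by auto
  let ?J = "img (cyc_edges C)"
  note l = loop_path[OF C]
  \<comment> \<open>An inner point of the arc: it is no vertex and lies on no other edge, so a small
    ball around it meets the graph only in \<open>e\<close>.\<close>
  define p where "p = curve G e (1 / 2)"
  have inj: "inj_on (curve G e) {0..1}" using edge_curve(1)[OF eE] by (simp add: arc_def)
  have "p \<noteq> curve G e 0" "p \<noteq> curve G e 1"
    unfolding p_def using inj by (auto simp: inj_on_def) force+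
  then have pne: "p \<noteq> place G (Black (snd e))" "p \<noteq> place G (White (fst e))"
    using edge_curve(2,3)[OF eE] by (auto simp: pathstart_def pathfinish_def)
  have pim: "p \<in> path_image (curve G e)" by (simp add: p_def path_image_def)
  have pv: "p \<notin> place G ` vertices G" using edge_curve(4)[OF eE] pne pim by auto
  have "p \<notin> img (edges G - {e})" using pim pv edge_cross[OF eE] by (fastforce simp: img_def)
  then have "p \<notin> supp (edges G - {e})" using pv by (simp add: supp_def)
  moreover have "closed (supp (edges G - {e}))" by (intro compact_imp_closed compact_supp) auto
  ultimately obtain r where r: "r > 0" "ball p r \<subseteq> - supp (edges G - {e})"
    by (metis ComplI openE open_Compl)
  have pJ: "p \<in> ?J" using pim e by (auto simp: img_def)
  \<comment> \<open>By the Jordan curve theorem every point of the loop is a boundary point of both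
    sides, which provides \<open>x\<close> inside and \<open>y\<close> outside within the
    ball.\<close>
  then have "p \<in> frontier (inside ?J)" "p \<in> frontier (outside ?J)"
    using Jordan_inside_outside[OF l(1,2)] l(3) by auto
  then have "p \<in> closure (inside ?J)" "p \<in> closure (outside ?J)" by (simp_all add: frontier_def)
  then obtain x y where x: "x \<in> inside ?J" "dist x p < r" and y: "y \<in> outside ?J" "dist y p < r"
    using r(1) by (meson closure_approachable)
  have xy: "x \<in> ball p r" "y \<in> ball p r" using x y by (auto simp: dist_commute)
  have xJ: "x \<notin> ?J" "y \<notin> ?J" "y \<notin> inside ?J"
    using x(1) y(1) inside_no_overlap[of ?J] outside_no_overlap[of ?J] inside_Int_outside[of ?J] by blast+
  have eJ: "path_image (curve G e) \<subseteq> ?J" using e by (auto simp: img_def)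
  have su: "supp (edges G) = supp (edges G - {e}) \<union> path_image (curve G e)"
    using eE by (auto simp: supp_def img_def)
  have xys: "x \<notin> supp (edges G)" "y \<notin> supp (edges G)"
    using xy r(2) xJ eJ su by auto
  \<comment> \<open>The number \<open>cycle_chain C e\<close> is 1 or -1, hence its own inverse, and
    \<open>d e = 0\<close>. So the ball avoids all edges of \<open>d\<close>, and the winding number
    of \<open>d\<close> is constant on it.\<close>
  define d where "d = (\<lambda>f. c f - c e * cycle_chain C e * cycle_chain C f)"
  have cc: "closed_chain (edges G) (cycle_chain C)" using closed_cycle_chain[OF finite_edges C] .
  have d: "closed_chain (edges G) d"
    unfolding d_def by (intro closed_chain_diff closed_chain_mult c cc)
  have Ce: "cycle_chain C e = 1 \<or> cycle_chain C e = - 1" using cycle_chain_values[OF C, of e] e by simp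
  then have "d e = 0" by (auto simp: d_def)
  then have "{f. d f \<noteq> 0} \<subseteq> edges G - {e}" using closed_chain_outside[OF d] by auto
  then have "img {f. d f \<noteq> 0} \<subseteq> supp (edges G - {e})" unfolding supp_def using img_mono by blast
  then have eqd: "wind d x = wind d y"
    using r(2) xy by (intro wind_connected[OF d, of "ball p r"]) auto
  obtain \<epsilon> :: int where \<epsilon>: "\<epsilon> = 1 \<or> \<epsilon> = - 1"
    "\<And>z. z \<notin> ?J \<Longrightarrow> wind (cycle_chain C) z = of_int \<epsilon> * of_bool (z \<in> inside ?J)"
    using cycle_wind[OF C] by blast
  have "wind d z = wind c z - of_int (c e * cycle_chain C e) * wind (cycle_chain C) z" for z
    unfolding d_def by (simp only: wind_diff wind_mult)
  then have wc: "wind c z = wind d z + of_int (c e * cycle_chain C e) * wind (cycle_chain C) z" for z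
    by simp
  have "wind c x - wind c y = of_int (c e * cycle_chain C e * \<epsilon>)"
    unfolding wc[of x] wc[of y] using eqd \<epsilon>(2)[of x] \<epsilon>(2)[of y] xJ x(1) by simp
  moreover have "c e * cycle_chain C e * \<epsilon> \<noteq> 0" using Ce \<epsilon>(1) ce by auto
  ultimately have "wind c x \<noteq> wind c y" by (metis diff_self of_int_eq_0_iff)
  then show ?thesis using that xys by blast
qed

text \<open>A nonzero coefficient puts the edge on a cycle, since bridges have coefficient 0, and
  then \<open>wind_jump\<close> gives two points with different winding numbers. Closed chains are
  thus determined by their winding numbers, which makes face boundaries unique.\<close>

lemma wind_zero_imp_zero:
  assumes "closed_chain (edges G) c" "\<And>z. z \<notin> supp (edges G) \<Longrightarrow> wind c z = 0"
  shows "c = (\<lambda>e. 0)"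
proof
  fix e
  show "c e = 0"
  proof (rule ccontr)
    assume ce: "c e \<noteq> 0"
    then have e: "e \<in> edges G" using closed_chain_outside[OF assms(1)] by blast
    from finite_edges e show False
    proof (cases rule: bridge_or_cycle)
      case bridge then show ?thesis using assms(1) ce by blast
    next
      case (cycle p)
      have "e \<in> cyc_edges p" using cycle_chain_values[OF cycle(4), of e] cycle(5) by (auto split: if_splits)
      then show ?thesis using wind_jump[OF assms(1) cycle(4) _ ce] assms(2) by metis
    qed
  qed
qed

lemma wind_eq_imp_eq:
  assumes "closed_chain (edges G) c" "closed_chain (edges G) d"
    "\<And>z. z \<notin> supp (edges G) \<Longrightarrow> wind c z = wind d z"
  shows "c = d"
proof -
  have "(\<lambda>e. c e - d e) = (\<lambda>e. 0)"
    using assms by (intro wind_zero_imp_zero) (auto simp: wind_diff intro: closed_chain_diff)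
  then show ?thesis by (metis (no_types) eq_iff_diff_eq_0 ext)
qed

end

section \<open>Faces\<close>

context plane_graph
begin

text \<open>Janiszewski's theorem: two closed sets, one of them compact, whose intersection is
  connected do not jointly separate two points that neither of them separates. Here the sets are the
  loop and \<open>supp D\<close>, and they meet in the path \<open>p\<close> without its closing
  edge.\<close>

lemma cycle_separation:
  assumes "D \<subseteq> edges G" "e \<in> edges G" "e \<notin> D"
    and p: "upath D p" "hd p = White (fst e)" "last p = Black (snd e)" "is_cyc (insert e D) p"
    and xy: "connected_component (- supp D) x y" "x \<notin> supp (insert e D)" "y \<notin> supp (insert e D)"
    and side: "x \<in> inside (img (cyc_edges p)) \<longleftrightarrow> y \<in> inside (img (cyc_edges p))"
  shows "connected_component (- supp (insert e D)) x y"
proof -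
  let ?J = "img (cyc_edges p)"
  have ce: "cyc_edges p = insert e (path_edges p)" using p by (simp add: cyc_edges_def)
  have pD: "path_edges p \<subseteq> D" using upath_edges_subset p by blast
  have cyc: "is_cyc (edges G) p" using is_cyc_mono[OF p(4)] assms by auto
  note J = Jordan_inside_outside[OF loop_path(1,2)[OF cyc], unfolded loop_path(3)[OF cyc]]
  have "?J \<subseteq> supp (insert e D)" using pD unfolding ce supp_def by (auto simp: img_def)
  then have xJ: "x \<notin> ?J" "y \<notin> ?J" using xy by auto
  have io: "inside ?J \<union> outside ?J = - ?J" by (rule inside_Un_outside)
  have "connected_component (- ?J) x y"
  proof (cases "x \<in> inside ?J")
    case True
    then have "x \<in> inside ?J \<and> y \<in> inside ?J" using side by blast
    then show ?thesis unfolding connected_component_def using J io by (intro exI[of _ "inside ?J"]) blast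
  next
    case False
    then have "x \<in> outside ?J \<and> y \<in> outside ?J" using side xJ io by blast
    then show ?thesis unfolding connected_component_def using J io by (intro exI[of _ "outside ?J"]) blast
  qed
  moreover have "?J \<inter> supp D = img (path_edges p)"
  proof
    have sub: "img (path_edges p) \<subseteq> supp D" unfolding supp_def using img_mono[OF pD] by blast
    then show "img (path_edges p) \<subseteq> ?J \<inter> supp D" by (auto simp: ce img_insert)
    have en: "{place G (White (fst e)), place G (Black (snd e))} \<subseteq> img (path_edges p)"
    proof -
      have "ends (path_edges p) = set p" "p \<noteq> []"
        using p ends_path_edges[of D p] by (auto simp: upath_def is_cyc_def)
      then have "White (fst e) \<in> ends (path_edges p)" "Black (snd e) \<in> ends (path_edges p)"
        using p(2,3) by (metis hd_in_set, metis last_in_set)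
      moreover have pG: "path_edges p \<subseteq> edges G" using pD assms by auto
      ultimately show ?thesis using vertex_in_img[OF pG] ends_vertices[OF pG] by blast
    qed
    \<comment> \<open>Apart from its two ends the closing edge avoids \<open>supp D\<close>, and
      these ends lie on the path.\<close>
    have "path_image (curve G e) \<inter> img D \<subseteq> place G ` ({White (fst e), Black (snd e)} \<inter> ends D)"
      using img_Int[of "{e}" D] assms by (simp add: img_insert ends_insert)
    then have "path_image (curve G e) \<inter> supp D \<subseteq> img (path_edges p)"
      using edge_curve(4)[OF assms(2)] en unfolding supp_def by blast
    then show "?J \<inter> supp D \<subseteq> img (path_edges p)" by (auto simp: ce img_insert)
  qed
  moreover have "connected (img (path_edges p))"
  proof -
    have up: "upath (edges G) p" "length p \<ge> 2" using p upath_mono assms(1) by (auto simp: is_cyc_def)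
    then show ?thesis using list_path[OF up] connected_path_image arc_imp_path by metis
  qed
  moreover have "compact ?J" using compact_img cyc_edges_subset[OF cyc] by blast
  moreover have "closed (supp D)" using compact_supp assms compact_imp_closed by blast
  ultimately have "connected_component (- (?J \<union> supp D)) x y"
    using Janiszewski xy(1) by metis
  moreover have "?J \<union> supp D = supp (insert e D)"
    using img_mono[OF pD] unfolding ce supp_def img_insert by blast
  ultimately show ?thesis by simp
qed

text \<open>The new edge meets \<open>supp D\<close> in both of its ends, a set that is not
  connected, so Janiszewski's theorem does not apply to these two sets at once. Since the edge is a
  bridge, \<open>supp D\<close> is the disjoint union of a part \<open>S1\<close> containing the
  white end and a part \<open>S2\<close> containing the black one. Adding the edge to
  \<open>S1\<close>, and then \<open>S2\<close> to the result, gives an intersection in one point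
  each time.\<close>

lemma bridge_separation:
  assumes "D \<subseteq> edges G" "e \<in> edges G" "e \<notin> D"
    and br: "\<not> (adj D)\<^sup>*\<^sup>* (White (fst e)) (Black (snd e))"
    and xy: "connected_component (- supp D) x y" "x \<notin> supp (insert e D)" "y \<notin> supp (insert e D)"
  shows "connected_component (- supp (insert e D)) x y"
proof -
  define V1 where "V1 = {v \<in> vertices G. (adj D)\<^sup>*\<^sup>* (White (fst e)) v}"
  define V2 where "V2 = vertices G - V1"
  define D1 where "D1 = {d \<in> D. White (fst d) \<in> V1}"
  define D2 where "D2 = D - D1"
  have V: "V1 \<subseteq> vertices G" "V2 \<subseteq> vertices G" "V1 \<inter> V2 = {}" "V1 \<union> V2 = vertices G" by (auto simp: V1_def V2_def)
  have D12: "D1 \<subseteq> edges G" "D2 \<subseteq> edges G" "D1 \<inter> D2 = {}" "D1 \<union> D2 = D"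
    using assms by (auto simp: D1_def D2_def)
  have endsD: "White (fst d) \<in> vertices G" "Black (snd d) \<in> vertices G" if "d \<in> edges G" for d
    using ends_vertices[of "{d}"] that by (auto simp: ends_insert)
  have same: "White (fst d) \<in> V1 \<longleftrightarrow> Black (snd d) \<in> V1" if "d \<in> D" for d
  proof -
    have a: "adj D (White (fst d)) (Black (snd d))" "adj D (Black (snd d)) (White (fst d))"
      using that by (auto simp: adj_def)
    show ?thesis using endsD[of d] that assms(1) rtranclp.rtrancl_into_rtrancl[of "adj D", OF _ a(1)]
      rtranclp.rtrancl_into_rtrancl[of "adj D", OF _ a(2)] unfolding V1_def by blast
  qed
  have e1: "ends D1 \<subseteq> V1" using same unfolding ends_def D1_def by auto
  have e2: "ends D2 \<subseteq> V2"
    using same endsD D12 unfolding ends_def D1_def D2_def V2_def by auto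
  define S1 where "S1 = place G ` V1 \<union> img D1"
  define S2 where "S2 = place G ` V2 \<union> img D2"
  define A where "A = path_image (curve G e)"
  let ?w = "place G (White (fst e))" and ?b = "place G (Black (snd e))"
  have S12: "S1 \<union> S2 = supp D" unfolding S1_def S2_def supp_def V(4)[symmetric] D12(4)[symmetric] img_Un by blast
  have disj: "S1 \<inter> S2 = {}"
  proof -
    have "place G ` V1 \<inter> place G ` V2 = {}"
      using inj_on_image_Int[OF inj_place V(1,2)] V(3) by simp
    moreover have "place G ` V1 \<inter> img D2 = {}"
      using vertex_in_img[OF D12(2)] V e2 by blast
    moreover have "img D1 \<inter> place G ` V2 = {}"
      using vertex_in_img[OF D12(1)] V e1 by blast
    moreover have "img D1 \<inter> img D2 = {}" using img_Int[OF D12(1-3)] e1 e2 V(3) by blast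
    ultimately show ?thesis unfolding S1_def S2_def by blast
  qed
  have "compact (place G ` V1)" "compact (place G ` V2)"
    using finite_subset[OF V(1) finite_vertices] finite_subset[OF V(2) finite_vertices]
    by (simp_all add: finite_imp_compact)
  then have compS: "compact S1" "compact S2"
    unfolding S1_def S2_def using compact_img D12 by (simp_all add: compact_Un)
  have arcA: "arc (curve G e)" using edge_curve assms by blast
  have "A \<inter> img D \<subseteq> place G ` ({White (fst e), Black (snd e)} \<inter> ends D)"
    unfolding A_def using img_Int[of "{e}" D] assms by (simp add: img_insert ends_insert)
  then have AD: "A \<inter> supp D \<subseteq> {?w, ?b}" "?w \<in> A" "?b \<in> A"
    using edge_curve(4)[OF assms(2)] unfolding supp_def A_def by blast+
  have "White (fst e) \<in> V1" "Black (snd e) \<in> V2" using br endsD[OF assms(2)] by (auto simp: V1_def V2_def)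
  then have wb: "?w \<in> S1" "?b \<in> S2" by (auto simp: S1_def S2_def)
  have suppe: "supp (insert e D) = A \<union> supp D" by (auto simp: supp_def img_insert A_def)
  have mono: "connected_component (- S) x y" if "S \<subseteq> supp D" for S
    using xy(1) that connected_component_mono[of "- supp D" "- S"] by blast
  \<comment> \<open>An arc does not separate the plane.\<close>
  have ccA: "connected_component (- A) x y"
    using connected_arc_complement[OF arcA] xy(2,3) suppe
    unfolding connected_component_def A_def by (intro exI[of _ "- path_image (curve G e)"]) auto
  have cA: "compact A" using compact_arc_image[OF arcA] by (simp add: A_def)
  have "S1 \<inter> A = {?w}" using AD wb disj S12 by blast
  then have "connected (S1 \<inter> A)" by simp
  then have cc: "connected_component (- (S1 \<union> A)) x y"
    by (rule Janiszewski[OF compS(1) compact_imp_closed[OF cA] _ mono ccA]) (use S12 in blast)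
  have "(S1 \<union> A) \<inter> S2 = {?b}" using AD wb disj S12 by blast
  then have "connected ((S1 \<union> A) \<inter> S2)" by simp
  then have "connected_component (- ((S1 \<union> A) \<union> S2)) x y"
    by (rule Janiszewski[OF compact_Un[OF compS(1) cA] compact_imp_closed[OF compS(2)] _ cc mono]) (use S12 in blast)
  then show ?thesis using S12 suppe by (simp add: Un_ac)
qed

text \<open>A common form of both cases: the new edge separates points of an old component at most
  according to membership in \<open>I\<close>. For a bridge, \<open>I\<close> is empty and the chain
  zero; for a cycle, \<open>I\<close> is the inside of the loop, and the sign from
  \<open>cycle_wind\<close> normalizes the winding number there to 1.\<close>

lemma edge_side:
  assumes "D \<subseteq> edges G" "e \<in> edges G" "e \<notin> D"
  obtains I \<gamma> where "bounded I" "I \<inter> path_image (curve G e) = {}"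
    "closed_chain (insert e D) \<gamma>" "\<And>z. z \<notin> supp (insert e D) \<Longrightarrow> wind \<gamma> z = of_bool (z \<in> I)"
    "\<And>S x y. connected S \<Longrightarrow> S \<inter> supp (insert e D) = {} \<Longrightarrow> x \<in> S \<Longrightarrow> y \<in> S \<Longrightarrow> x \<in> I \<Longrightarrow> y \<in> I"
    "\<And>x y. connected_component (- supp D) x y \<Longrightarrow> x \<notin> supp (insert e D) \<Longrightarrow> y \<notin> supp (insert e D) \<Longrightarrow>
       (x \<in> I \<longleftrightarrow> y \<in> I) \<Longrightarrow> connected_component (- supp (insert e D)) x y"
proof -
  have fin: "finite (insert e D)" using assms finite_subset[OF _ finite_edges] by auto
  have DE: "insert e D - {e} = D" using assms by auto
  from fin insertI1 show ?thesis
  proof (cases rule: bridge_or_cycle[where e = e])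
    case bridge
    then show ?thesis using bridge_separation[OF assms] that[of "{}" "\<lambda>e. 0"] unfolding DE by simp
  next
    case (cycle p)
    let ?J = "img (cyc_edges p)"
    have cyc: "is_cyc (edges G) p" using is_cyc_mono[OF cycle(4)] assms by auto
    have JD: "?J \<subseteq> supp (insert e D)" unfolding supp_def using img_mono[OF cyc_edges_subset[OF cycle(4)]] by blast
    obtain \<epsilon> :: int where \<epsilon>: "\<epsilon> = 1 \<or> \<epsilon> = - 1"
      "\<And>z. z \<notin> ?J \<Longrightarrow> wind (cycle_chain p) z = of_int \<epsilon> * of_bool (z \<in> inside ?J)"
      using cycle_wind[OF cyc] by blast
    show ?thesis
    proof (rule that[of "inside ?J" "\<lambda>e. \<epsilon> * cycle_chain p e"])
      show "bounded (inside ?J)"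
        using Jordan_inside_outside[OF loop_path(1,2)[OF cyc]] loop_path(3)[OF cyc] by simp
      have "path_image (curve G e) \<subseteq> ?J" using cycle by (auto simp: cyc_edges_def img_insert)
      then show "inside ?J \<inter> path_image (curve G e) = {}" using inside_no_overlap[of ?J] by blast
      show "closed_chain (insert e D) (\<lambda>e. \<epsilon> * cycle_chain p e)"
        using closed_chain_mult closed_cycle_chain fin cycle by blast
      show "wind (\<lambda>e. \<epsilon> * cycle_chain p e) z = of_bool (z \<in> inside ?J)" if "z \<notin> supp (insert e D)" for z
      proof -
        have "z \<notin> ?J" using that JD by blast
        then show ?thesis using \<epsilon>(1) \<epsilon>(2)[of z] by (auto simp: wind_mult)
      qed
      show "y \<in> inside ?J" if "connected S" "S \<inter> supp (insert e D) = {}" "x \<in> S" "y \<in> S" "x \<in> inside ?J" for S x y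
      proof -
        have "S \<inter> ?J = {}" using that(2) JD by blast
        then show ?thesis using connected_inside_iff[OF that(1)] that by blast
      qed
    qed (use cycle_separation[OF assms] cycle DE in auto)
  qed
qed

section \<open>Construction of the face boundaries\<close>

definition faces :: "(nat \<times> nat) set \<Rightarrow> complex set set" where
  "faces D = {F \<in> components (- supp D). bounded F}"

lemma bounded_faces_eq: "bounded_faces G = faces (edges G)"
  by (simp add: bounded_faces_def faces_def support_eq)

lemma sum_of_bool_components:
  assumes "finite T" "T \<subseteq> components U"
  shows "(\<Sum>F\<in>T. of_bool (y \<in> F)) = (of_bool (y \<in> \<Union> T) :: complex)"
proof (cases "y \<in> \<Union> T")
  case True
  then obtain K where K: "K \<in> T" "y \<in> K" by blast
  have "of_bool (y \<in> F) = (if F = K then 1 else 0 :: complex)" if "F \<in> T" for F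
    using components_nonoverlap[of F U K] assms(2) that K by auto
  then have "(\<Sum>F\<in>T. of_bool (y \<in> F)) = (\<Sum>F\<in>T. if F = K then 1 else 0 :: complex)"
    by (intro sum.cong) auto
  then show ?thesis using K True assms(1) by simp
next
  case False
  then show ?thesis by (auto intro!: sum.neutral)
qed

text \<open>The new edge without its ends lies in one component \<open>F0\<close> of the old
  complement. The other components remain, and \<open>F0\<close> is cut at most into its parts
  inside and outside \<open>I\<close>. The winding number of \<open>\<gamma>\<close> is the
  indicator of \<open>I\<close>; subtracting the boundaries of the other old faces in
  \<open>I\<close> leaves a chain \<open>\<delta>\<close> for the part of \<open>F0\<close> inside
  \<open>I\<close>. If \<open>F0\<close> is a face, its boundary minus \<open>\<delta>\<close>
  serves for the part outside.\<close>

lemma faces_step: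
  assumes D: "D \<subseteq> edges G" "e \<in> edges G" "e \<notin> D" and fin: "finite (faces D)"
    and \<beta>: "\<And>F. F \<in> faces D \<Longrightarrow> closed_chain D (\<beta> F)"
      "\<And>F z. F \<in> faces D \<Longrightarrow> z \<notin> supp D \<Longrightarrow> wind (\<beta> F) z = of_bool (z \<in> F)"
  shows "finite (faces (insert e D)) \<and> (\<forall>F \<in> faces (insert e D).
     \<exists>c. closed_chain (insert e D) c \<and> (\<forall>z. z \<notin> supp (insert e D) \<longrightarrow> wind c z = of_bool (z \<in> F)))"
proof -
  let ?D = "insert e D"
  obtain I \<gamma> where I: "bounded I" "I \<inter> path_image (curve G e) = {}"
    and \<gamma>: "closed_chain ?D \<gamma>" "\<And>z. z \<notin> supp ?D \<Longrightarrow> wind \<gamma> z = of_bool (z \<in> I)"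
    and Iconn: "\<And>S x y. connected S \<Longrightarrow> S \<inter> supp ?D = {} \<Longrightarrow> x \<in> S \<Longrightarrow> y \<in> S \<Longrightarrow> x \<in> I \<Longrightarrow> y \<in> I"
    and Isep: "\<And>x y. connected_component (- supp D) x y \<Longrightarrow> x \<notin> supp ?D \<Longrightarrow> y \<notin> supp ?D \<Longrightarrow>
       (x \<in> I \<longleftrightarrow> y \<in> I) \<Longrightarrow> connected_component (- supp ?D) x y"
    by (rule edge_side[OF D]) (rule that; assumption)
  define A where "A = path_image (curve G e)"
  have finD: "finite ?D" using D finite_subset[OF _ finite_edges] by auto
  have suppD: "supp ?D = supp D \<union> A" by (auto simp: supp_def img_insert A_def)
  let ?w = "place G (White (fst e))" and ?b = "place G (Black (snd e))"
  note ec = edge_curve[OF D(2)]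
  have wb: "{?w, ?b} \<subseteq> supp D"
    using ends_vertices[of "{e}"] D(2) by (auto simp: ends_insert supp_def)
  have AD: "A \<inter> supp D \<subseteq> {?w, ?b}"
  proof -
    have "A \<inter> img D \<subseteq> place G ` ({White (fst e), Black (snd e)} \<inter> ends D)"
      unfolding A_def using img_Int[of "{e}" D] D by (simp add: img_insert ends_insert)
    then show ?thesis using ec(4) unfolding supp_def A_def by blast
  qed
  obtain F0 where F0: "F0 \<in> components (- supp D)" "A - {?w, ?b} \<subseteq> F0"
  proof -
    have "connected (A - {?w, ?b})"
      using connected_simple_path_endless[OF arc_imp_simple_path[OF ec(1)]] ec(2,3)
      by (simp add: A_def insert_commute)
    moreover have "A - {?w, ?b} \<noteq> {}"
      using nonempty_simple_path_endless[OF arc_imp_simple_path[OF ec(1)]] ec(2,3)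
      by (simp add: A_def insert_commute)
    moreover have "A - {?w, ?b} \<subseteq> - supp D" using AD by blast
    ultimately show ?thesis using that exists_component_superset[of "A - {?w, ?b}" "- supp D"] by auto
  qed
  have comp_disj: "F \<inter> supp ?D = {}" if "F \<in> components (- supp D)" "F \<noteq> F0" for F
  proof -
    have "F \<inter> F0 = {}" using that F0(1) components_nonoverlap by blast
    moreover have "F \<subseteq> - supp D" using that(1) in_components_subset by blast
    ultimately show ?thesis using suppD F0(2) wb by blast
  qed
  \<comment> \<open>A component other than \<open>F0\<close> is disjoint from the new edge and so
    lies entirely inside or entirely outside \<open>I\<close>. If inside, it is bounded, hence a
    face of \<open>D\<close> whose boundary chain is known.\<close>
  define T where "T = {F \<in> faces D. F \<noteq> F0 \<and> F \<subseteq> I}"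
  have T: "finite T" "T \<subseteq> components (- supp D)" using finite_subset[OF _ fin, of T] by (auto simp: T_def faces_def)
  define \<delta> where "\<delta> = (\<lambda>e. \<gamma> e - (\<Sum>F\<in>T. \<beta> F e))"
  have \<delta>cl: "closed_chain ?D \<delta>" unfolding \<delta>_def
    using \<beta>(1) closed_chain_mono[OF finD] by (intro closed_chain_diff \<gamma> closed_chain_sum) (auto simp: T_def)
  have \<delta>w: "wind \<delta> z = of_bool (z \<in> I \<and> z \<in> F0)" if z: "z \<notin> supp ?D" for z
  proof -
    have zD: "z \<notin> supp D" using z suppD by blast
    have "wind \<delta> z = of_bool (z \<in> I) - (\<Sum>F\<in>T. wind (\<beta> F) z)"
      unfolding \<delta>_def wind_diff wind_sum using \<gamma>(2)[OF z] by simp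
    also have "(\<Sum>F\<in>T. wind (\<beta> F) z) = (\<Sum>F\<in>T. of_bool (z \<in> F))"
      using \<beta>(2)[OF _ zD] by (intro sum.cong) (auto simp: T_def)
    also have "\<dots> = of_bool (z \<in> \<Union> T)" by (rule sum_of_bool_components[OF T])
    also have "z \<in> \<Union> T \<longleftrightarrow> z \<in> I \<and> z \<notin> F0"
    proof
      assume "z \<in> \<Union> T"
      then obtain F where F: "F \<in> T" "z \<in> F" by blast
      then show "z \<in> I \<and> z \<notin> F0"
        using components_nonoverlap[of F "- supp D" F0] F0(1) by (auto simp: T_def faces_def)
    next
      assume zI: "z \<in> I \<and> z \<notin> F0"
      obtain F where F: "F \<in> components (- supp D)" "z \<in> F"
        using zD Union_components[of "- supp D"] by blast
      then have "F \<noteq> F0" using zI by blast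
      then have "F \<inter> supp ?D = {}" using comp_disj F by blast
      then have "F \<subseteq> I" using Iconn[OF in_components_connected[OF F(1)]] F zI by blast
      then have "F \<in> T" using F \<open>F \<noteq> F0\<close> bounded_subset[OF I(1)] by (simp add: T_def faces_def)
      then show "z \<in> \<Union> T" using F by blast
    qed
    finally show ?thesis by auto
  qed
  \<comment> \<open>A component of the new complement is what membership in \<open>I\<close> leaves
    of an old one: \<open>Iconn\<close> shows that it is no larger, and \<open>Isep\<close> that it
    is no smaller.\<close>
  have comp_eq: "F = {y. y \<notin> supp ?D \<and> connected_component (- supp D) z y \<and> (y \<in> I \<longleftrightarrow> z \<in> I)}"
    if F: "F \<in> components (- supp ?D)" "z \<in> F" for F z
  proof -
    have F': "F = connected_component_set (- supp ?D) z"
      using F by (metis components_iff connected_component_eq)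
    have zD: "z \<notin> supp ?D" using F in_components_subset by blast
    have Fc: "connected F" "F \<inter> supp ?D = {}" using F in_components_connected in_components_subset by blast+
    show ?thesis
    proof (intro equalityI subsetI CollectI conjI)
      fix y assume y: "y \<in> F"
      show "y \<notin> supp ?D" using Fc y by blast
      show "connected_component (- supp D) z y"
        using y F' connected_component_mono[of "- supp ?D" "- supp D"] suppD by blast
      show "y \<in> I \<longleftrightarrow> z \<in> I" using Iconn[OF Fc] y F(2) by blast
    next
      fix y assume "y \<in> {y. y \<notin> supp ?D \<and> connected_component (- supp D) z y \<and> (y \<in> I \<longleftrightarrow> z \<in> I)}"
      then show "y \<in> F" unfolding F' using Isep zD by blast
    qed
  qed
  have cases: "F \<in> faces D \<or> (F = F0 \<inter> I - supp ?D) \<or> (F = F0 - I - supp ?D \<and> F0 \<in> faces D)"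
    if F: "F \<in> faces ?D" for F
  proof -
    have Fc: "F \<in> components (- supp ?D)" and bF: "bounded F" using F by (auto simp: faces_def)
    then obtain z where z: "z \<in> F" using in_components_nonempty by blast
    note eq = comp_eq[OF Fc z]
    have zD: "z \<notin> supp ?D" using Fc z in_components_subset by blast
    have zD': "z \<notin> supp D" using zD suppD by blast
    define K where "K = connected_component_set (- supp D) z"
    have K: "K \<in> components (- supp D)" "z \<in> K" using zD' by (auto simp: K_def componentsI)
    have eqK: "F = {y \<in> K. y \<notin> supp ?D \<and> (y \<in> I \<longleftrightarrow> z \<in> I)}" by (subst eq) (auto simp: K_def)
    show ?thesis
    proof (cases "K = F0")
      case True
      show ?thesis
      proof (cases "z \<in> I")
        case zI: True
        then have "F = F0 \<inter> I - supp ?D" using eqK True by blast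
        then show ?thesis by blast
      next
        case False
        then have Feq: "F = F0 - I - supp ?D" using eqK True by blast
        \<comment> \<open>Since \<open>I\<close> and the support are bounded, so is
          \<open>F0\<close>; thus \<open>F0\<close> is a face of \<open>D\<close>, and its chain is
          available for the difference.\<close>
        then have "F0 \<subseteq> F \<union> I \<union> supp ?D" by blast
        moreover have "bounded (F \<union> I \<union> supp ?D)"
          using bF I(1) compact_supp[of ?D] D compact_imp_bounded by simp
        ultimately have "bounded F0" using bounded_subset by blast
        then show ?thesis using Feq F0(1) by (simp add: faces_def)
      qed
    next
      case False
      have Kd: "K \<inter> supp ?D = {}" using comp_disj[OF K(1) False] .
      have "y \<in> I \<longleftrightarrow> z \<in> I" if "y \<in> K" for y
        using Iconn[OF in_components_connected[OF K(1)] Kd] that K(2) by blast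
      then have "F = K" using eqK Kd by blast
      then show ?thesis using K(1) bF by (simp add: faces_def)
    qed
  qed
  have "faces ?D \<subseteq> faces D \<union> {F0 \<inter> I - supp ?D, F0 - I - supp ?D}" using cases by blast
  then have "finite (faces ?D)" using fin finite_subset by blast
  moreover have "\<exists>c. closed_chain ?D c \<and> (\<forall>z. z \<notin> supp ?D \<longrightarrow> wind c z = of_bool (z \<in> F))"
    if F: "F \<in> faces ?D" for F
    using cases[OF F]
  proof (elim disjE conjE)
    assume "F \<in> faces D"
    then show ?thesis using \<beta> closed_chain_mono[OF finD \<beta>(1) subset_insertI] suppD
      by (intro exI[of _ "\<beta> F"]) auto
  next
    assume "F = F0 \<inter> I - supp ?D"
    then show ?thesis using \<delta>cl \<delta>w by (intro exI[of _ \<delta>]) auto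
  next
    assume F: "F = F0 - I - supp ?D" "F0 \<in> faces D"
    show ?thesis
    proof (intro exI[of _ "\<lambda>e. \<beta> F0 e - \<delta> e"] conjI allI impI)
      show "closed_chain ?D (\<lambda>e. \<beta> F0 e - \<delta> e)"
        using closed_chain_mono[OF finD \<beta>(1)[OF F(2)]] by (intro closed_chain_diff \<delta>cl) auto
      fix z assume z: "z \<notin> supp ?D"
      then have "z \<notin> supp D" using suppD by blast
      then show "wind (\<lambda>e. \<beta> F0 e - \<delta> e) z = of_bool (z \<in> F)"
        using \<delta>w[OF z] \<beta>(2)[OF F(2)] z F(1) by (auto simp: wind_diff)
    qed
  qed
  ultimately show ?thesis by blast
qed

text \<open>The induction starts without any face: the complement of the finitely many vertices is
  connected and unbounded.\<close>

lemma faces_chains: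
  assumes "D \<subseteq> edges G"
  shows "finite (faces D) \<and>
    (\<forall>F \<in> faces D. \<exists>c. closed_chain D c \<and> (\<forall>z. z \<notin> supp D \<longrightarrow> wind c z = of_bool (z \<in> F)))"
  using finite_subset[OF assms finite_edges] assms
proof (induction D rule: finite_induct)
  case empty
  have "connected (- supp {})"
    unfolding supp_def using connected_open_diff_countable[of "UNIV :: complex set" "place G ` vertices G"] finite_vertices
    by (simp add: countable_finite Compl_eq_Diff_UNIV connected_UNIV)
  moreover have "\<not> bounded (- supp {})"
    using compact_supp[of "{}"] compact_imp_bounded cobounded_imp_unbounded by force
  ultimately have "components (- supp {}) = {- supp {}}" using components_eq_sing_iff by (metis bounded_empty)
  then have "faces {} = {}" using \<open>\<not> bounded _\<close> by (auto simp: faces_def)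
  then show ?case by simp
next
  case (insert e D)
  then obtain \<beta> where \<beta>: "finite (faces D)" "\<And>F. F \<in> faces D \<Longrightarrow> closed_chain D (\<beta> F)"
      "\<And>F z. F \<in> faces D \<Longrightarrow> z \<notin> supp D \<Longrightarrow> wind (\<beta> F) z = of_bool (z \<in> F)"
    by (metis insert_subset)
  show ?case by (rule faces_step[OF _ _ insert.hyps(2) \<beta>]) (use insert.prems in auto)
qed

lemma finite_bounded_faces: "finite (bounded_faces G)"
  using faces_chains[of "edges G"] by (simp add: bounded_faces_eq)

text \<open>For closed chains and points off the support, \<open>chain_winding\<close> agrees with
  \<open>wind\<close>, so the definite description can be rewritten in terms of \<open>wind\<close>.
  A chain satisfying it comes from \<open>faces_chains\<close>, and uniqueness from
  \<open>wind_eq_imp_eq\<close>.\<close>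

lemma face_boundary:
  assumes F: "F \<in> bounded_faces G"
  shows "closed_chain (edges G) (face_boundary G F)"
    "\<And>z. z \<notin> supp (edges G) \<Longrightarrow> wind (face_boundary G F) z = of_bool (z \<in> F)"
proof -
  let ?P = "\<lambda>c. closed_chain (edges G) c \<and> (\<forall>z. z \<notin> supp (edges G) \<longrightarrow> wind c z = of_bool (z \<in> F))"
  let ?Q = "\<lambda>c. c \<in> closed_chains G \<and> (\<forall>z. z \<notin> Defs.support G \<longrightarrow> chain_winding G c z = of_bool (z \<in> F))"
  have PQ: "?Q c \<longleftrightarrow> ?P c" for c
  proof -
    have "chain_winding G c z = of_bool (z \<in> F) \<longleftrightarrow> wind c z = of_bool (z \<in> F)"
      if "closed_chain (edges G) c" "z \<notin> supp (edges G)" for z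
    proof -
      have "img {e. c e \<noteq> 0} \<subseteq> supp (edges G)"
        unfolding supp_def using img_mono[OF closed_chain_support(2)[OF that(1)]] by blast
      then have *: "of_int (chain_winding G c z) = wind c z"
        using of_int_chain_winding that by blast
      show ?thesis unfolding *[symmetric] by (metis of_int_eq_iff of_int_of_bool)
    qed
    then show ?thesis unfolding closed_chains_iff support_eq by blast
  qed
  obtain c where c: "?P c" using faces_chains[of "edges G"] F by (auto simp: bounded_faces_eq)
  have uniq: "d = c" if "?P d" for d by (rule wind_eq_imp_eq) (use that c in simp_all)
  have "?P (THE c. ?P c)" by (rule theI[of ?P, OF c uniq])
  moreover have "face_boundary G F = (THE c. ?P c)" unfolding face_boundary_def PQ ..
  ultimately show "closed_chain (edges G) (face_boundary G F)"
    "\<And>z. z \<notin> supp (edges G) \<Longrightarrow> wind (face_boundary G F) z = of_bool (z \<in> F)" by auto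
qed

lemma face_point:
  assumes "F \<in> bounded_faces G"
  shows "(SOME z. z \<in> F) \<in> F" "z \<in> F \<Longrightarrow> z \<notin> supp (edges G)"
proof -
  have F: "F \<in> components (- supp (edges G))" using assms by (simp add: bounded_faces_eq faces_def)
  show "(SOME z. z \<in> F) \<in> F" using in_components_nonempty[OF F] by (simp add: some_in_eq)
  show "z \<in> F \<Longrightarrow> z \<notin> supp (edges G)" using in_components_subset[OF F] by blast
qed

lemma wind_off_support:
  assumes "closed_chain (edges G) c" "S \<inter> supp (edges G) = {}"
  shows "S \<inter> img {e. c e \<noteq> 0} = {}"
  using img_mono[OF closed_chain_support(2)[OF assms(1)]] assms(2) unfolding supp_def by blast

text \<open>Both sides have the same winding number at every point off the graph. In a face only the
  term of that face counts, and winding numbers are constant there, so the chosen point is as good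
  as any other; on an unbounded component both sides give 0.\<close>

theorem closed_chain_expand:
  assumes c: "closed_chain (edges G) c"
  shows "c = (\<lambda>e. \<Sum>F\<in>bounded_faces G. chain_winding G c (SOME z. z \<in> F) * face_boundary G F e)"
proof (rule wind_eq_imp_eq[OF c])
  show "closed_chain (edges G) (\<lambda>e. \<Sum>F\<in>bounded_faces G. chain_winding G c (SOME z. z \<in> F) * face_boundary G F e)"
    by (intro closed_chain_sum closed_chain_mult face_boundary(1))
  fix z assume z: "z \<notin> supp (edges G)"
  have "wind (\<lambda>e. \<Sum>F\<in>bounded_faces G. chain_winding G c (SOME z. z \<in> F) * face_boundary G F e) z
     = (\<Sum>F\<in>bounded_faces G. of_int (chain_winding G c (SOME z. z \<in> F)) * of_bool (z \<in> F))"
    unfolding wind_sum wind_mult using face_boundary(2)[OF _ z] by (intro sum.cong) auto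
  also have "\<dots> = (\<Sum>F\<in>bounded_faces G. wind c z * of_bool (z \<in> F))"
  proof (rule sum.cong[OF refl])
    fix F assume F: "F \<in> bounded_faces G"
    have "of_int (chain_winding G c (SOME z. z \<in> F)) = wind c z" if "z \<in> F"
    proof -
      have Fc: "connected F" "F \<inter> supp (edges G) = {}"
        using F face_point(2)[OF F] by (auto simp: bounded_faces_eq faces_def in_components_connected)
      have "of_int (chain_winding G c (SOME z. z \<in> F)) = wind c (SOME z. z \<in> F)"
        using wind_off_support[OF c Fc(2)] face_point(1)[OF F] by (intro of_int_chain_winding[OF c]) blast
      also have "\<dots> = wind c z"
        using wind_connected[OF c Fc(1) wind_off_support[OF c Fc(2)] face_point(1)[OF F] that] .
      finally show ?thesis .
    qed
    then show "of_int (chain_winding G c (SOME z. z \<in> F)) * of_bool (z \<in> F) = wind c z * of_bool (z \<in> F)"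
      by simp
  qed
  also have "\<dots> = wind c z * of_bool (z \<in> \<Union> (bounded_faces G))"
    using sum_of_bool_components[OF finite_bounded_faces, of "- supp (edges G)" z]
    by (simp add: bounded_faces_eq faces_def flip: sum_distrib_left)
  also have "\<dots> = wind c z"
  proof (cases "z \<in> \<Union> (bounded_faces G)")
    case False
    obtain K where K: "K \<in> components (- supp (edges G))" "z \<in> K"
      using z Union_components[of "- supp (edges G)"] by blast
    then have "\<not> bounded K" using False by (auto simp: bounded_faces_eq faces_def)
    moreover have "K \<inter> supp (edges G) = {}" using in_components_subset[OF K(1)] by blast
    ultimately have "wind c z = 0"
      using wind_unbounded[OF c in_components_connected[OF K(1)] wind_off_support[OF c]] K(2) by blast
    then show ?thesis by simp
  qed simp
  finally show "wind c z = wind (\<lambda>e. \<Sum>F\<in>bounded_faces G. chain_winding G c (SOME z. z \<in> F) * face_boundary G F e) z" ..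
qed

end

section \<open>Cycles and theta graphs\<close>

lemma is_cyc_rotate:
  assumes "is_cyc E (u @ v)"
  shows "is_cyc E (v @ u)" "cyc_edges (v @ u) = cyc_edges (u @ v)"
proof -
  have "is_cyc E (v @ u) \<and> cyc_edges (v @ u) = cyc_edges (u @ v)"
  proof (cases "u = [] \<or> v = []")
    case True then show ?thesis using assms by auto
  next
    case False
    then have "upath E u" "upath E v" "set u \<inter> set v = {}" "adj E (last u) (hd v)" "adj E (last v) (hd u)"
      using assms upath_append[of u v E] by (auto simp: is_cyc_def)
    then show ?thesis using False assms upath_append[of v u E]
      by (auto simp: is_cyc_def cyc_edges_def path_edges_append)
  qed
  then show "is_cyc E (v @ u)" "cyc_edges (v @ u) = cyc_edges (u @ v)" by auto
qed

text \<open>A rotation of the vertex list makes \<open>e\<close> the closing edge.\<close>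

lemma cycle_open_at_edge:
  assumes C: "is_cyc E C" and e: "e \<in> cyc_edges C"
  obtains p where "upath E p" "{hd p, last p} = {White (fst e), Black (snd e)}" "set p = set C"
    "cyc_edges C = insert e (path_edges p)" "e \<notin> path_edges p"
proof -
  have "\<exists>p. is_cyc E p \<and> cyc_edges p = cyc_edges C \<and> edge_between (last p) (hd p) = Some e"
  proof (cases "e \<in> path_edges C")
    case True
    then obtain k where k: "Suc k < length C" "e = the (edge_between (C ! k) (C ! Suc k))"
      by (auto simp: path_edges_nth)
    have eq: "C = take (Suc k) C @ drop (Suc k) C" by simp
    have "is_cyc E (drop (Suc k) C @ take (Suc k) C)"
      "cyc_edges (drop (Suc k) C @ take (Suc k) C) = cyc_edges C"
      using is_cyc_rotate[of E "take (Suc k) C" "drop (Suc k) C"] C by auto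
    moreover have "last (drop (Suc k) C @ take (Suc k) C) = C ! k" "hd (drop (Suc k) C @ take (Suc k) C) = C ! Suc k"
      using k(1) by (simp_all add: take_Suc_conv_app_nth hd_drop_conv_nth)
    moreover have "edge_between (C ! k) (C ! Suc k) = Some e"
      using C k by (auto simp: is_cyc_def upath_def successively_nth adj_def)
    ultimately show ?thesis by metis
  next
    case False
    then show ?thesis using C e by (auto simp: is_cyc_def cyc_edges_def adj_def intro!: exI[of _ C])
  qed
  then obtain p where p: "is_cyc E p" "cyc_edges p = cyc_edges C" "edge_between (last p) (hd p) = Some e" by blast
  show ?thesis
  proof (rule that[of p])
    show "upath E p" using p by (simp add: is_cyc_def)
    show "{hd p, last p} = {White (fst e), Black (snd e)}" using edge_between_ends[OF p(3)] by auto
    show "set p = set C" using ends_cyc_edges[OF p(1)] ends_cyc_edges[OF C] p(2) by simp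
    show "cyc_edges C = insert e (path_edges p)" using p(2,3) by (simp add: cyc_edges_def)
    show "e \<notin> path_edges p" using closing_edge_notin[OF p(1)] p(3) by simp
  qed
qed

lemma path_edges_decomp:
  assumes "m \<noteq> []"
  shows "path_edges (x # m @ [z]) =
    insert (the (edge_between x (hd m))) (insert (the (edge_between (last m) z)) (path_edges m))"
  using path_edges_append[of "[x]" "m @ [z]"] path_edges_append[of m "[z]"] assms by auto

text \<open>The cycle is rotated to start at \<open>x\<close>. One path is the part up to
  \<open>z\<close>; the other goes from \<open>x\<close> backwards through the remaining vertices to
  \<open>z\<close>.\<close>

lemma cycle_split:
  assumes C: "is_cyc E C" and xz: "x \<in> set C" "z \<in> set C" "x \<noteq> z"
  obtains p q where "upath E p" "upath E q" "hd p = x" "last p = z" "hd q = x" "last q = z"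
    "set p \<inter> set q = {x, z}" "path_edges p \<union> path_edges q = cyc_edges C" "path_edges p \<inter> path_edges q = {}"
    "set p \<union> set q = set C"
proof -
  obtain u v where uv: "C = u @ x # v" using xz(1) by (meson split_list)
  define C' where "C' = x # v @ u"
  have C': "is_cyc E C'" "cyc_edges C' = cyc_edges C"
    using is_cyc_rotate[of E u "x # v"] C unfolding uv C'_def by simp_all
  have "z \<in> set (v @ u)" using xz uv by auto
  then obtain m r where mr: "v @ u = m @ z # r" by (meson split_list)
  have Ceq: "C' = x # m @ z # r" using mr by (simp add: C'_def)
  define p where "p = x # m @ [z]"
  define q where "q = x # rev r @ [z]"
  have up: "upath E C'" using C'(1) by (simp add: is_cyc_def)
  have dist: "distinct C'" using up by (simp add: upath_def)
  have pr: "C' = p @ r" by (simp add: Ceq p_def)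
  have p: "upath E p" using up upath_append[of p r E] pr by (cases "r = []") (auto simp: p_def)
  have zr: "upath E (z # r)"
    using up upath_append[of "x # m" "z # r" E] by (simp add: Ceq)
  have "adj E (last (z # r)) x" using C'(1) by (simp add: is_cyc_def Ceq split: if_splits)
  then have "adj E x (last (z # r))" using adj_sym by blast
  moreover have "hd (rev (z # r)) = last (z # r)" by (rule hd_rev)
  moreover have "x \<notin> set (rev (z # r))" using dist by (auto simp: Ceq)
  ultimately have "upath E ([x] @ rev (z # r))"
    using upath_rev[OF zr] by (subst upath_append) simp_all
  then have q: "upath E q" by (simp add: q_def)
  have "path_edges p \<union> path_edges q = cyc_edges C'"
  proof -
    have 1: "path_edges q = insert (the (edge_between x (last (z # r)))) (path_edges (z # r))"
    proof -
      have "path_edges ([x] @ rev (z # r)) = path_edges (rev (z # r)) \<union> {the (edge_between x (hd (rev (z # r))))}"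
        by (subst path_edges_append) auto
      then show ?thesis by (simp add: q_def hd_rev path_edges_rev[of "z # r", simplified] del: path_edges.simps)
    qed
    have 2: "path_edges C' = path_edges p \<union> path_edges (z # r)"
    proof -
      have "path_edges C' = path_edges (x # m) \<union> path_edges (z # r) \<union> {the (edge_between (last (x # m)) z)}"
        using path_edges_append[of "x # m" "z # r"] by (simp add: Ceq)
      moreover have "path_edges p = path_edges (x # m) \<union> {the (edge_between (last (x # m)) z)}"
        using path_edges_append[of "x # m" "[z]"] by (simp add: p_def)
      ultimately show ?thesis by blast
    qed
    have "last C' = last (z # r)" "hd C' = x" by (simp_all add: Ceq)
    then show ?thesis unfolding cyc_edges_def 1 2 by (simp add: edge_between_sym[of x])
  qed
  then have un: "path_edges p \<union> path_edges q = cyc_edges C" using C' by simp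
  \<comment> \<open>The numbers of edges of the two paths add up to that of the cycle, so no edge is
    shared.\<close>
  have "card (cyc_edges C) = card (path_edges p) + card (path_edges q)"
    unfolding card_cyc_edges[OF C] card_path_edges[OF p] card_path_edges[OF q]
    using arg_cong[OF mr, of length] by (simp add: p_def q_def uv)
  then have "card (path_edges p \<inter> path_edges q) = 0"
    using card_Un_Int[of "path_edges p" "path_edges q"] un by simp
  then have dj: "path_edges p \<inter> path_edges q = {}" by simp
  show ?thesis
  proof (rule that[OF p q _ _ _ _ _ un dj])
    show "hd p = x" "last p = z" "hd q = x" "last q = z" by (simp_all add: p_def q_def)
    show "set p \<inter> set q = {x, z}" using dist by (auto simp: p_def q_def Ceq)
    have "set C = set C'" by (auto simp: uv C'_def)
    then show "set p \<union> set q = set C" by (auto simp: p_def q_def Ceq)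
  qed
qed

lemma upath_ends_decomp:
  assumes "upath E p" "hd p \<noteq> last p"
  obtains m where "p = hd p # m @ [last p]"
proof -
  obtain a p' where p: "p = a # p'" using assms by (cases p) (auto simp: upath_def)
  then have "p' \<noteq> []" using assms by auto
  then have "p' = butlast p' @ [last p']" by simp
  then show ?thesis using that[of "butlast p'"] p \<open>p' \<noteq> []\<close> by simp
qed

text \<open>The cycle runs along \<open>p\<close> and returns through the inner vertices of
  \<open>q\<close>. If \<open>q\<close> has none, its only edge closes \<open>p\<close>; then
  \<open>p\<close> has an inner vertex, because the paths share no edge.\<close>

lemma two_paths_cycle:
  assumes p: "upath E p" and q: "upath E q" and ends: "hd q = hd p" "last q = last p" "hd p \<noteq> last p"
    and disj: "set p \<inter> set q = {hd p, last p}" "path_edges p \<inter> path_edges q = {}"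
  obtains C where "is_cyc E C" "cyc_edges C = path_edges p \<union> path_edges q"
proof -
  define a b where "a = hd p" and "b = last p"
  obtain m where m: "p = a # m @ [b]" using upath_ends_decomp[OF p ends(3)] by (auto simp: a_def b_def)
  obtain n where n: "q = a # n @ [b]" using upath_ends_decomp[OF q] ends by (auto simp: a_def b_def)
  have dist: "distinct p" "distinct q" using p q by (auto simp: upath_def)
  show ?thesis
  proof (cases "n = []")
    case True
    then have "m \<noteq> []" using disj(2) m n by auto
    moreover have "adj E b a" using q n True adj_sym by (auto simp: upath_def)
    ultimately have "is_cyc E p" using p m by (cases m) (auto simp: is_cyc_def)
    moreover have "cyc_edges p = path_edges p \<union> path_edges q"
      using m n True by (auto simp: cyc_edges_def edge_between_sym[of b])
    ultimately show ?thesis using that by blast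
  next
    case False
    have "upath E (a # n)" using q n upath_append[of "a # n" "[b]" E] by simp
    then have n': "upath E n" "adj E a (hd n)" using upath_append[of "[a]" n E] False by auto
    have "adj E (last n) b" using q n upath_append[of "a # n" "[b]" E] False by simp
    moreover have "set p \<inter> set n = {}"
    proof -
      have "a \<notin> set n" "b \<notin> set n" "set n \<subseteq> set q" using dist(2) unfolding n by auto
      moreover have "v \<in> {a, b}" if "v \<in> set p" "v \<in> set q" for v
        using that disj(1) unfolding a_def b_def by blast
      ultimately show ?thesis by blast
    qed
    ultimately have up: "upath E (p @ rev n)"
      using upath_append[of p "rev n" E] p upath_rev[OF n'(1)] False m adj_sym[of E b "last n"]
      by (auto simp: hd_rev)
    have "adj E (hd n) a" using n' adj_sym by blast
    then have "is_cyc E (p @ rev n)" using up m False by (cases n) (auto simp: is_cyc_def last_rev)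
    moreover have "cyc_edges (p @ rev n) = path_edges p \<union> path_edges q"
    proof -
      have "path_edges q = insert (the (edge_between a (hd n))) (insert (the (edge_between (last n) b)) (path_edges n))"
        using path_edges_decomp[OF False] n by simp
      moreover have "path_edges (p @ rev n) = path_edges p \<union> path_edges n \<union> {the (edge_between b (last n))}"
        using path_edges_append[of p "rev n"] False m by (simp add: path_edges_rev hd_rev del: path_edges.simps)
      ultimately show ?thesis using False m
        by (simp add: cyc_edges_def last_rev edge_between_sym[of b] edge_between_sym[of a] Un_ac del: path_edges.simps)
    qed
    ultimately show ?thesis using that by blast
  qed
qed

text \<open>The first vertex lies on a single edge of the path, so a closed chain has coefficient 0
  there and is supported on the rest.\<close>

lemma upath_no_closed_chain:
  assumes "upath E p" "closed_chain (path_edges p) c" shows "c = (\<lambda>e. 0)"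
  using assms
proof (induction p arbitrary: c rule: path_edges.induct)
  case (1 u v p)
  then have *: "adj E u v" "u \<notin> set (v # p)" "upath E (v # p)" by (auto simp: upath_Cons2)
  obtain f where f: "edge_between u v = Some f" using *(1) by (auto simp: adj_def)
  let ?P = "path_edges (v # p)"
  have ends: "White (fst e) \<noteq> u \<and> Black (snd e) \<noteq> u" if "e \<in> ?P" for e
    using path_edges_ends[of E "v # p" e] *(2,3) that by (auto simp: upath_def)
  have cl: "closed_chain (insert f ?P) c" using 1(3) f by simp
  have fP: "f \<notin> ?P" using ends[of f] f by (auto simp: edge_between_Some)
  have "(\<Sum>e\<in>insert f ?P. c e * (of_bool (White (fst e) = u) - of_bool (Black (snd e) = u))) = 0"
    using cl[unfolded closed_chain_def, THEN conjunct2, rule_format, of "\<lambda>v. of_bool (v = u)"] .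
  moreover have "(\<Sum>e\<in>?P. c e * (of_bool (White (fst e) = u) - of_bool (Black (snd e) = u))) = 0"
    using ends by (intro sum.neutral) auto
  ultimately have "c f * (of_bool (White (fst f) = u) - of_bool (Black (snd f) = u)) = 0"
    using fP by simp
  then have "c f = 0" using f by (auto simp: edge_between_Some)
  then have "closed_chain ?P c" using closed_chain_remove[OF _ cl] by simp
  then show ?case using 1(1) *(3) by blast
qed (auto simp: closed_chain_def)

lemma upath_no_cycle:
  assumes "upath E p" shows "\<not> is_cyc (path_edges p) C"
proof
  assume C: "is_cyc (path_edges p) C"
  then have "cycle_chain C = (\<lambda>e. 0)"
    using upath_no_closed_chain[OF assms] closed_cycle_chain by simp
  moreover obtain e where "e \<in> cyc_edges C" unfolding cyc_edges_def by blast
  ultimately show False using cycle_chain_values[OF C, of e] by simp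
qed

text \<open>Opened at an edge missing from \<open>C'\<close>, the cycle \<open>C\<close> would
  become a path containing all edges of \<open>C'\<close>, but a path contains no cycle.\<close>

lemma cycle_subset_eq:
  assumes "is_cyc E C" "is_cyc E C'" "cyc_edges C' \<subseteq> cyc_edges C" shows "cyc_edges C' = cyc_edges C"
proof (rule ccontr)
  assume "cyc_edges C' \<noteq> cyc_edges C"
  then obtain e where e: "e \<in> cyc_edges C" "e \<notin> cyc_edges C'" using assms(3) by blast
  obtain p where p: "upath E p" "cyc_edges C = insert e (path_edges p)"
    using cycle_open_at_edge[OF assms(1) e(1)] by metis
  then have "cyc_edges C' \<subseteq> path_edges p" using assms(3) e(2) by (simp add: subset_insert)
  then have "is_cyc (path_edges p) C'" by (rule is_cyc_cyc_edges[OF assms(2)])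
  then show False using upath_no_cycle[OF p(1)] by blast
qed

text \<open>The segment of \<open>p\<close> from its start to its next vertex in \<open>V\<close> is
  an ear unless it uses an edge of \<open>D\<close>. Both ends of such an edge lie in
  \<open>V\<close>, and the segment has no inner vertex in \<open>V\<close>, so the segment is this
  single edge and can be skipped. An ear is found in the end because \<open>p\<close> is not
  contained in \<open>D\<close>.\<close>

lemma ear_exists:
  assumes "upath E p" "hd p \<in> V" "last p \<in> V" "\<not> path_edges p \<subseteq> D" "ends D \<subseteq> V"
  shows "\<exists>q. upath E q \<and> hd q \<in> V \<and> last q \<in> V \<and> hd q \<noteq> last q \<and> set q \<inter> V = {hd q, last q} \<and>
    path_edges q \<subseteq> path_edges p \<and> path_edges q \<inter> D = {}"
  using assms(1-4)
proof (induction "length p" arbitrary: p rule: less_induct)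
  case less
  obtain x y r where p: "p = x # y # r" using less(5) by (cases p rule: path_edges.cases) auto
  let ?t = "y # r"
  have "last p \<in> set ?t" using p by simp
  then have ex: "\<exists>v\<in>set ?t. v \<in> V" using less(4) by blast
  then obtain m z s where t: "?t = m @ z # s" "z \<in> V" "\<forall>v\<in>set m. v \<notin> V"
    using split_list_first_prop[of ?t "\<lambda>v. v \<in> V"] by metis
  let ?q = "x # m @ [z]"
  have pq: "p = ?q @ s" "p = (x # m) @ (z # s)" using p t(1) by auto
  have q: "upath E ?q" using less(2) upath_append[of ?q s E] pq(1) by (cases "s = []") auto
  have zs: "upath E (z # s)" using less(2) upath_append[of "x # m" "z # s" E] pq(2) by simp
  have pe: "path_edges p = path_edges ?q \<union> path_edges (z # s)"
  proof -
    have "path_edges p = path_edges (x # m) \<union> path_edges (z # s) \<union> {the (edge_between (last (x # m)) z)}"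
      using path_edges_append[of "x # m" "z # s"] pq(2) by simp
    moreover have "path_edges ?q = path_edges (x # m) \<union> {the (edge_between (last (x # m)) z)}"
      using path_edges_append[of "x # m" "[z]"] by simp
    ultimately show ?thesis by blast
  qed
  have xV: "x \<in> V" using less(3) p by simp
  show ?case
  proof (cases "path_edges ?q \<inter> D = {}")
    case True
    have "x \<noteq> z" using less(2) pq by (auto simp: upath_def)
    moreover have "set ?q \<inter> V = {x, z}" using xV t by auto
    ultimately show ?thesis using q xV t(2) pe True by (intro exI[of _ ?q]) auto
  next
    case False
    have "m = []"
    proof (rule ccontr)
      assume m: "m \<noteq> []"
      obtain e where e: "e \<in> path_edges ?q" "e \<in> D" using False by blast
      then have eV: "White (fst e) \<in> V" "Black (snd e) \<in> V" using assms(5) by (auto simp: ends_def)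
      have um: "upath E m" "adj E x (hd m)" "adj E (last m) z"
        using q upath_append[of "[x]" "m @ [z]" E] upath_append[of m "[z]" E] m by auto
      from e(1) consider "e \<in> path_edges m" | "edge_between x (hd m) = Some e" | "edge_between (last m) z = Some e"
        unfolding path_edges_decomp[OF m] using um by (auto simp: adj_def)
      then show False
      proof cases
        case 1
        then have "White (fst e) \<in> set m" using path_edges_ends[of E m e] um(1) by (simp add: upath_def)
        then show ?thesis using eV t(3) by blast
      next
        case 2
        have "hd m \<in> {White (fst e), Black (snd e)}" unfolding edge_between_ends[OF 2] by simp
        then have "hd m \<in> V" using eV by auto
        then show ?thesis using t(3) m by auto
      next
        case 3
        have "last m \<in> {White (fst e), Black (snd e)}" unfolding edge_between_ends[OF 3] by simp
        then have "last m \<in> V" using eV by auto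
        then show ?thesis using t(3) m by auto
      qed
    qed
    then have "path_edges ?q \<subseteq> D" using False by auto
    then have "\<not> path_edges (z # s) \<subseteq> D" using less(5) pe by blast
    moreover have "last (z # s) = last p" and len: "length (z # s) < length p" using pq by auto
    then have "last (z # s) \<in> V" "hd (z # s) \<in> V" using less(4) t(2) by simp_all
    ultimately have "\<exists>q. upath E q \<and> hd q \<in> V \<and> last q \<in> V \<and> hd q \<noteq> last q \<and> set q \<inter> V = {hd q, last q} \<and>
      path_edges q \<subseteq> path_edges (z # s) \<and> path_edges q \<inter> D = {}"
      using less(1)[OF len zs] by blast
    moreover have "path_edges (z # s) \<subseteq> path_edges p" using pe by (rule equalityD2[THEN Un_subset_iff[THEN iffD1], THEN conjunct2])
    ultimately show ?thesis by (meson subset_trans)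
  qed
qed

text \<open>Disjointness of the edges is required besides that of the inner vertices, since two
  paths without inner vertices would both be the same single edge.\<close>

definition theta :: "(nat \<times> nat) set \<Rightarrow> vertex list \<Rightarrow> vertex list \<Rightarrow> vertex list \<Rightarrow> bool" where
  "theta E p q r \<longleftrightarrow> upath E p \<and> upath E q \<and> upath E r \<and> hd p \<noteq> last p \<and>
     hd q = hd p \<and> hd r = hd p \<and> last q = last p \<and> last r = last p \<and>
     set p \<inter> set q = {hd p, last p} \<and> set p \<inter> set r = {hd p, last p} \<and> set q \<inter> set r = {hd p, last p} \<and>
     path_edges p \<inter> path_edges q = {} \<and> path_edges p \<inter> path_edges r = {} \<and> path_edges q \<inter> path_edges r = {}"

lemma theta_mono: "theta E p q r \<Longrightarrow> E \<subseteq> E' \<Longrightarrow> theta E' p q r"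
  by (auto simp: theta_def intro: upath_mono)

lemma bit_add_self [simp]: "x + x = (0 :: bit)"
  by (cases x) simp_all

text \<open>By induction on the edges. When the cycles through the last edge \<open>e\<close> are treated, one of them, \<open>C\<^sub>0\<close>, fixes
  the value at \<open>e\<close>; any other one is brought closer to \<open>C\<^sub>0\<close> by an ear of \<open>C\<^sub>0\<close>.\<close>

lemma theta_additive_linear:
  fixes f :: "(nat \<times> nat) set \<Rightarrow> bit"
  assumes "finite E"
    and "\<And>p q r. theta E p q r \<Longrightarrow>
      f (path_edges p \<union> path_edges q) = f (path_edges p \<union> path_edges r) + f (path_edges q \<union> path_edges r)"
  shows "\<exists>k. \<forall>C. is_cyc E C \<longrightarrow> (\<Sum>e\<in>cyc_edges C. k e) = f (cyc_edges C)"
  using assms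
proof (induction E rule: finite_induct)
  case empty
  have "\<not> is_cyc {} C" for C by (auto simp: is_cyc_def adj_def)
  then show ?case by blast
next
  case (insert e E)
  have "\<exists>k. \<forall>C. is_cyc E C \<longrightarrow> (\<Sum>e\<in>cyc_edges C. k e) = f (cyc_edges C)"
    by (rule insert.IH) (rule insert.prems, erule theta_mono, rule subset_insertI)
  then obtain k where k: "\<And>C. is_cyc E C \<Longrightarrow> (\<Sum>e\<in>cyc_edges C. k e) = f (cyc_edges C)" by blast
  have noe: "is_cyc E C" if "is_cyc (insert e E) C" "e \<notin> cyc_edges C" for C
    using is_cyc_cyc_edges[OF that(1)] cyc_edges_subset[OF that(1)] that(2) by blast
  show ?case
  proof (cases "\<exists>C. is_cyc (insert e E) C \<and> e \<in> cyc_edges C")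
    case False
    then show ?thesis using k noe by blast
  next
    case True
    then obtain C0 where C0: "is_cyc (insert e E) C0" "e \<in> cyc_edges C0" by blast
    obtain p0 where p0: "upath (insert e E) p0" "{hd p0, last p0} = {White (fst e), Black (snd e)}"
      "cyc_edges C0 = insert e (path_edges p0)" "e \<notin> path_edges p0"
      using cycle_open_at_edge[OF C0] by metis
    \<comment> \<open>The value at \<open>e\<close> is the one that makes the claim true for
      \<open>C0\<close>; sums over cycles avoiding \<open>e\<close> do not change.\<close>
    define k' where "k' = k(e := f (cyc_edges C0) - (\<Sum>e\<in>path_edges p0. k e))"
    have k'_eq: "(\<Sum>e\<in>D. k' e) = (\<Sum>e\<in>D. k e)" if "e \<notin> D" for D
      using that by (intro sum.cong) (auto simp: k'_def)
    have k'0: "(\<Sum>e\<in>cyc_edges C0. k' e) = f (cyc_edges C0)"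
    proof -
      have "(\<Sum>e\<in>cyc_edges C0. k' e) = k' e + (\<Sum>e\<in>path_edges p0. k' e)"
        unfolding p0(3) by (rule sum.insert[OF finite_path_edges p0(4)])
      also have "\<dots> = f (cyc_edges C0)"
        unfolding k'_eq[OF p0(4)] by (simp only: k'_def fun_upd_same diff_add_cancel)
      finally show ?thesis .
    qed
    have k'e: "(\<Sum>e\<in>cyc_edges C. k' e) = f (cyc_edges C)" if "is_cyc (insert e E) C" "e \<notin> cyc_edges C" for C
      using k[OF noe[OF that]] k'_eq[OF that(2)] by simp
    have "(\<Sum>e\<in>cyc_edges C. k' e) = f (cyc_edges C)" if "is_cyc (insert e E) C" for C
      using that
    proof (induction "card (cyc_edges C - cyc_edges C0)" arbitrary: C rule: less_induct)
      case less
      note C = less.prems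
      show ?case
      proof (cases "e \<in> cyc_edges C")
        case False
        then show ?thesis using k'e C by blast
      next
        case e: True
        show ?thesis
        proof (cases "path_edges p0 \<subseteq> cyc_edges C")
          case True
          then have "cyc_edges C0 = cyc_edges C" using cycle_subset_eq[OF C C0(1)] p0(3) e by simp
          then show ?thesis using k'0 by simp
        next
          case False
          have eC: "{White (fst e), Black (snd e)} \<subseteq> set C" using e ends_cyc_edges[OF C] by (auto simp: ends_def)
          \<comment> \<open>As \<open>C0\<close> is not contained in \<open>C\<close>, some segment
            of \<open>p0\<close> leaves \<open>C\<close> and returns to it through edges that are
            not in \<open>C\<close>.\<close>
          obtain q where q: "upath (insert e E) q" "hd q \<in> set C" "last q \<in> set C" "hd q \<noteq> last q"
            "set q \<inter> set C = {hd q, last q}" "path_edges q \<subseteq> path_edges p0" "path_edges q \<inter> cyc_edges C = {}"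
          proof -
            have "{hd p0, last p0} \<subseteq> set C" using eC p0(2) by simp
            then have "hd p0 \<in> set C" "last p0 \<in> set C" by simp_all
            from ear_exists[OF p0(1) this False equalityD1[OF ends_cyc_edges[OF C]]]
            show ?thesis using that by (elim exE conjE) blast
          qed
          \<comment> \<open>The ends of the ear cut \<open>C\<close> into two arcs, named so that
            \<open>a\<close> contains \<open>e\<close>. The cycle \<open>C1\<close> of
            \<open>a\<close> and \<open>q\<close> will be closer to \<open>C0\<close>, while the
            cycle \<open>C2\<close> of \<open>b\<close> and \<open>q\<close> avoids
            \<open>e\<close>.\<close>
          obtain a b where ab: "upath (insert e E) a" "upath (insert e E) b" "hd a = hd q" "last a = last q"
            "hd b = hd q" "last b = last q" "set a \<inter> set b = {hd q, last q}"
            "path_edges a \<union> path_edges b = cyc_edges C" "path_edges a \<inter> path_edges b = {}"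
            "set a \<union> set b = set C" "e \<in> path_edges a"
          proof -
            obtain a b where ab: "upath (insert e E) a" "upath (insert e E) b" "hd a = hd q" "last a = last q"
              "hd b = hd q" "last b = last q" "set a \<inter> set b = {hd q, last q}"
              "path_edges a \<union> path_edges b = cyc_edges C" "path_edges a \<inter> path_edges b = {}"
              "set a \<union> set b = set C"
              using cycle_split[OF C q(2,3,4)] by metis
            show ?thesis
            proof (cases "e \<in> path_edges a")
              case True
              show ?thesis by (rule that[OF ab True])
            next
              case False
              then have eb: "e \<in> path_edges b" using ab(8) e by blast
              show ?thesis
                by (rule that[OF ab(2,1,5,6,3,4) _ _ _ _ eb]) (simp_all only: ab Int_commute[of "set b"] Int_commute[of "path_edges b"] Un_commute[of "path_edges b"] Un_commute[of "set b"])
            qed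
          qed
          have "hd q \<in> set a \<and> last q \<in> set a" "hd q \<in> set b \<and> last q \<in> set b" using ab(7) by auto
          then have sa: "set a \<inter> set q = {hd q, last q}" and sb: "set b \<inter> set q = {hd q, last q}"
            using q(5) ab(10) by blast+
          have dj: "path_edges a \<inter> path_edges q = {}" "path_edges b \<inter> path_edges q = {}"
            using ab(8) q(7) by blast+
          have th: "theta (insert e E) a b q"
            unfolding theta_def using ab q sa sb dj by simp
          obtain C1 where C1: "is_cyc (insert e E) C1" "cyc_edges C1 = path_edges a \<union> path_edges q"
            by (rule two_paths_cycle[OF ab(1) q(1)]) (use ab q sa dj in auto)
          obtain C2 where C2: "is_cyc (insert e E) C2" "cyc_edges C2 = path_edges b \<union> path_edges q"
            by (rule two_paths_cycle[OF ab(2) q(1)]) (use ab q sb dj in auto)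
          have e2: "e \<notin> cyc_edges C2" unfolding C2(2) using ab(9,11) q(6) p0(4) by blast
          \<comment> \<open>Otherwise \<open>C2\<close>, which avoids \<open>e\<close>, would be a
            cycle inside the path \<open>p0\<close>. So the passage from \<open>C\<close> to
            \<open>C1\<close> loses an edge outside \<open>C0\<close>, and the edges gained belong
            to \<open>C0\<close>.\<close>
          have "\<not> path_edges b \<subseteq> cyc_edges C0"
          proof
            assume "path_edges b \<subseteq> cyc_edges C0"
            then have "path_edges b \<subseteq> insert e (path_edges p0)" unfolding p0(3) .
            then have "cyc_edges C2 \<subseteq> insert e (path_edges p0)" unfolding C2(2) using q(6) by auto
            then have "cyc_edges C2 \<subseteq> path_edges p0" using e2 by (simp add: subset_insert)
            then show False using upath_no_cycle[OF p0(1)] is_cyc_cyc_edges[OF C2(1)] by blast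
          qed
          then obtain d where "d \<in> path_edges b" "d \<notin> cyc_edges C0" by blast
          then have "cyc_edges C1 - cyc_edges C0 \<subset> cyc_edges C - cyc_edges C0"
          proof (intro psubsetI)
            have "path_edges q \<subseteq> cyc_edges C0" using q(6) p0(3) by auto
            then show "cyc_edges C1 - cyc_edges C0 \<subseteq> cyc_edges C - cyc_edges C0"
              unfolding C1(2) ab(8)[symmetric] by blast
            have "d \<notin> cyc_edges C1"
              using \<open>d \<in> path_edges b\<close> ab(9) \<open>path_edges q \<subseteq> cyc_edges C0\<close> \<open>d \<notin> cyc_edges C0\<close> unfolding C1(2) by blast
            moreover have "d \<in> cyc_edges C" using \<open>d \<in> path_edges b\<close> unfolding ab(8)[symmetric] by blast
            ultimately show "cyc_edges C1 - cyc_edges C0 \<noteq> cyc_edges C - cyc_edges C0"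
              using \<open>d \<notin> cyc_edges C0\<close> by auto
          qed
          then have "card (cyc_edges C1 - cyc_edges C0) < card (cyc_edges C - cyc_edges C0)"
            by (intro psubset_card_mono) auto
          then have s1: "(\<Sum>e\<in>cyc_edges C1. k' e) = f (cyc_edges C1)" using less.hyps C1 by blast
          have s2: "(\<Sum>e\<in>cyc_edges C2. k' e) = f (cyc_edges C2)" using k'e[OF C2(1) e2] .
          have "(\<Sum>e\<in>cyc_edges C. k' e) = (\<Sum>e\<in>path_edges a. k' e) + (\<Sum>e\<in>path_edges b. k' e)"
            unfolding ab(8)[symmetric] by (rule sum.union_disjoint) (use ab in auto)
          \<comment> \<open>Modulo 2 the ear can be added twice.\<close>
          also have "\<dots> = ((\<Sum>e\<in>path_edges a. k' e) + (\<Sum>e\<in>path_edges q. k' e))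
              + ((\<Sum>e\<in>path_edges b. k' e) + (\<Sum>e\<in>path_edges q. k' e))"
          proof -
            have "x + y = (x + z) + (y + z)" for x y z :: bit by (cases x; cases y; cases z) simp_all
            then show ?thesis .
          qed
          also have "\<dots> = f (cyc_edges C1) + f (cyc_edges C2)"
          proof -
            have "sum k' (cyc_edges C1) = sum k' (path_edges a) + sum k' (path_edges q)"
              unfolding C1(2) using dj by (intro sum.union_disjoint) auto
            moreover have "sum k' (cyc_edges C2) = sum k' (path_edges b) + sum k' (path_edges q)"
              unfolding C2(2) using dj by (intro sum.union_disjoint) auto
            ultimately show ?thesis by (simp only: s1 s2)
          qed
          also have "\<dots> = f (cyc_edges C)"
            using insert.prems[OF th] C1(2) C2(2) ab(8) by simp
          finally show ?thesis .
        qed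
      qed
    qed
    then show ?thesis by blast
  qed
qed

section \<open>Evaluation of cohomology classes\<close>

text \<open>Induction on the edges. Across a bridge, the potential can be shifted by a constant on
  one of the two sides to fit the value at the bridge. If the new edge lies on a cycle, vanishing on
  this cycle forces its value to agree with the potential already found.\<close>

lemma coboundary_exists:
  fixes \<phi> :: "nat \<times> nat \<Rightarrow> 'a::ab_group_add"
  assumes "finite E" "\<And>C. is_cyc E C \<Longrightarrow> pairing E \<phi> (cycle_chain C) = 0"
  shows "\<exists>f. \<forall>(i, j)\<in>E. \<phi> (i, j) = f (White i) - f (Black j)"
  using assms
proof (induction E rule: finite_induct)
  case (insert e E)
  have fin: "finite (insert e E)" "e \<in> insert e E" "insert e E - {e} = E" using insert by auto
  have "pairing E \<phi> (cycle_chain C) = 0" if "is_cyc E C" for C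
  proof -
    have "pairing (insert e E) \<phi> (cycle_chain C) = pairing E \<phi> (cycle_chain C)"
      using closed_chain_outside[OF closed_cycle_chain[OF insert.hyps(1) that]] fin by (intro pairing_superset) auto
    then show ?thesis using insert.prems[OF is_cyc_mono[OF that]] by auto
  qed
  then obtain f where f: "\<And>i j. (i, j) \<in> E \<Longrightarrow> \<phi> (i, j) = f (White i) - f (Black j)"
    using insert.IH by fastforce
  from fin(1,2) show ?case
  proof (cases rule: bridge_or_cycle)
    case bridge
    define R where "R = (adj E)\<^sup>*\<^sup>* (White (fst e))"
    \<comment> \<open>The error of the old potential at the bridge; adding it on the component of
      the white end corrects it and changes no difference along the other edges.\<close>
    define t where "t = \<phi> e - (f (White (fst e)) - f (Black (snd e)))"
    define g where "g = (\<lambda>v. f v + (if R v then t else 0))"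
    have "\<phi> (i, j) = g (White i) - g (Black j)" if "(i, j) \<in> insert e E" for i j
    proof (cases "(i, j) = e")
      case True
      have "R (White i)" "\<not> R (Black j)"
        using bridge(1)[unfolded fin(3)] unfolding R_def True[symmetric] by simp_all
      then show ?thesis using True by (auto simp: g_def t_def)
    next
      case False
      then have ij: "(i, j) \<in> E" using that by auto
      then have a: "adj E (White i) (Black j)" "adj E (Black j) (White i)" by (auto simp: adj_def)
      have "R (White i) \<longleftrightarrow> R (Black j)" unfolding R_def
        using rtranclp.rtrancl_into_rtrancl[of "adj E", OF _ a(1)] rtranclp.rtrancl_into_rtrancl[of "adj E", OF _ a(2)]
        by blast
      then show ?thesis using f[OF ij] by (simp add: g_def)
    qed
    then show ?thesis by blast
  next
    case (cycle p)
    let ?\<psi> = "\<lambda>e. f (White (fst e)) - f (Black (snd e))"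
    have cl: "closed_chain (insert e E) (cycle_chain p)" using closed_cycle_chain[OF fin(1) cycle(4)] .
    have "pairing (insert e E) (\<lambda>d. \<phi> d - ?\<psi> d) (cycle_chain p) = 0"
      using pairing_coboundary[OF fin(1) cl, of ?\<psi> f] insert.prems[OF cycle(4)] by (simp add: pairing_diff_left)
    moreover have "pairing (insert e E) (\<lambda>d. \<phi> d - ?\<psi> d) (cycle_chain p) = \<phi> e - ?\<psi> e"
    proof -
      have "(\<Sum>d\<in>E. int_scale (cycle_chain p d) (\<phi> d - ?\<psi> d)) = 0"
        by (rule sum.neutral) (auto simp: f)
      then show ?thesis unfolding pairing_def using insert.hyps cycle(5) by simp
    qed
    ultimately have "\<phi> e = ?\<psi> e" by simp
    then show ?thesis using f by (intro exI[of _ f]) auto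
  qed
qed auto

lemma cohomologousI:
  assumes "\<phi> \<in> cochains G" "\<psi> \<in> cochains G"
    "\<And>i j. (i, j) \<in> edges G \<Longrightarrow> \<phi> (i, j) - \<psi> (i, j) = f (White i) - f (Black j)"
  shows "(\<phi>, \<psi>) \<in> cohomologous G"
  using assms unfolding cohomologous_def by (auto intro!: exI[of _ f])

context plane_graph
begin

lemma equiv_cohomologous: "equiv (cochains G) (cohomologous G :: ((nat \<times> nat \<Rightarrow> 'a::ab_group_add) \<times> _) set)"
proof (rule equivI)
  show "cohomologous G \<subseteq> (cochains G :: (nat \<times> nat \<Rightarrow> 'a) set) \<times> cochains G" by (auto simp: cohomologous_def)
  show "refl_on (cochains G) (cohomologous G :: ((nat \<times> nat \<Rightarrow> 'a) \<times> _) set)"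
    by (rule refl_onI) (auto simp: cohomologous_def intro!: exI[of _ "\<lambda>_. 0"])
  show "sym (cohomologous G :: ((nat \<times> nat \<Rightarrow> 'a) \<times> _) set)"
  proof (rule symI)
    fix \<phi> \<psi> :: "nat \<times> nat \<Rightarrow> 'a" assume "(\<phi>, \<psi>) \<in> cohomologous G"
    then obtain f where *: "\<phi> \<in> cochains G" "\<psi> \<in> cochains G"
      "\<And>i j. (i, j) \<in> edges G \<Longrightarrow> \<phi> (i, j) - \<psi> (i, j) = f (White i) - f (Black j)"
      unfolding cohomologous_def by blast
    have "\<psi> (i, j) - \<phi> (i, j) = (\<lambda>v. - f v) (White i) - (\<lambda>v. - f v) (Black j)"
      if "(i, j) \<in> edges G" for i j
      using arg_cong[OF *(3)[OF that], of uminus] by simp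
    with *(1,2) show "(\<psi>, \<phi>) \<in> cohomologous G" by (intro cohomologousI[where f = "\<lambda>v. - f v"])
  qed
  show "trans (cohomologous G :: ((nat \<times> nat \<Rightarrow> 'a) \<times> _) set)"
  proof (rule transI)
    fix \<phi> \<psi> \<omega> :: "nat \<times> nat \<Rightarrow> 'a" assume "(\<phi>, \<psi>) \<in> cohomologous G" "(\<psi>, \<omega>) \<in> cohomologous G"
    then obtain f g where *: "\<phi> \<in> cochains G" "\<omega> \<in> cochains G"
      "\<And>i j. (i, j) \<in> edges G \<Longrightarrow> \<phi> (i, j) - \<psi> (i, j) = f (White i) - f (Black j)"
      "\<And>i j. (i, j) \<in> edges G \<Longrightarrow> \<psi> (i, j) - \<omega> (i, j) = g (White i) - g (Black j)"
      unfolding cohomologous_def by blast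
    have "\<phi> (i, j) - \<omega> (i, j) = (\<lambda>v. f v + g v) (White i) - (\<lambda>v. f v + g v) (Black j)"
      if "(i, j) \<in> edges G" for i j
    proof -
      have "\<phi> (i, j) - \<omega> (i, j) = (\<phi> (i, j) - \<psi> (i, j)) + (\<psi> (i, j) - \<omega> (i, j))" by simp
      then show ?thesis unfolding *(3,4)[OF that] by (simp add: algebra_simps)
    qed
    then show "(\<phi>, \<omega>) \<in> cohomologous G" using *(1,2) by (intro cohomologousI[where f = "\<lambda>v. f v + g v"])
  qed
qed

lemma pairing_cohomologous:
  assumes "(\<phi>, \<psi>) \<in> cohomologous G" "closed_chain (edges G) c"
  shows "pairing (edges G) \<phi> c = pairing (edges G) \<psi> c"
proof -
  obtain f where "\<And>i j. (i, j) \<in> edges G \<Longrightarrow> \<phi> (i, j) - \<psi> (i, j) = f (White i) - f (Black j)"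
    using assms(1) unfolding cohomologous_def by blast
  then have "pairing (edges G) (\<lambda>e. \<phi> e - \<psi> e) c = 0"
    using pairing_coboundary[OF finite_edges assms(2), of "\<lambda>e. \<phi> e - \<psi> e" f] by blast
  then show ?thesis by (simp add: pairing_diff_left)
qed

lemma evaluate_eq:
  assumes "X \<noteq> {}" "\<And>\<phi>. \<phi> \<in> X \<Longrightarrow> pairing (edges H) \<phi> c = v"
  shows "evaluate H X c = v"
  unfolding evaluate_def pairing_def[symmetric] using assms by (intro the_equality) blast+

lemma evaluate_class:
  assumes "\<phi> \<in> cochains G" "closed_chain (edges G) c"
  shows "evaluate G (cohomologous G `` {\<phi>}) c = pairing (edges G) \<phi> c"
proof (rule evaluate_eq)
  show "cohomologous G `` {\<phi>} \<noteq> {}"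
    using equiv_class_self[OF equiv_cohomologous assms(1)] by blast
qed (use pairing_cohomologous[OF _ assms(2), symmetric] in auto)

text \<open>The representatives differ by a cochain that vanishes on all cycles, hence by a
  coboundary. This gives the uniqueness in the definition of \<open>kasteleyn_class\<close>.\<close>

lemma class_eqI:
  fixes X Y :: "(nat \<times> nat \<Rightarrow> 'a::ab_group_add) set"
  assumes "X \<in> cohomology G" "Y \<in> cohomology G"
    and "\<And>C. is_cycle G C \<Longrightarrow> evaluate G X (cycle_chain C) = evaluate G Y (cycle_chain C)"
  shows "X = Y"
proof -
  obtain \<phi> \<psi> where \<phi>: "\<phi> \<in> cochains G" "X = cohomologous G `` {\<phi>}" and \<psi>: "\<psi> \<in> cochains G" "Y = cohomologous G `` {\<psi>}"
    using assms(1,2) unfolding cohomology_def by (auto elim!: quotientE)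
  have "pairing (edges G) (\<lambda>e. \<phi> e - \<psi> e) (cycle_chain C) = 0" if "is_cyc (edges G) C" for C
  proof -
    have "closed_chain (edges G) (cycle_chain C)" using closed_cycle_chain[OF finite_edges that] .
    then show ?thesis using assms(3)[of C] that evaluate_class[OF \<phi>(1)] evaluate_class[OF \<psi>(1)]
      by (simp add: is_cycle_iff pairing_diff_left \<phi>(2) \<psi>(2))
  qed
  then obtain f where "\<And>i j. (i, j) \<in> edges G \<Longrightarrow> \<phi> (i, j) - \<psi> (i, j) = f (White i) - f (Black j)"
    using coboundary_exists[OF finite_edges, of "\<lambda>e. \<phi> e - \<psi> e"] by fastforce
  then have "(\<phi>, \<psi>) \<in> cohomologous G" using \<phi>(1) \<psi>(1) by (intro cohomologousI)
  then show ?thesis using \<phi>(2) \<psi>(2) equiv_class_eq[OF equiv_cohomologous] by blast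
qed

end

section \<open>The Kasteleyn class\<close>

text \<open>The difference of the winding numbers of the arcs is that of a simple loop, so it is
  constant and nonzero inside and 0 outside.\<close>

lemma two_arcs_loop:
  fixes c d :: "real \<Rightarrow> complex"
  assumes "arc c" "arc d" "pathstart d = pathstart c" "pathfinish d = pathfinish c"
    "path_image c \<inter> path_image d = {pathstart c, pathfinish c}"
  shows "simple_path (c +++ reversepath d)" "pathfinish (c +++ reversepath d) = pathstart (c +++ reversepath d)"
    "path_image (c +++ reversepath d) = path_image c \<union> path_image d"
    "\<exists>\<epsilon>::complex. \<epsilon> \<noteq> 0 \<and> (\<forall>z. z \<notin> path_image c \<union> path_image d \<longrightarrow>
       winding_number c z - winding_number d z = \<epsilon> * of_bool (z \<in> inside (path_image c \<union> path_image d)))"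
proof -
  let ?l = "c +++ reversepath d"
  let ?J = "path_image c \<union> path_image d"
  show sp: "simple_path ?l"
    using assms by (intro simple_path_join_loop) (auto simp: arc_reversepath)
  show cl: "pathfinish ?l = pathstart ?l" using assms by simp
  show im: "path_image ?l = ?J" using assms by (simp add: path_image_join)
  have wn: "winding_number c z - winding_number d z = winding_number ?l z" if "z \<notin> ?J" for z
    using assms that by (subst winding_number_join) (auto simp: arc_imp_path winding_number_reversepath)
  have out: "winding_number ?l z = 0" if "z \<notin> ?J" "z \<notin> inside ?J" for z
  proof -
    have "z \<in> inside ?J \<union> outside ?J" unfolding inside_Un_outside using that(1) by simp
    then have "z \<in> outside (path_image ?l)" using that(2) unfolding im by blast
    then show ?thesis using sp cl by (intro winding_number_zero_in_outside) (simp_all add: simple_path_imp_path)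
  qed
  obtain \<epsilon> where "\<epsilon> \<noteq> 0" "\<And>z. z \<in> inside ?J \<Longrightarrow> winding_number ?l z = \<epsilon>"
    using simple_closed_path_winding_number_inside[OF sp] im by (metis one_neq_zero neg_equal_0_iff_equal)
  then show "\<exists>\<epsilon>::complex. \<epsilon> \<noteq> 0 \<and> (\<forall>z. z \<notin> ?J \<longrightarrow>
       winding_number c z - winding_number d z = \<epsilon> * of_bool (z \<in> inside ?J))"
    using wn out by (intro exI[of _ \<epsilon>]) auto
qed

text \<open>If none of the three arcs were inside the loop formed by the other two, the inside of
  \<open>c\<^sub>1 \<union> c\<^sub>2\<close> would be outside the other two loops, which is impossible since the winding numbers of
  the three loops add up to zero.\<close>

lemma theta_arc_inside:
  fixes c1 c2 c3 :: "real \<Rightarrow> complex"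
  assumes arcs: "arc c1" "arc c2" "arc c3"
    and s: "pathstart c2 = pathstart c1" "pathstart c3 = pathstart c1"
    and f: "pathfinish c2 = pathfinish c1" "pathfinish c3 = pathfinish c1"
    and i12: "path_image c1 \<inter> path_image c2 = {pathstart c1, pathfinish c1}"
    and i13: "path_image c1 \<inter> path_image c3 = {pathstart c1, pathfinish c1}"
    and i23: "path_image c2 \<inter> path_image c3 = {pathstart c1, pathfinish c1}"
  shows "path_image c3 \<inter> inside (path_image c1 \<union> path_image c2) \<noteq> {} \<or>
    path_image c2 \<inter> inside (path_image c1 \<union> path_image c3) \<noteq> {} \<or>
    path_image c1 \<inter> inside (path_image c2 \<union> path_image c3) \<noteq> {}"
proof (rule ccontr)
  let ?A = "path_image c1" and ?B = "path_image c2" and ?C = "path_image c3"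
  let ?a = "pathstart c1" and ?b = "pathfinish c1"
  assume "\<not> ?thesis"
  then have no: "?C \<inter> inside (?A \<union> ?B) = {}" "?B \<inter> inside (?A \<union> ?C) = {}" "?A \<inter> inside (?B \<union> ?C) = {}" by auto
  note l12 = two_arcs_loop[OF arcs(1,2) s(1) f(1) i12]
  note l13 = two_arcs_loop[OF arcs(1,3) s(2) f(2) i13]
  have l23: "\<exists>\<epsilon>::complex. \<epsilon> \<noteq> 0 \<and> (\<forall>z. z \<notin> ?B \<union> ?C \<longrightarrow>
       winding_number c2 z - winding_number c3 z = \<epsilon> * of_bool (z \<in> inside (?B \<union> ?C)))"
    using s f i23 by (intro two_arcs_loop(4) arcs) auto
  obtain \<epsilon>12 \<epsilon>13 \<epsilon>23 :: complex where \<epsilon>: "\<epsilon>12 \<noteq> 0"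
    "\<And>z. z \<notin> ?A \<union> ?B \<Longrightarrow> winding_number c1 z - winding_number c2 z = \<epsilon>12 * of_bool (z \<in> inside (?A \<union> ?B))"
    "\<And>z. z \<notin> ?A \<union> ?C \<Longrightarrow> winding_number c1 z - winding_number c3 z = \<epsilon>13 * of_bool (z \<in> inside (?A \<union> ?C))"
    "\<And>z. z \<notin> ?B \<union> ?C \<Longrightarrow> winding_number c2 z - winding_number c3 z = \<epsilon>23 * of_bool (z \<in> inside (?B \<union> ?C))"
    using l12(4) l13(4) l23 by metis
  let ?I = "inside (?A \<union> ?B)"
  note J = Jordan_inside_outside[OF l12(1,2), unfolded l12(3)]
  have IAB: "?I \<inter> (?A \<union> ?B) = {}" using inside_no_overlap[of "?A \<union> ?B"] by blast
  have conn: "connected ?I" using J by blast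
  have closed: "closed ?A" "closed ?B" "closed ?C"
    using arcs by (simp_all add: closed_arc_image)
  \<comment> \<open>A point \<open>p\<close> of the loop is a limit of points of its inside, and if
    \<open>p\<close> lies outside \<open>K\<close>, then so does a neighbourhood of
    \<open>p\<close>. This will be applied to an inner point of each of the first two arcs.\<close>
  have near: "\<exists>x. x \<in> ?I \<and> x \<notin> inside K"
    if X: "X \<subseteq> ?A \<union> ?B" "p \<in> X" "p \<notin> K" "closed K" "p \<notin> inside K" for X K p
  proof -
    have "p \<in> inside K \<union> outside K" unfolding inside_Un_outside using that(3) by simp
    then have "p \<in> outside K" using that by blast
    moreover have "open (outside K)" using that(4) by (rule open_outside)
    moreover have "p \<in> closure ?I" using J X by (auto simp: frontier_def)
    ultimately obtain x where "x \<in> ?I" "x \<in> outside K" using open_Int_closure_eq_empty[of "outside K" ?I] by blast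
    then show ?thesis using inside_Int_outside[of K] by blast
  qed
  obtain p where p: "p \<in> ?A" "p \<noteq> ?a" "p \<noteq> ?b"
    using nonempty_simple_path_endless[OF arc_imp_simple_path[OF arcs(1)]] by blast
  obtain q where q: "q \<in> ?B" "q \<noteq> ?a" "q \<noteq> ?b"
    using nonempty_simple_path_endless[OF arc_imp_simple_path[OF arcs(2)]] s f by auto
  obtain x where x: "x \<in> ?I" "x \<notin> inside (?B \<union> ?C)"
    using near[of ?A p "?B \<union> ?C"] p i12 i13 closed no(3) by auto
  obtain y where y: "y \<in> ?I" "y \<notin> inside (?A \<union> ?C)"
    using near[of ?B q "?A \<union> ?C"] q i12 i23 closed no(2) by auto
  have IABC: "?I \<inter> (?A \<union> ?B \<union> ?C) = {}" using IAB no(1) by blast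
  \<comment> \<open>The set \<open>?I\<close> is connected and avoids all three arcs, so what is
    known about \<open>y\<close> carries over to \<open>x\<close>. At \<open>x\<close> two of the
    three differences of winding numbers then vanish, hence also the third, although
    \<open>x\<close> lies in \<open>?I\<close>.\<close>
  have "x \<in> inside (?A \<union> ?C) \<longleftrightarrow> y \<in> inside (?A \<union> ?C)"
  proof -
    have "connected_component (- (?A \<union> ?C)) x y"
      unfolding connected_component_def using conn IABC x y by (intro exI[of _ ?I]) auto
    then show ?thesis using inside_same_component connected_component_sym by blast
  qed
  then have "x \<notin> inside (?A \<union> ?C)" using y by simp
  moreover have "x \<notin> ?A \<union> ?B \<union> ?C" using IABC x by blast
  ultimately have "winding_number c1 x - winding_number c2 x = 0" using x \<epsilon>(3,4)[of x] by simp
  then show False using \<epsilon>(1) \<epsilon>(2)[of x] x(1) \<open>x \<notin> ?A \<union> ?B \<union> ?C\<close> by simp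
qed

section \<open>The prescribed sign of a cycle and its additivity\<close>

fun is_white :: "vertex \<Rightarrow> bool" where
  "is_white (White _) = True"
| "is_white (Black _) = False"

lemma upath_parity:
  assumes "upath E p" shows "odd (length p) \<longleftrightarrow> (is_white (hd p) \<longleftrightarrow> is_white (last p))"
  using assms
proof (induction p rule: path_edges.induct)
  case (1 u v p)
  then have "is_white u \<longleftrightarrow> \<not> is_white v" by (auto simp: upath_def adj_def edge_between_Some)
  then show ?case using 1 by (auto simp: upath_Cons2)
qed (auto simp: upath_def)

context plane_graph
begin

definition inner_vertices :: "(nat \<times> nat) set \<Rightarrow> vertex set" where
  "inner_vertices D = {v \<in> vertices G. place G v \<in> inside (img D)}"

text \<open>The value prescribed for the Kasteleyn class, as a function of the edge set instead of
  the vertex list: the cycles of a theta graph are unions of the edge sets of two paths, and no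
  vertex order is then needed.\<close>

definition kasteleyn_sign :: "(nat \<times> nat) set \<Rightarrow> bit" where
  "kasteleyn_sign D = of_nat (card (inner_vertices D) + card D div 2 + 1)"

lemma finite_inner_vertices: "finite (inner_vertices D)"
  using finite_vertices by (simp add: inner_vertices_def)

lemma kasteleyn_sign_cycle:
  assumes "is_cyc E C"
  shows "kasteleyn_sign (cyc_edges C) = of_nat (card (interior_vertices G C) + length C div 2 + 1)"
  using cycle_image_eq[OF assms] card_cyc_edges[OF assms]
  by (simp add: kasteleyn_sign_def inner_vertices_def interior_vertices_def)

lemma theta_arcs:
  assumes th: "theta (edges G) p q r"
  shows "arc (list_path p)" "pathstart (list_path p) = place G (hd p)" "pathfinish (list_path p) = place G (last p)"
    "path_image (list_path p) = img (path_edges p)"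
    "img (path_edges p) \<inter> img (path_edges q) = {place G (hd p), place G (last p)}"
proof -
  have p: "upath (edges G) p" "upath (edges G) q" "hd p \<noteq> last p" "hd q = hd p" "last q = last p"
     "set p \<inter> set q = {hd p, last p}" "path_edges p \<inter> path_edges q = {}"
    using th by (auto simp: theta_def)
  have len: "length p \<ge> 2" "length q \<ge> 2"
    using upath_ends_decomp[OF p(1,3)] upath_ends_decomp[OF p(2)] p by (metis One_nat_def Suc_1 Suc_le_mono append_is_Nil_conv
      length_Cons length_append_singleton le0 not_less_eq_eq)+
  note l = list_path[OF p(1) len(1)]
  show "arc (list_path p)" "pathstart (list_path p) = place G (hd p)" "pathfinish (list_path p) = place G (last p)"
    "path_image (list_path p) = img (path_edges p)" using l by auto
  have E: "path_edges p \<subseteq> edges G" "path_edges q \<subseteq> edges G" using upath_edges_subset p by auto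
  have en: "ends (path_edges p) = set p" "ends (path_edges q) = set q"
    using ends_path_edges p(1,2) len unfolding upath_def by blast+
  have sub: "img (path_edges p) \<inter> img (path_edges q) \<subseteq> {place G (hd p), place G (last p)}"
    using img_Int[OF E p(7)] unfolding en p(6) by simp
  have "hd p \<in> vertices G" "last p \<in> vertices G"
    using ends_vertices[OF E(1)] en(1) p(1) by (auto simp: upath_def)
  then have "{place G (hd p), place G (last p)} \<subseteq> img (path_edges p) \<inter> img (path_edges q)"
    using vertex_in_img[OF E(1)] vertex_in_img[OF E(2)] en p(6) by auto
  then show "img (path_edges p) \<inter> img (path_edges q) = {place G (hd p), place G (last p)}" using sub by blast
qed

text \<open>The path \<open>r\<close> divides the inside of the loop of \<open>p\<close> and
  \<open>q\<close>; the vertices there are those inside the two smaller loops and the inner vertices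
  of \<open>r\<close>. If the paths have P, Q and R edges, which are numbers of equal parity, then
  the half lengths of the loops add up to P + Q + R, the vertex counts to an even number plus R - 1,
  and the constants to 3. The total is even because P + Q is.\<close>

lemma kasteleyn_sign_theta_aux:
  assumes th: "theta (edges G) p q r"
    and ne: "img (path_edges r) \<inter> inside (img (path_edges p) \<union> img (path_edges q)) \<noteq> {}"
  shows "kasteleyn_sign (path_edges p \<union> path_edges q) + kasteleyn_sign (path_edges p \<union> path_edges r)
    + kasteleyn_sign (path_edges q \<union> path_edges r) = 0"
proof -
  have p: "upath (edges G) p" "upath (edges G) q" "upath (edges G) r" "hd p \<noteq> last p"
     "hd q = hd p" "last q = last p" "hd r = hd p" "last r = last p"
     "set p \<inter> set q = {hd p, last p}" "path_edges p \<inter> path_edges q = {}"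
     "path_edges p \<inter> path_edges r = {}" "path_edges q \<inter> path_edges r = {}"
    using th by (auto simp: theta_def)
  have th': "theta (edges G) q p r" "theta (edges G) r p q" "theta (edges G) p r q" "theta (edges G) q r p"
    using th unfolding theta_def by (auto simp: Int_commute)
  note a1 = theta_arcs[OF th] and a2 = theta_arcs[OF th'(1)] and a3 = theta_arcs[OF th'(2)]
    and a13 = theta_arcs[OF th'(3)] and a23 = theta_arcs[OF th'(4)]
  let ?A = "img (path_edges p)" and ?B = "img (path_edges q)" and ?C = "img (path_edges r)"
  let ?a = "place G (hd p)" and ?b = "place G (last p)"
  have ab: "?a \<noteq> ?b" using arc_distinct_ends[OF a1(1)] a1 by simp
  obtain i1: "inside (?A \<union> ?C) \<inter> inside (?B \<union> ?C) = {}"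
    and i2: "inside (?A \<union> ?C) \<union> inside (?B \<union> ?C) \<union> (?C - {?a, ?b}) = inside (?A \<union> ?B)"
    using split_inside_simple_closed_curve[OF arc_imp_simple_path[OF a1(1)] a1(2,3)
        arc_imp_simple_path[OF a2(1)] _ _ arc_imp_simple_path[OF a3(1)] _ _ ab, unfolded a1(4) a2(4) a3(4)]
      a2 a3 a1(5) a13(5) a23(5) p ne by metis
  have iC: "inside (?A \<union> ?C) \<inter> ?C = {}" "inside (?B \<union> ?C) \<inter> ?C = {}"
    using inside_no_overlap[of "?A \<union> ?C"] inside_no_overlap[of "?B \<union> ?C"] by blast+
  have Er: "path_edges r \<subseteq> edges G" using upath_edges_subset p by auto
  have len: "length r \<ge> 2"
    using upath_ends_decomp[OF p(3)] p by (metis One_nat_def Suc_1 Suc_le_mono append_is_Nil_conv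
      length_Cons length_append_singleton le0 not_less_eq_eq)
  have lenp: "length p \<ge> 1" "length q \<ge> 1" using p by (auto simp: upath_def Suc_le_eq)
  have er: "ends (path_edges r) = set r" using ends_path_edges p(3) len unfolding upath_def by blast
  have rV: "set r \<subseteq> vertices G" using ends_vertices[OF Er] er by simp
  define N where "N = set r - {hd p, last p}"
  have N: "{v \<in> vertices G. place G v \<in> ?C - {?a, ?b}} = N"
  proof -
    have "place G v \<in> ?C - {?a, ?b} \<longleftrightarrow> v \<in> N" if v: "v \<in> vertices G" for v
    proof -
      have "hd r \<in> set r" "last r \<in> set r" using p(3) by (auto simp: upath_def)
      then have "hd p \<in> vertices G" "last p \<in> vertices G" using rV p by auto
      then have "place G v = ?a \<longleftrightarrow> v = hd p" "place G v = ?b \<longleftrightarrow> v = last p"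
        using inj_place v by (auto simp: inj_on_def)
      then show ?thesis using vertex_in_img[OF Er v] er by (auto simp: N_def)
    qed
    moreover have "N \<subseteq> vertices G" using rV by (auto simp: N_def)
    ultimately show ?thesis by blast
  qed
  have cN: "card N = length r - 2"
  proof -
    have "card (set r) = length r" using p(3) by (simp add: upath_def distinct_card)
    moreover have "{hd p, last p} \<subseteq> set r" using p by (metis empty_subsetI hd_in_set insert_subset last_in_set upath_def)
    ultimately show ?thesis unfolding N_def using p(4) by (subst card_Diff_subset) auto
  qed
  let ?V = "\<lambda>x y. inner_vertices (path_edges x \<union> path_edges y)"
  have "?V p q = ?V p r \<union> ?V q r \<union> N"
    unfolding inner_vertices_def img_Un i2[symmetric] N[symmetric] by blast
  moreover have "?V p r \<inter> ?V q r = {}" "(?V p r \<union> ?V q r) \<inter> N = {}"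
    unfolding inner_vertices_def img_Un N[symmetric] using i1 iC by blast+
  moreover have "finite N" by (simp add: N_def)
  ultimately have cV: "card (?V p q) = card (?V p r) + card (?V q r) + (length r - 2)"
    using finite_inner_vertices cN by (metis card_Un_disjoint finite_Un)
  have cE: "card (path_edges p \<union> path_edges q) = (length p - 1) + (length q - 1)"
    "card (path_edges p \<union> path_edges r) = (length p - 1) + (length r - 1)"
    "card (path_edges q \<union> path_edges r) = (length q - 1) + (length r - 1)"
    using card_path_edges p by (simp_all add: card_Un_disjoint)
  have par: "odd (length p) \<longleftrightarrow> odd (length r)" "odd (length q) \<longleftrightarrow> odd (length r)"
    using upath_parity[OF p(1)] upath_parity[OF p(2)] upath_parity[OF p(3)] p by auto
  \<comment> \<open>Here \<open>s\<close> is the common parity of the numbers of edges, which are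
    the lengths of the vertex lists minus 1.\<close>
  obtain a b c s where abc: "length p = 2 * a + s + 1" "length q = 2 * b + s + 1" "length r = 2 * c + s + 1" "s < 2"
  proof -
    have "length p = 2 * ((length p - 1) div 2) + (length p - 1) mod 2 + 1"
      "length q = 2 * ((length q - 1) div 2) + (length q - 1) mod 2 + 1"
      "length r = 2 * ((length r - 1) div 2) + (length r - 1) mod 2 + 1"
      using lenp len by auto
    moreover have "(length p - 1) mod 2 = (length r - 1) mod 2" "(length q - 1) mod 2 = (length r - 1) mod 2"
      using par lenp len by (auto simp: mod2_eq_if)
    ultimately show ?thesis using that[of _ "(length r - 1) mod 2"] by (metis mod_less_divisor pos2)
  qed
  have eq2: "(2 * x + s + (2 * y + s)) div 2 = x + y + s" for x y :: nat by simp
  have nat_even: "even (card (?V p q) + card (path_edges p \<union> path_edges q) div 2 + 1 +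
      (card (?V p r) + card (path_edges p \<union> path_edges r) div 2 + 1) +
      (card (?V q r) + card (path_edges q \<union> path_edges r) div 2 + 1))"
    unfolding cV cE abc add_diff_cancel_right' eq2 using len abc(3,4) by auto
  then have "of_nat (card (?V p q) + card (path_edges p \<union> path_edges q) div 2 + 1 +
      (card (?V p r) + card (path_edges p \<union> path_edges r) div 2 + 1) +
      (card (?V q r) + card (path_edges q \<union> path_edges r) div 2 + 1)) = (0 :: bit)"
    by (metis bit_add_self evenE mult_2 of_nat_add)
  then show ?thesis unfolding kasteleyn_sign_def of_nat_add by (simp add: add.assoc)
qed

text \<open>Modulo 2 the relation says that the three values add up to 0, which is symmetric in the
  paths. So it suffices that some path runs inside the loop of the other two.\<close>

lemma kasteleyn_sign_theta:
  assumes th: "theta (edges G) p q r"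
  shows "kasteleyn_sign (path_edges p \<union> path_edges q) =
    kasteleyn_sign (path_edges p \<union> path_edges r) + kasteleyn_sign (path_edges q \<union> path_edges r)"
proof -
  have th': "theta (edges G) q p r" "theta (edges G) r p q" "theta (edges G) p r q" "theta (edges G) q r p"
    using th unfolding theta_def by (auto simp: Int_commute)
  note a1 = theta_arcs[OF th] and a2 = theta_arcs[OF th'(1)] and a3 = theta_arcs[OF th'(2)]
    and a13 = theta_arcs[OF th'(3)] and a23 = theta_arcs[OF th'(4)]
  have e: "hd q = hd p" "last q = last p" "hd r = hd p" "last r = last p" using th by (auto simp: theta_def)
  let ?k = "\<lambda>x y. kasteleyn_sign (path_edges x \<union> path_edges y)"
  have "img (path_edges r) \<inter> inside (img (path_edges p) \<union> img (path_edges q)) \<noteq> {} \<or>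
    img (path_edges q) \<inter> inside (img (path_edges p) \<union> img (path_edges r)) \<noteq> {} \<or>
    img (path_edges p) \<inter> inside (img (path_edges q) \<union> img (path_edges r)) \<noteq> {}"
    using theta_arc_inside[OF a1(1) a2(1) a3(1), unfolded a1(4) a2(4) a3(4)]
      a1(2,3,5) a2(2,3) a3(2,3) a13(5) a23(5) e by simp
  then have "?k p q + ?k p r + ?k q r = 0"
  proof (elim disjE)
    assume "img (path_edges r) \<inter> inside (img (path_edges p) \<union> img (path_edges q)) \<noteq> {}"
    then show ?thesis by (rule kasteleyn_sign_theta_aux[OF th])
  next
    assume "img (path_edges q) \<inter> inside (img (path_edges p) \<union> img (path_edges r)) \<noteq> {}"
    from kasteleyn_sign_theta_aux[OF th'(3) this] show ?thesis
      by (simp only: Un_commute[of "path_edges r" "path_edges q"] add_ac)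
  next
    assume "img (path_edges p) \<inter> inside (img (path_edges q) \<union> img (path_edges r)) \<noteq> {}"
    from kasteleyn_sign_theta_aux[OF th'(4) this] show ?thesis
      by (simp only: Un_commute[of "path_edges q" "path_edges p"] Un_commute[of "path_edges r" "path_edges p"] add_ac)
  qed
  moreover have "x = y + z" if "x + y + z = 0" for x y z :: bit
    using that by (cases x; cases y; cases z) simp_all
  ultimately show ?thesis by blast
qed

text \<open>Modulo 2 the orientation of the edges makes no difference.\<close>

lemma pairing_cycle_bit:
  fixes k :: "nat \<times> nat \<Rightarrow> bit"
  assumes "is_cyc (edges G) C"
  shows "pairing (edges G) k (cycle_chain C) = (\<Sum>e\<in>cyc_edges C. k e)"
proof -
  have "pairing (edges G) k (cycle_chain C) = pairing (cyc_edges C) k (cycle_chain C)"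
    using cyc_edges_subset[OF assms] cycle_chain_values[OF assms]
    by (intro pairing_superset[OF finite_edges]) (auto split: if_splits)
  also have "\<dots> = (\<Sum>e\<in>cyc_edges C. k e)"
    unfolding pairing_def
  proof (rule sum.cong[OF refl])
    fix e assume "e \<in> cyc_edges C"
    then have "cycle_chain C e = 1 \<or> cycle_chain C e = - 1" using cycle_chain_values[OF assms, of e] by simp
    then show "int_scale (cycle_chain C e) (k e) = k e"
      by (cases "k e") (auto simp: int_scale_minus)
  qed
  finally show ?thesis .
qed

text \<open>Additivity on theta graphs provides edge values \<open>k0\<close> with the prescribed
  sums over cycles; set to 0 off the graph, they form a cochain. Uniqueness of its class is
  \<open>class_eqI\<close>.\<close>

theorem kasteleyn_class:
  obtains k :: "nat \<times> nat \<Rightarrow> bit" where "k \<in> cochains G" "kasteleyn_class G = cohomologous G `` {k}"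
    "\<And>C. is_cyc (edges G) C \<Longrightarrow> (\<Sum>e\<in>cyc_edges C. k e) = kasteleyn_sign (cyc_edges C)"
proof -
  obtain k0 :: "nat \<times> nat \<Rightarrow> bit" where
    k0: "\<And>C. is_cyc (edges G) C \<Longrightarrow> (\<Sum>e\<in>cyc_edges C. k0 e) = kasteleyn_sign (cyc_edges C)"
    using theta_additive_linear[OF finite_edges, of kasteleyn_sign] kasteleyn_sign_theta by blast
  define k where "k = (\<lambda>e. if e \<in> edges G then k0 e else 0)"
  have k: "k \<in> cochains G" by (simp add: k_def cochains_def)
  have ks: "(\<Sum>e\<in>cyc_edges C. k e) = kasteleyn_sign (cyc_edges C)" if "is_cyc (edges G) C" for C
    unfolding k0[OF that, symmetric] k_def
    using cyc_edges_subset[OF that] by (intro sum.cong) auto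
  let ?X = "cohomologous G `` {k}"
  let ?P = "\<lambda>X. X \<in> cohomology G \<and> (\<forall>C. is_cycle G C \<longrightarrow> evaluate G X (cycle_chain C)
          = of_nat (card (interior_vertices G C) + length C div 2 + 1))"
  have "?P ?X"
    using k ks evaluate_class[OF k closed_cycle_chain[OF finite_edges]] pairing_cycle_bit[of _ k] kasteleyn_sign_cycle
    by (auto simp: cohomology_def is_cycle_iff intro: quotientI)
  moreover have "Y = ?X" if "?P Y" for Y
    using that \<open>?P ?X\<close> by (intro class_eqI) auto
  ultimately have "kasteleyn_class G = ?X" unfolding kasteleyn_class_def by (intro the_equality) blast+
  then show ?thesis using that k ks by blast
qed

end

section \<open>Signs of alternating permutations\<close>

lemma sign_cycle_of_list:
  "distinct cs \<Longrightarrow> sign (cycle_of_list cs) = (- 1) ^ (length cs - 1)"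
proof (induction cs rule: cycle_of_list.induct)
  case (1 i j cs)
  then have "sign (Transposition.transpose i j \<circ> cycle_of_list (j # cs)) = sign (Transposition.transpose i j) * sign (cycle_of_list (j # cs))"
    by (intro sign_compose permutation_swap_id permutation_of_cycle)
  with 1 show ?case by (simp add: sign_swap_id comp_def)
qed (simp_all add: sign_id)

lemma cycle_decomp_finite: "cycle_decomp I p \<Longrightarrow> finite I"
  by (induction rule: cycle_decomp.induct) auto

lemma cycle_decomp_permutes: "cycle_decomp I p \<Longrightarrow> p permutes I"
proof (induction rule: cycle_decomp.induct)
  case (comp I p cs)
  have "cycle_of_list cs permutes (set cs \<union> I)" "p permutes (set cs \<union> I)"
    using comp cycle_permutes by (auto intro: permutes_subset)
  then show ?case by (rule permutes_compose[rotated])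
qed (rule permutes_id)

lemma cycle_of_list_nth:
  assumes "distinct cs" "k < length cs"
  shows "cycle_of_list cs (cs ! k) = cs ! (Suc k mod length cs)"
proof -
  have "map (cycle_of_list cs) cs = rotate1 cs"
    using cyclic_rotation[OF assms(1), of 1] by simp
  then have "map (cycle_of_list cs) cs ! k = rotate1 cs ! k" by simp
  then show ?thesis using assms(2) by (simp add: nth_rotate1)
qed

text \<open>The sign is multiplicative over the cycles, so it can be spread over the points by any
  weights whose product along each cycle is the sign of that cycle. Fixed points count as cycles of
  length 1.\<close>

lemma sign_eq_prod_cycle_weights:
  assumes "cycle_decomp I p"
    and "\<And>cs. cs \<noteq> [] \<Longrightarrow> distinct cs \<Longrightarrow> set cs \<subseteq> I \<Longrightarrow>
      (\<And>k. k < length cs \<Longrightarrow> p (cs ! k) = cs ! (Suc k mod length cs)) \<Longrightarrow>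
      (\<Prod>y\<in>set cs. w y) = (- 1 :: int) ^ (length cs - 1)"
  shows "sign p = (\<Prod>y\<in>I. w y)"
  using assms
proof (induction rule: cycle_decomp.induct)
  case empty
  then show ?case by (simp add: sign_id)
next
  case (comp I p cs)
  have pI: "p permutes I" "finite I" using comp cycle_decomp_permutes cycle_decomp_finite by blast+
  let ?p = "cycle_of_list cs \<circ> p"
  have "sign p = (\<Prod>y\<in>I. w y)"
  proof (rule comp.IH)
    fix ds assume ds: "ds \<noteq> []" "distinct ds" "set ds \<subseteq> I"
      "\<And>k. k < length ds \<Longrightarrow> p (ds ! k) = ds ! (Suc k mod length ds)"
    show "(\<Prod>y\<in>set ds. w y) = (- 1) ^ (length ds - 1)"
    proof (rule comp.prems)
      fix k assume k: "k < length ds"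
      have "ds ! (Suc k mod length ds) \<in> set ds" using ds(1) by (intro nth_mem) simp
      then have "ds ! (Suc k mod length ds) \<notin> set cs" using ds(3) comp.hyps(3) by blast
      then show "?p (ds ! k) = ds ! (Suc k mod length ds)"
        using ds(4)[OF k] by (simp add: id_outside_supp)
    qed (use ds in auto)
  qed
  moreover have "(\<Prod>y\<in>set cs. w y) = (- 1) ^ (length cs - 1)"
  proof (cases "cs = []")
    case False
    show ?thesis
    proof (rule comp.prems)
      fix k assume k: "k < length cs"
      then have "cs ! k \<notin> I" using comp.hyps(3) nth_mem by blast
      then show "?p (cs ! k) = cs ! (Suc k mod length cs)"
        using pI(1) cycle_of_list_nth[OF comp.hyps(2) k] by (simp add: permutes_not_in)
    qed (use False comp.hyps in auto)
  qed simp
  moreover have "sign ?p = sign (cycle_of_list cs) * sign p"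
    using pI permutation_permutes by (intro sign_compose permutation_of_cycle) blast
  moreover have "(\<Prod>y\<in>set cs \<union> I. w y) = (\<Prod>y\<in>set cs. w y) * (\<Prod>y\<in>I. w y)"
    using pI comp.hyps by (intro prod.union_disjoint) auto
  ultimately show ?case using sign_cycle_of_list[OF comp.hyps(2)] by (simp add: comp_def)
qed

text \<open>The integer form of \<open>eta\<close> on the image of the two-element group
  (\<open>eta_bit\<close>), which can be compared with the sign of a permutation.\<close>

definition sgn_bit :: "bit \<Rightarrow> int" where
  "sgn_bit b = (if b = 0 then 1 else - 1)"

lemma sgn_bit_simps [simp]: "sgn_bit 0 = 1" "sgn_bit 1 = - 1"
  by (simp_all add: sgn_bit_def)

lemma sgn_bit_add: "sgn_bit (a + b) = sgn_bit a * sgn_bit b"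
  by (cases a; cases b) simp_all

lemma sgn_bit_sum: "sgn_bit (\<Sum>x\<in>A. f x) = (\<Prod>x\<in>A. sgn_bit (f x))"
proof (induction A rule: infinite_finite_induct)
  case (insert x F)
  then show ?case by (simp only: sum.insert[OF insert(1,2)] prod.insert[OF insert(1,2)] sgn_bit_add)
qed simp_all

lemma sgn_bit_of_nat: "sgn_bit (of_nat m) = (- 1) ^ m"
proof (induction m)
  case (Suc m)
  then show ?case by (simp only: of_nat_Suc sgn_bit_add sgn_bit_simps power_Suc)
qed simp

lemma prod_white_sign:
  "finite A \<Longrightarrow> (\<Prod>x\<in>A. if P x then - 1 else (1 :: int)) = (- 1) ^ card {x \<in> A. P x}"
  by (induction A rule: finite_induct) (auto simp: prod.If_cases Int_def)

text \<open>The injection maps each of the two colour classes into the other, so they have the same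
  size.\<close>

lemma card_alternating:
  assumes "finite A" "inj_on f A" "f ` A \<subseteq> A" "\<And>x. x \<in> A \<Longrightarrow> P (f x) \<longleftrightarrow> \<not> P x"
  shows "card A = 2 * card {x \<in> A. P x}"
proof -
  let ?P = "{x \<in> A. P x}" and ?Q = "{x \<in> A. \<not> P x}"
  have inj: "inj_on f ?P" "inj_on f ?Q" using assms(2) by (auto intro: inj_on_subset)
  have "card ?P \<le> card ?Q" using assms by (intro card_inj_on_le[OF inj(1)]) auto
  moreover have "card ?Q \<le> card ?P" using assms by (intro card_inj_on_le[OF inj(2)]) auto
  moreover have "card A = card ?P + card ?Q"
  proof -
    have "card (?P \<union> ?Q) = card ?P + card ?Q" using assms(1) by (intro card_Un_disjoint) auto
    moreover have "?P \<union> ?Q = A" by auto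
    ultimately show ?thesis by simp
  qed
  ultimately show ?thesis by simp
qed

context plane_graph
begin

text \<open>The interior of a cycle of an alternating permutation is a union of cycles of the permutation,
  hence contains an even number of vertices.\<close>

lemma even_inner_vertices:
  assumes C: "is_cyc (edges G) C" and V: "bij_betw vt S (vertices G)" and S: "finite S"
    and inj: "inj_on \<sigma> S" and \<sigma>: "\<sigma> ` S \<subseteq> S"
    and adj: "\<And>x. x \<in> S \<Longrightarrow> adj (edges G) (vt x) (vt (\<sigma> x))"
    and cyc: "\<And>x. x \<in> S \<Longrightarrow> vt (\<sigma> x) \<in> set C \<Longrightarrow> vt x \<in> set C"
  shows "even (card (inner_vertices (cyc_edges C)))"
proof -
  let ?J = "img (cyc_edges C)"
  define X where "X = {x \<in> S. vt x \<in> inner_vertices (cyc_edges C)}"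
  have vS: "vt x \<in> vertices G" if "x \<in> S" for x using V that by (auto simp: bij_betw_def)
  have "\<sigma> x \<in> X" if x: "x \<in> X" for x
  proof -
    have xS: "x \<in> S" and xin: "place G (vt x) \<in> inside ?J" using x by (auto simp: X_def inner_vertices_def)
    obtain e where e: "e \<in> edges G" "edge_between (vt x) (vt (\<sigma> x)) = Some e" using adj[OF xS] by (auto simp: adj_def)
    have en: "{White (fst e), Black (snd e)} = {vt x, vt (\<sigma> x)}" using edge_between_ends[OF e(2)] .
    have "place G (vt x) \<notin> ?J" using xin inside_no_overlap[of ?J] by blast
    then have xC: "vt x \<notin> set C"
      using vertex_in_img[OF cyc_edges_subset[OF C] vS[OF xS]] ends_cyc_edges[OF C] by simp
    then have sxC: "vt (\<sigma> x) \<notin> set C" using cyc[OF xS] by blast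
    \<comment> \<open>Neither end of the edge from \<open>x\<close> to its image lies on
      \<open>C\<close>, so the edge is disjoint from the loop and, being connected, stays
      inside.\<close>
    have "ends {e} \<inter> ends (cyc_edges C) = {}"
      using xC sxC unfolding ends_cyc_edges[OF C] ends_insert en by simp
    moreover have "e \<notin> cyc_edges C"
    proof
      assume "e \<in> cyc_edges C"
      then have "ends {e} \<subseteq> ends (cyc_edges C)" by (intro ends_mono) simp
      then show False using \<open>ends {e} \<inter> _ = {}\<close> by (simp add: ends_insert)
    qed
    ultimately have "path_image (curve G e) \<inter> ?J = {}"
      using img_Int[of "{e}" "cyc_edges C"] e(1) cyc_edges_subset[OF C] by (simp add: img_insert)
    moreover have "place G (vt x) \<in> path_image (curve G e)" "place G (vt (\<sigma> x)) \<in> path_image (curve G e)"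
    proof -
      have "{place G (White (fst e)), place G (Black (snd e))} \<subseteq> path_image (curve G e)"
        using edge_curve(4)[OF e(1)] by blast
      then have "place G ` {White (fst e), Black (snd e)} \<subseteq> path_image (curve G e)" by simp
      then show "place G (vt x) \<in> path_image (curve G e)" "place G (vt (\<sigma> x)) \<in> path_image (curve G e)"
        unfolding en by simp_all
    qed
    moreover have "connected (path_image (curve G e))"
      using edge_curve(1)[OF e(1)] by (simp add: connected_arc_image)
    ultimately have "place G (vt (\<sigma> x)) \<in> inside ?J" using connected_inside_iff xin by blast
    then show ?thesis using \<sigma> xS vS by (auto simp: X_def inner_vertices_def)
  qed
  moreover have "is_white (vt (\<sigma> x)) \<longleftrightarrow> \<not> is_white (vt x)" if "x \<in> X" for x
    using adj[of x] that by (auto simp: X_def adj_def edge_between_Some)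
  ultimately have "card X = 2 * card {x \<in> X. is_white (vt x)}"
    using S inj by (intro card_alternating[of X \<sigma>]) (auto simp: X_def intro: inj_on_subset)
  moreover have "bij_betw vt X (inner_vertices (cyc_edges C))"
  proof (rule bij_betw_imageI)
    show "inj_on vt X" using V by (auto simp: bij_betw_def X_def intro: inj_on_subset)
    have "inner_vertices (cyc_edges C) \<subseteq> vt ` S" using V by (auto simp: bij_betw_def inner_vertices_def)
    then show "vt ` X = inner_vertices (cyc_edges C)" by (auto simp: X_def)
  qed
  ultimately show ?thesis by (metis bij_betw_same_card even_mult_iff even_numeral)
qed

text \<open>Every white vertex is given the weight -1, and every vertex in addition the sign of
  \<open>k\<close> on the edge to its image. Along a cycle with \<open>l\<close> white vertices the
  first factors give \<open>(-1)^l\<close>, and the second ones \<open>(-1)^(l+1)\<close>, because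
  the number of inner vertices is even. The product -1 is the sign of a cycle of even
  length.\<close>

lemma sign_alternating_permutation:
  assumes k: "\<And>C. is_cyc (edges G) C \<Longrightarrow> (\<Sum>e\<in>cyc_edges C. k e) = kasteleyn_sign (cyc_edges C)"
    and V: "bij_betw vt S (vertices G)" and S: "finite S" and \<sigma>: "\<sigma> permutes S"
    and adj: "\<And>x. x \<in> S \<Longrightarrow> adj (edges G) (vt x) (vt (\<sigma> x))"
  shows "sign \<sigma> = (- 1) ^ card {x \<in> S. is_white (vt x)}
     * sgn_bit (\<Sum>x\<in>S. k (the (edge_between (vt x) (vt (\<sigma> x)))))"
proof -
  define ed where "ed = (\<lambda>x. the (edge_between (vt x) (vt (\<sigma> x))))"
  define w where "w = (\<lambda>x. (if is_white (vt x) then - 1 else 1) * sgn_bit (k (ed x)))"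
  have inj: "inj_on \<sigma> S" and im: "\<sigma> ` S = S" using \<sigma> permutes_inj_on permutes_image by blast+
  have injv: "inj_on vt S" using V by (simp add: bij_betw_def)
  have flip: "is_white (vt (\<sigma> x)) \<longleftrightarrow> \<not> is_white (vt x)" if "x \<in> S" for x
    using adj[OF that] by (auto simp: adj_def edge_between_Some)
  have "(\<Prod>y\<in>set cs. w y) = (- 1) ^ (length cs - 1)"
    if cs: "cs \<noteq> []" "distinct cs" "set cs \<subseteq> S"
      and nx: "\<And>k. k < length cs \<Longrightarrow> \<sigma> (cs ! k) = cs ! (Suc k mod length cs)" for cs
  proof -
    have s_in: "\<sigma> x \<in> set cs" if "x \<in> set cs" for x
      using that nx cs(1) by (metis in_set_conv_nth length_greater_0_conv mod_less_divisor nth_mem)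
    have s_im: "\<sigma> ` set cs = set cs"
      using s_in inj cs(3) by (intro endo_inj_surj) (auto intro: inj_on_subset)
    have card_alt: "card (set cs) = 2 * card {x \<in> set cs. is_white (vt x)}"
      using s_in flip cs(3) inj by (intro card_alternating[of _ \<sigma>]) (auto intro: inj_on_subset)
    then obtain l where l: "length cs = 2 * l" "card {x \<in> set cs. is_white (vt x)} = l"
      using cs(2) by (metis distinct_card)
    have "l > 0" using l cs(1) by (cases l) auto
    have prod_w: "(\<Prod>y\<in>set cs. w y) = (- 1) ^ l * sgn_bit (\<Sum>y\<in>set cs. k (ed y))"
      unfolding w_def prod.distrib sgn_bit_sum prod_white_sign[OF finite_set] l(2) ..
    have "sgn_bit (\<Sum>y\<in>set cs. k (ed y)) = (- 1) ^ (l + 1)"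
    proof (cases "l = 1")
      case True
      \<comment> \<open>A transposition runs along one edge to and fro. It is no cycle of the graph,
        but its two contributions cancel modulo 2, in accordance with the formula for
        \<open>l = 1\<close>.\<close>
      then obtain x y where xy: "cs = [x, y]" using l(1) by (cases cs; cases "tl cs") (auto simp: length_Suc_conv)
      then have "\<sigma> x = y" "\<sigma> y = x" using nx[of 0] nx[of 1] by auto
      then have "ed x = ed y" by (simp add: ed_def edge_between_sym)
      then show ?thesis using xy cs(2) True by (simp add: sgn_bit_def)
    next
      case False
      define C where "C = map vt cs"
      have lenC: "length C = 2 * l" "length C \<ge> 3" "C \<noteq> []" using False \<open>l > 0\<close> l(1) by (auto simp: C_def)
      have C_nth: "adj (edges G) (C ! k) (next_vertex C k)"
          "edge_between (C ! k) (next_vertex C k) = edge_between (vt (cs ! k)) (vt (\<sigma> (cs ! k)))"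
        if "k < length C" for k
      proof -
        have kc: "k < length cs" "Suc k mod length cs < length cs" using that cs(1) by (auto simp: C_def)
        have e: "C ! k = vt (cs ! k)" "next_vertex C k = vt (\<sigma> (cs ! k))"
          using kc nx[OF kc(1)] by (simp_all add: C_def next_vertex_def)
        show "adj (edges G) (C ! k) (next_vertex C k)"
          unfolding e using adj cs(3) nth_mem[OF kc(1)] by blast
        show "edge_between (C ! k) (next_vertex C k) = edge_between (vt (cs ! k)) (vt (\<sigma> (cs ! k)))"
          unfolding e ..
      qed
      have "distinct C" unfolding C_def distinct_map using cs injv by (auto intro: inj_on_subset)
      then have "is_cycle G C" using C_nth(1) lenC(2) by (auto simp: is_cycle_def adj_def)
      then have cyc: "is_cyc (edges G) C" by (simp add: is_cycle_iff)
      have "cyc_edges C = (\<lambda>k. the (edge_between (C ! k) (next_vertex C k))) ` {..<length C}"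
        unfolding cyc_edges_def cycle_nth_cases(1)[OF lenC(3)] path_edges_nth
        using cycle_nth_cases(2,3)[OF lenC(3)] lenC(3) by (simp add: last_conv_nth)
      also have "\<dots> = (\<lambda>k. ed (cs ! k)) ` {..<length cs}"
        using C_nth(2) by (intro image_cong) (auto simp: C_def ed_def)
      also have "\<dots> = ed ` set cs" by (auto simp: set_conv_nth)
      finally have ce: "cyc_edges C = ed ` set cs" .
      \<comment> \<open>A graph cycle has as many edges as vertices, so different points of
        \<open>cs\<close> give different edges.\<close>
      have "card (ed ` set cs) = card (set cs)"
        using card_cyc_edges[OF cyc] ce cs(2) by (simp add: C_def distinct_card)
      then have "inj_on ed (set cs)" by (intro eq_card_imp_inj_on) auto
      then have "(\<Sum>y\<in>set cs. k (ed y)) = (\<Sum>e\<in>cyc_edges C. k e)"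
        unfolding ce by (simp add: sum.reindex)
      also have "\<dots> = of_nat (card (inner_vertices (cyc_edges C)) + l + 1)"
        unfolding k[OF cyc] kasteleyn_sign_def card_cyc_edges[OF cyc] lenC(1) by simp
      finally have "sgn_bit (\<Sum>y\<in>set cs. k (ed y)) = (- 1) ^ (card (inner_vertices (cyc_edges C)) + l + 1)"
        by (simp only: sgn_bit_of_nat)
      moreover have "even (card (inner_vertices (cyc_edges C)))"
      proof (rule even_inner_vertices[OF cyc V S inj _ adj])
        \<comment> \<open>The vertices of \<open>C\<close> come from a full cycle of
          \<open>\<sigma>\<close>, so a point that is mapped into this cycle belongs to it.\<close>
        fix x assume x: "x \<in> S" "vt (\<sigma> x) \<in> set C"
        then obtain y where y: "y \<in> set cs" "vt (\<sigma> x) = vt y" by (auto simp: C_def)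
        have "\<sigma> x \<in> S" using im x(1) by blast
        then have "\<sigma> x = y" using injv y cs(3) by (auto simp: inj_on_def)
        then obtain z where "z \<in> set cs" "\<sigma> x = \<sigma> z" using y(1) s_im by (metis imageE)
        then have "x = z" using inj x(1) cs(3) by (auto simp: inj_on_def)
        then show "vt x \<in> set C" using \<open>z \<in> set cs\<close> by (simp add: C_def)
      qed (use im in auto)
      ultimately show ?thesis by (simp add: power_add)
    qed
    then have "(\<Prod>y\<in>set cs. w y) = (- 1) ^ (l + (l + 1))" unfolding prod_w by (simp only: power_add)
    also have "\<dots> = (- 1) ^ (length cs - 1)" using l(1) \<open>l > 0\<close> by (simp add: minus_one_power_iff)
    finally show ?thesis .
  qed
  then have "sign \<sigma> = (\<Prod>y\<in>S. w y)"
    by (intro sign_eq_prod_cycle_weights[OF cycle_decomposition[OF \<sigma> S]]) blast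
  also have "\<dots> = (- 1) ^ card {x \<in> S. is_white (vt x)} * sgn_bit (\<Sum>x\<in>S. k (ed x))"
    unfolding w_def prod.distrib sgn_bit_sum prod_white_sign[OF S] ..
  finally show ?thesis by (simp add: ed_def)
qed

end

section \<open>Units of the ring of Laurent polynomials\<close>

lemma circle_exp_add: "circle_exp (x + y) = circle_exp x * circle_exp y"
  by transfer (simp add: algebra_simps flip: exp_add)

lemma circle_exp_zero: "circle_exp 0 = 1"
  by transfer simp

lemma circle_exp_nonzero: "circle_exp x \<noteq> 0"
  by transfer simp

lemma circle_exp_inj: "circle_exp x = circle_exp y \<Longrightarrow> x = y"
proof transfer
  fix x y :: real
  assume "exp (2 * of_real pi * \<i> * of_real x) = exp (2 * of_real pi * \<i> * of_real y)"
  then obtain n :: int where "2 * of_real pi * \<i> * of_real x = 2 * of_real pi * \<i> * of_real y + of_int (2 * n) * pi * \<i>"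
    unfolding exp_eq by blast
  then have "2 * of_real pi * \<i> * (of_real x - of_real y - of_int n) = (0 :: complex)" by (simp add: algebra_simps)
  then have "of_real x - of_real y - of_int n = (0 :: complex)" by simp
  then have "of_real (x - y - of_int n) = (0 :: complex)" by simp
  then have "x - y = of_int n" using of_real_eq_0_iff by fastforce
  then show "x - y \<in> \<int>" by simp
qed

lemma cnj_circle_exp: "cnj (circle_exp x) = circle_exp (- x)"
  by transfer (simp add: exp_cnj)

lemma eta_add: "eta (s + t) = eta s * eta t"
  by (simp add: eta_def circle_exp_add mult_single)

lemma eta_zero [simp]: "eta 0 = 1"
  by (simp add: eta_def circle_exp_zero flip: single_one)

text \<open>The only exponent with nonzero coefficient gives the second component, and the
  coefficient determines the first. Hence the definite description in \<open>matrix_cochain\<close>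
  has at most one candidate.\<close>

lemma eta_inj: "eta s = eta t \<Longrightarrow> s = t"
proof -
  assume *: "eta s = eta t"
  then have l: "Poly_Mapping.lookup (eta s) k = Poly_Mapping.lookup (eta t) k" for k by simp
  have "snd s = snd t"
    using l[of "snd s"] circle_exp_nonzero[of "fst s"] by (auto simp: eta_def lookup_single when_def split: if_splits)
  then have "circle_exp (fst s) = circle_exp (fst t)" using l[of "snd s"] by (simp add: eta_def)
  then show "s = t" using \<open>snd s = snd t\<close> circle_exp_inj by (simp add: prod_eq_iff)
qed

lemma eta_sum: "eta (\<Sum>x\<in>A. f x) = (\<Prod>x\<in>A. eta (f x))"
  by (induction A rule: infinite_finite_induct) (simp_all add: eta_add)

lemma lookup_laurent_cnj: "Poly_Mapping.lookup (laurent_cnj a) k = cnj (Poly_Mapping.lookup a (- k))"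
  by transfer simp

lemma laurent_cnj_single: "laurent_cnj (Poly_Mapping.single k c) = Poly_Mapping.single (- k) (cnj c)"
  by (rule poly_mapping_eqI) (auto simp: lookup_laurent_cnj lookup_single when_def)

lemma laurent_cnj_eta: "laurent_cnj (eta s) = eta (- s)"
  by (simp add: eta_def laurent_cnj_single cnj_circle_exp)

lemma eta_mult_cnj: "eta s * laurent_cnj (eta s) = 1"
  by (simp add: laurent_cnj_eta flip: eta_add)

lemma laurent_cnj_zero [simp]: "laurent_cnj 0 = 0"
  by (rule poly_mapping_eqI) (simp add: lookup_laurent_cnj)

text \<open>Laurent polynomials form an integral domain, and the conjugate of a nonzero element is
  nonzero.\<close>

lemma laurent_norm_zero:
  assumes "a * laurent_cnj a = 0" shows "a = 0"
proof -
  have "a = 0 \<or> laurent_cnj a = 0" using assms by simp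
  moreover have "a = 0" if "laurent_cnj a = 0"
  proof (rule poly_mapping_eqI)
    fix k
    have "cnj (Poly_Mapping.lookup a k) = Poly_Mapping.lookup (laurent_cnj a) (- k)" by (simp add: lookup_laurent_cnj)
    then show "Poly_Mapping.lookup a k = Poly_Mapping.lookup 0 k" using that by simp
  qed
  ultimately show ?thesis by blast
qed

lemma sum_singles: "a = (\<Sum>k\<in>Poly_Mapping.keys a. Poly_Mapping.single k (Poly_Mapping.lookup a k))"
proof (rule poly_mapping_eqI)
  fix n
  have "Poly_Mapping.lookup (\<Sum>k\<in>Poly_Mapping.keys a. Poly_Mapping.single k (Poly_Mapping.lookup a k)) n = (\<Sum>k\<in>Poly_Mapping.keys a. if k = n then Poly_Mapping.lookup a k else 0)"
    unfolding lookup_sum by (intro sum.cong) (auto simp: lookup_single when_def)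
  also have "\<dots> = Poly_Mapping.lookup a n" by (simp add: in_keys_iff)
  finally show "Poly_Mapping.lookup a n = Poly_Mapping.lookup (\<Sum>k\<in>Poly_Mapping.keys a. Poly_Mapping.single k (Poly_Mapping.lookup a k)) n" ..
qed

text \<open>If \<open>m\<close> and \<open>M\<close> are the extreme exponents of \<open>a\<close>, then the coefficient of \<open>q\<^bsup>M - m\<^esup>\<close> in
  \<open>a \<cdot> laurent_cnj a\<close> does not vanish.\<close>

lemma laurent_norm_one:
  assumes "a * laurent_cnj a = 1" shows "\<exists>s. eta s = a"
proof -
  let ?K = "Poly_Mapping.keys a"
  have "a \<noteq> 0" using assms by auto
  then have K: "finite ?K" "?K \<noteq> {}" by auto
  define m M where "m = Min ?K" and "M = Max ?K"
  have mM: "m \<in> ?K" "M \<in> ?K" "\<And>k. k \<in> ?K \<Longrightarrow> m \<le> k" "\<And>k. k \<in> ?K \<Longrightarrow> k \<le> M"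
    using K by (auto simp: m_def M_def)
  have cnj_a: "laurent_cnj a = (\<Sum>l\<in>?K. Poly_Mapping.single (- l) (cnj (Poly_Mapping.lookup a l)))"
  proof (rule poly_mapping_eqI)
    fix n
    have "Poly_Mapping.lookup (\<Sum>l\<in>?K. Poly_Mapping.single (- l) (cnj (Poly_Mapping.lookup a l))) n
        = (\<Sum>l\<in>?K. if l = - n then cnj (Poly_Mapping.lookup a l) else 0)"
      unfolding lookup_sum by (intro sum.cong) (auto simp: lookup_single when_def)
    also have "\<dots> = Poly_Mapping.lookup (laurent_cnj a) n" by (simp add: in_keys_iff lookup_laurent_cnj)
    finally show "Poly_Mapping.lookup (laurent_cnj a) n = Poly_Mapping.lookup (\<Sum>l\<in>?K. Poly_Mapping.single (- l) (cnj (Poly_Mapping.lookup a l))) n" ..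
  qed
  have "a * laurent_cnj a = (\<Sum>k\<in>?K. Poly_Mapping.single k (Poly_Mapping.lookup a k)) * laurent_cnj a"
    using sum_singles[of a] by simp
  also have "\<dots> = (\<Sum>k\<in>?K. \<Sum>l\<in>?K. Poly_Mapping.single (k - l) (Poly_Mapping.lookup a k * cnj (Poly_Mapping.lookup a l)))"
    unfolding cnj_a sum_product mult_single by simp
  finally have "Poly_Mapping.lookup (a * laurent_cnj a) (M - m)
      = (\<Sum>k\<in>?K. \<Sum>l\<in>?K. if k - l = M - m then Poly_Mapping.lookup a k * cnj (Poly_Mapping.lookup a l) else 0)"
    by (simp add: lookup_sum lookup_single when_def)
  also have "\<dots> = (\<Sum>k\<in>?K. \<Sum>l\<in>?K. if k = M then (if l = m then Poly_Mapping.lookup a k * cnj (Poly_Mapping.lookup a l) else 0) else 0)"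
  proof (intro sum.cong refl)
    \<comment> \<open>As \<open>k\<close> is at most \<open>M\<close> and \<open>l\<close> at least
      \<open>m\<close>, the difference \<open>M - m\<close> is attained only for
      \<open>k = M\<close> and \<open>l = m\<close>.\<close>
    fix k l assume "k \<in> ?K" "l \<in> ?K"
    then have "m \<le> l" "k \<le> M" using mM by auto
    then have "k - l = M - m \<longleftrightarrow> k = M \<and> l = m" by linarith
    then show "(if k - l = M - m then Poly_Mapping.lookup a k * cnj (Poly_Mapping.lookup a l) else 0) =
        (if k = M then (if l = m then Poly_Mapping.lookup a k * cnj (Poly_Mapping.lookup a l) else 0) else 0)" by simp
  qed
  also have "\<dots> = (\<Sum>k\<in>?K. if k = M then Poly_Mapping.lookup a k * cnj (Poly_Mapping.lookup a m) else 0)"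
    using mM by (intro sum.cong refl) (simp add: sum.delta)
  also have "\<dots> = Poly_Mapping.lookup a M * cnj (Poly_Mapping.lookup a m)" using mM by (simp add: sum.delta)
  finally have lk: "Poly_Mapping.lookup (1 :: laurent) (M - m) = Poly_Mapping.lookup a M * cnj (Poly_Mapping.lookup a m)" using assms by simp
  have nz: "Poly_Mapping.lookup a M \<noteq> 0" "Poly_Mapping.lookup a m \<noteq> 0" using mM by (auto simp: in_keys_iff)
  have "M = m"
  proof (rule ccontr)
    assume "M \<noteq> m"
    then have "Poly_Mapping.lookup (1 :: laurent) (M - m) = 0" by (simp add: lookup_one)
    then show False using lk nz by simp
  qed
  \<comment> \<open>A single exponent is left, and its coefficient has modulus 1.\<close>
  then have "?K = {m}" using mM by (auto intro: antisym)
  then have a: "a = Poly_Mapping.single m (Poly_Mapping.lookup a m)" using sum_singles[of a] by simp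
  have "Poly_Mapping.lookup a m * cnj (Poly_Mapping.lookup a m) = 1" using lk \<open>M = m\<close> by simp
  then have "complex_of_real ((cmod (Poly_Mapping.lookup a m))\<^sup>2) = 1"
    using complex_norm_square[of "Poly_Mapping.lookup a m"] by simp
  then have "(cmod (Poly_Mapping.lookup a m))\<^sup>2 = 1" by (metis of_real_eq_1_iff)
  then have "cmod (Poly_Mapping.lookup a m) = 1"
    using norm_ge_zero[of "Poly_Mapping.lookup a m"] by (auto simp: power2_eq_1_iff)
  then obtain t where t: "Poly_Mapping.lookup a m = cis t"
    by (metis rcis_cmod_Arg rcis_def mult_1 of_real_1)
  \<comment> \<open>The circle is parametrized by reals modulo 1, so the angle \<open>t\<close> is
    divided by \<open>2 * pi\<close>.\<close>
  have "circle_exp (circle_of_real (t / (2 * pi))) = cis t"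
    by (simp add: circle_exp.abs_eq cis_conv_exp)
  then have "eta (circle_of_real (t / (2 * pi)), m) = a" using a t by (simp add: eta_def)
  then show ?thesis by blast
qed

lemma eta_bit: "eta (q_circle_of_bit b) = of_int (sgn_bit b)"
proof -
  have "circle_exp (circle_of_real (1 / 2)) = - 1"
    by (simp add: circle_exp.abs_eq mult.commute)
  moreover have "Poly_Mapping.single 0 (- 1) = (- 1 :: laurent)"
    by (simp add: single_uminus)
  ultimately show ?thesis
    by (simp add: eta_def q_circle_of_bit_def sgn_bit_def circle_exp_zero)
qed

text \<open>It is enough to compare the images under the injective \<open>eta\<close>, where sums
  become products of signs.\<close>

lemma q_circle_of_bit_add: "q_circle_of_bit (a + b) = q_circle_of_bit a + q_circle_of_bit b"
proof (rule eta_inj)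
  show "eta (q_circle_of_bit (a + b)) = eta (q_circle_of_bit a + q_circle_of_bit b)"
    by (simp only: eta_add eta_bit sgn_bit_add of_int_mult)
qed

lemma q_circle_of_bit_zero [simp]: "q_circle_of_bit 0 = 0"
  by (simp add: q_circle_of_bit_def zero_prod_def)

lemma q_circle_of_bit_sum: "q_circle_of_bit (\<Sum>x\<in>A. f x) = (\<Sum>x\<in>A. q_circle_of_bit (f x))"
proof (induction A rule: infinite_finite_induct)
  case (insert x F)
  then show ?case by (simp only: sum.insert[OF insert(1,2)] q_circle_of_bit_add)
qed simp_all

lemma q_circle_of_bit_scale: "q_circle_of_bit (int_scale k b) = int_scale k (q_circle_of_bit b)"
proof -
  have "q_circle_of_bit (- x) = - q_circle_of_bit x" for x
    using q_circle_of_bit_add[of x "- x"] by (simp add: eq_neg_iff_add_eq_0 add.commute)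
  then have d: "q_circle_of_bit (x - y) = q_circle_of_bit x - q_circle_of_bit y" for x y
    using q_circle_of_bit_add[of x "- y"] \<open>\<And>x. q_circle_of_bit (- x) = _\<close> by (metis add_uminus_conv_diff)
  show ?thesis unfolding int_scale_def d q_circle_of_bit_sum ..
qed

lemma q_power_eta: "q_power k = eta (0, k)"
  by (simp add: q_power_def eta_def circle_exp_zero)

lemma int_scale_gen_q: "int_scale k gen_q = (0, k)"
proof -
  have "int_scale (int n) gen_q = (0, int n)" for n
    by (induction n) (simp_all add: int_scale_add gen_q_def zero_prod_def)
  note * = this
  show ?thesis
  proof (cases "k \<ge> 0")
    case True then show ?thesis using *[of "nat k"] by simp
  next
    case False
    then have "int_scale k gen_q = - int_scale (int (nat (- k))) gen_q" by (simp flip: int_scale_minus)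
    then show ?thesis using False *[of "nat (- k)"] by simp
  qed
qed

section \<open>The characteristic polynomial as a block determinant\<close>

definition block_mat :: "'a::comm_ring_1 mat \<Rightarrow> 'a mat \<Rightarrow> 'a poly mat" where
  "block_mat A B = four_block_mat ([:0, 1:] \<cdot>\<^sub>m 1\<^sub>m (dim_row A)) (map_mat (\<lambda>a. [:a:]) A)
     (map_mat (\<lambda>a. [:a:]) B) (1\<^sub>m (dim_col A))"

text \<open>Multiplication on the right by the block matrix with rows (1, 0) and (-B, 1), which has
  determinant 1, clears the lower left block and turns the upper left one into the characteristic
  matrix of \<open>A * B\<close>.\<close>

lemma char_poly_mult_eq_det:
  fixes A B :: "'a::idom mat"
  assumes A: "A \<in> carrier_mat n m" and B: "B \<in> carrier_mat m n"
  shows "char_poly (A * B) = det (block_mat A B)"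
proof -
  let ?c = "map_mat (\<lambda>a. [:a:])"
  let ?X = "[:0, 1:] \<cdot>\<^sub>m 1\<^sub>m n :: 'a poly mat"
  let ?F = "four_block_mat ?X (?c A) (?c B) (1\<^sub>m m)"
  let ?R = "four_block_mat (1\<^sub>m n) (0\<^sub>m n m) (- ?c B) (1\<^sub>m m) :: 'a poly mat"
  have c: "?X \<in> carrier_mat n n" "?c A \<in> carrier_mat n m" "?c B \<in> carrier_mat m n" "- ?c B \<in> carrier_mat m n"
    using A B by auto
  have cc: "?c A * ?c B = ?c (A * B)"
  proof (rule eq_matI)
    fix i j assume ij: "i < dim_row (?c (A * B))" "j < dim_col (?c (A * B))"
    have const_sum: "(\<Sum>x\<in>S. [:f x:]) = [:\<Sum>x\<in>S. f x:]" for S :: "nat set" and f :: "nat \<Rightarrow> 'a"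
      by (induction S rule: infinite_finite_induct) auto
    show "(?c A * ?c B) $$ (i, j) = ?c (A * B) $$ (i, j)"
      using ij A B by (simp add: scalar_prod_def const_sum mult.commute)
  qed (use A B in auto)
  have "?F * ?R = four_block_mat (?X * 1\<^sub>m n + ?c A * - ?c B) (?X * 0\<^sub>m n m + ?c A * 1\<^sub>m m)
      (?c B * 1\<^sub>m n + 1\<^sub>m m * - ?c B) (?c B * 0\<^sub>m n m + 1\<^sub>m m * 1\<^sub>m m)"
    by (rule mult_four_block_mat[OF c(1,2,3) one_carrier_mat one_carrier_mat zero_carrier_mat c(4) one_carrier_mat])
  also have "?X * 1\<^sub>m n + ?c A * - ?c B = char_poly_matrix (A * B)"
  proof -
    have "?c A * - ?c B = - (?c (A * B))" using c cc by simp
    then show ?thesis using A B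
      by (intro eq_matI) (auto simp: char_poly_matrix_def)
  qed
  also have "?X * 0\<^sub>m n m + ?c A * 1\<^sub>m m = ?c A" using c by simp
  also have "?c B * 1\<^sub>m n + 1\<^sub>m m * - ?c B = 0\<^sub>m m n" using c by (intro eq_matI) auto
  also have "?c B * 0\<^sub>m n m + 1\<^sub>m m * 1\<^sub>m m = 1\<^sub>m m" using c by simp
  finally have FR: "?F * ?R = four_block_mat (char_poly_matrix (A * B)) (?c A) (0\<^sub>m m n) (1\<^sub>m m)" .
  have F: "?F \<in> carrier_mat (n + m) (n + m)" using c by (intro four_block_carrier_mat) auto
  have R: "?R \<in> carrier_mat (n + m) (n + m)" using c by (intro four_block_carrier_mat) auto
  have "det ?F * det ?R = det (?F * ?R)" using det_mult[OF F R] ..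
  also have "\<dots> = det (char_poly_matrix (A * B)) * det (1\<^sub>m m)"
    unfolding FR using A B c by (intro det_four_block_mat_lower_left_zero) auto
  also have "\<dots> = char_poly (A * B)" by (simp add: char_poly_def)
  finally have "det ?F * det ?R = char_poly (A * B)" .
  moreover have "det ?R = det (1\<^sub>m n) * det (1\<^sub>m m)"
    using c by (intro det_four_block_mat_upper_right_zero) auto
  ultimately show ?thesis using A by (simp add: block_mat_def)
qed

lemma block_mat_index:
  assumes A: "A \<in> carrier_mat n m" and B: "B \<in> carrier_mat m n" and "k < n + m" "l < n + m"
  shows "block_mat A B $$ (k, l) =
    (if k < n then if l < n then (if k = l then [:0, 1:] else 0) else [:A $$ (k, l - n):]
     else if l < n then [:B $$ (k - n, l):] else (if k = l then 1 else 0))"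
  using assms by (auto simp: block_mat_def)

lemma block_mat_carrier:
  assumes "A \<in> carrier_mat n m" "B \<in> carrier_mat m n"
  shows "block_mat A B \<in> carrier_mat (n + m) (n + m)"
  unfolding block_mat_def using assms by (intro four_block_carrier_mat) auto

section \<open>Pipe systems\<close>

text \<open>The sets \<open>W\<close> and \<open>B\<close> are recovered as the projections of the
  matching, and the uniqueness of the edge at each vertex becomes injectivity of these
  projections.\<close>

lemma perfect_matching_induced:
  "perfect_matching (induced_subgraph G W B) M \<longleftrightarrow>
     M \<subseteq> edges G \<and> fst ` M = W \<and> snd ` M = B \<and> inj_on fst M \<and> inj_on snd M"
  (is "?L \<longleftrightarrow> ?R")
proof
  assume L: ?L
  then have M: "M \<subseteq> edges G \<inter> W \<times> B" "\<And>i. i \<in> W \<Longrightarrow> \<exists>!j. (i, j) \<in> M" "\<And>j. j \<in> B \<Longrightarrow> \<exists>!i. (i, j) \<in> M"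
    by (auto simp: perfect_matching_def induced_subgraph_def)
  have "W \<subseteq> fst ` M" using M(2) by force
  moreover have "B \<subseteq> snd ` M" using M(3) by force
  moreover have "inj_on fst M"
  proof (rule inj_onI)
    fix e e' assume "e \<in> M" "e' \<in> M" "fst e = fst e'"
    then show "e = e'" using M(1) M(2)[of "fst e"] by (cases e; cases e') auto
  qed
  moreover have "inj_on snd M"
  proof (rule inj_onI)
    fix e e' assume "e \<in> M" "e' \<in> M" "snd e = snd e'"
    then show "e = e'" using M(1) M(3)[of "snd e"] by (cases e; cases e') auto
  qed
  ultimately show ?R using M(1) by auto
next
  assume R: ?R
  have "\<exists>!j. (i, j) \<in> M" if "i \<in> W" for i
  proof -
    have "i \<in> fst ` M" using R that by simp
    then obtain j where j: "(i, j) \<in> M" by auto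
    show ?thesis
    proof (rule ex1I[of _ j])
      show "(i, j) \<in> M" by (rule j)
      fix j' assume "(i, j') \<in> M"
      then have "(i, j') = (i, j)" using R j by (intro inj_onD[of fst M]) auto
      then show "j' = j" by simp
    qed
  qed
  moreover have "\<exists>!i. (i, j) \<in> M" if "j \<in> B" for j
  proof -
    have "j \<in> snd ` M" using R that by simp
    then obtain i where i: "(i, j) \<in> M" by auto
    show ?thesis
    proof (rule ex1I[of _ i])
      show "(i, j) \<in> M" by (rule i)
      fix i' assume "(i', j) \<in> M"
      then have "(i', j) = (i, j)" using R i by (intro inj_onD[of snd M]) auto
      then show "i' = i" by simp
    qed
  qed
  moreover have "M \<subseteq> W \<times> B" using R by force
  ultimately show ?L using R by (auto simp: perfect_matching_def induced_subgraph_def)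
qed

text \<open>A pipe system without mention of the subgraph: the two matchings cover the same
  vertices, and these determine the support.\<close>

definition same_support :: "(nat \<times> nat) set \<Rightarrow> (nat \<times> nat) set \<Rightarrow> (nat \<times> nat) set \<Rightarrow> bool" where
  "same_support E M1 M2 \<longleftrightarrow> M1 \<subseteq> E \<and> M2 \<subseteq> E \<and> inj_on fst M1 \<and> inj_on snd M1 \<and> inj_on fst M2 \<and> inj_on snd M2 \<and>
     fst ` M1 = fst ` M2 \<and> snd ` M1 = snd ` M2"

lemma same_support_unique:
  assumes "same_support E M1 M2"
  shows "(i, j) \<in> M1 \<Longrightarrow> (i, j') \<in> M1 \<Longrightarrow> j = j'" "(i, j) \<in> M1 \<Longrightarrow> (i', j) \<in> M1 \<Longrightarrow> i = i'"
    "(i, j) \<in> M2 \<Longrightarrow> (i, j') \<in> M2 \<Longrightarrow> j = j'" "(i, j) \<in> M2 \<Longrightarrow> (i', j) \<in> M2 \<Longrightarrow> i = i'"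
  using assms unfolding same_support_def inj_on_def by (metis fst_conv snd_conv)+

lemma sum_pipe_chain:
  assumes "finite E" "M1 \<subseteq> E" "M2 \<subseteq> E"
  shows "pairing E \<phi> (pipe_chain (M1, M2)) = (\<Sum>e\<in>M2. \<phi> e) - (\<Sum>e\<in>M1. \<phi> e)"
proof -
  have *: "int_scale (of_bool b) x = (if b then x else 0)" for b and x :: 'a by simp
  have "pairing E \<phi> (pipe_chain (M1, M2)) = (\<Sum>e\<in>E. if e \<in> M2 then \<phi> e else 0) - (\<Sum>e\<in>E. if e \<in> M1 then \<phi> e else 0)"
    unfolding pairing_def pipe_chain_def int_scale_diff * sum_subtractf by simp
  then show ?thesis using assms by (simp add: sum.inter_restrict[symmetric] Int_absorb1)
qed

text \<open>Both matchings project bijectively to the same white and the same black vertices, so the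
  sums of a coboundary over them are equal.\<close>

lemma closed_pipe_chain:
  assumes "finite E" "same_support E M1 M2"
  shows "closed_chain E (pipe_chain (M1, M2))"
  unfolding closed_chain_def
proof (intro conjI allI impI)
  fix e assume "e \<notin> E"
  then show "pipe_chain (M1, M2) e = 0" using assms by (auto simp: pipe_chain_def same_support_def)
next
  fix f :: "vertex \<Rightarrow> int"
  have *: "(\<Sum>e\<in>M. f (White (fst e)) - f (Black (snd e))) = (\<Sum>i\<in>fst ` M. f (White i)) - (\<Sum>j\<in>snd ` M. f (Black j))"
    if "inj_on fst M" "inj_on snd M" for M
    by (simp add: sum_subtractf sum.reindex[OF that(1)] sum.reindex[OF that(2)])
  have "(\<Sum>e\<in>E. pipe_chain (M1, M2) e * (f (White (fst e)) - f (Black (snd e))))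
      = pairing E (\<lambda>e. f (White (fst e)) - f (Black (snd e))) (pipe_chain (M1, M2))"
    by (simp add: pairing_def int_scale_of_int)
  also have "\<dots> = 0"
    using assms by (subst sum_pipe_chain) (auto simp: same_support_def *)
  finally show "(\<Sum>e\<in>E. pipe_chain (M1, M2) e * (f (White (fst e)) - f (Black (snd e)))) = 0" .
qed

section \<open>Pipe systems as permutations of the vertices\<close>

definition index_vertex :: "nat \<Rightarrow> nat \<Rightarrow> vertex" where
  "index_vertex n k = (if k < n then White k else Black (k - n))"

text \<open>The permutation of the white vertices \<open>0, \<dots>, n - 1\<close> and the black vertices \<open>n, n + 1, \<dots>\<close>
  that follows \<open>M2\<close> from white to black and \<open>M1\<close> from black to white.\<close>

definition pipe_perm :: "nat \<Rightarrow> pipe_system \<Rightarrow> nat \<Rightarrow> nat" where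
  "pipe_perm n \<nu> k = (if k < n then if k \<in> fst ` snd \<nu> then n + (THE j. (k, j) \<in> snd \<nu>) else k
     else if k - n \<in> snd ` fst \<nu> then (THE i. (i, k - n) \<in> fst \<nu>) else k)"

text \<open>The inverse of \<open>pipe_perm\<close> on alternating permutations; fixed vertices are
  left uncovered.\<close>

definition perm_pipe :: "nat \<Rightarrow> (nat \<Rightarrow> nat) \<Rightarrow> pipe_system" where
  "perm_pipe n \<sigma> = ({(i, j). i < n \<and> \<sigma> (n + j) = i}, {(i, j). i < n \<and> \<sigma> i = n + j})"

text \<open>The permutations that can contribute to the determinant of the block matrix: its
  diagonal entries are the variable and 1, and its other entries vanish off the edges.\<close>

definition alternating_perms :: "(nat \<times> nat) set \<Rightarrow> nat \<Rightarrow> nat \<Rightarrow> (nat \<Rightarrow> nat) set" where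
  "alternating_perms E n m = {\<sigma>. \<sigma> permutes {0..<n + m} \<and>
     (\<forall>k < n + m. \<sigma> k \<noteq> k \<longrightarrow> adj E (index_vertex n k) (index_vertex n (\<sigma> k)))}"

context
  fixes E :: "(nat \<times> nat) set" and n m :: nat
  assumes E: "E \<subseteq> {..<n} \<times> {..<m}"
begin

lemma pipe_perm_simps:
  assumes "same_support E M1 M2"
  shows "(i, j) \<in> M2 \<Longrightarrow> pipe_perm n (M1, M2) i = n + j"
    "(i, j) \<in> M1 \<Longrightarrow> pipe_perm n (M1, M2) (n + j) = i"
    "i < n \<Longrightarrow> i \<notin> fst ` M2 \<Longrightarrow> pipe_perm n (M1, M2) i = i"
    "j \<notin> snd ` M1 \<Longrightarrow> pipe_perm n (M1, M2) (n + j) = n + j"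
proof -
  note u = same_support_unique[OF assms]
  show "pipe_perm n (M1, M2) i = n + j" if "(i, j) \<in> M2"
  proof -
    have "i < n" using that assms E by (auto simp: same_support_def)
    moreover have "i \<in> fst ` M2" using that by force
    moreover have "(THE j. (i, j) \<in> M2) = j" using that u(3) by blast
    ultimately show ?thesis by (simp add: pipe_perm_def)
  qed
  show "pipe_perm n (M1, M2) (n + j) = i" if "(i, j) \<in> M1"
  proof -
    have "j \<in> snd ` M1" using that by force
    moreover have "(THE i. (i, j) \<in> M1) = i" using that u(2) by blast
    ultimately show ?thesis by (simp add: pipe_perm_def)
  qed
qed (auto simp: pipe_perm_def)

lemma pipe_perm_cases:
  assumes "same_support E M1 M2"
  obtains (white) j where "(k, j) \<in> M2" "k < n" "j < m" "pipe_perm n (M1, M2) k = n + j"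
  | (black) i j where "(i, j) \<in> M1" "i < n" "j < m" "k = n + j" "pipe_perm n (M1, M2) k = i"
  | (fixed) "pipe_perm n (M1, M2) k = k" "\<And>i. (i, k - n) \<in> M1 \<Longrightarrow> k < n" "\<And>j. (k, j) \<notin> M2"
proof (cases "k < n")
  case True
  show ?thesis
  proof (cases "k \<in> fst ` M2")
    case t: True
    then obtain j where "(k, j) \<in> M2" by force
    then show ?thesis using white pipe_perm_simps(1)[OF assms] assms E True by (auto simp: same_support_def)
  next
    case False
    then show ?thesis using fixed pipe_perm_simps(3)[OF assms] True by force
  qed
next
  case False
  then obtain j where j: "k = n + j" using le_Suc_ex by (metis not_less)
  have no2: "(k, j') \<notin> M2" for j' using False assms E by (auto simp: same_support_def)
  show ?thesis
  proof (cases "j \<in> snd ` M1")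
    case True
    then obtain i where "(i, j) \<in> M1" by force
    then show ?thesis using black j pipe_perm_simps(2)[OF assms] assms E by (auto simp: same_support_def)
  next
    case f: False
    then show ?thesis using fixed no2 j pipe_perm_simps(4)[OF assms] by force
  qed
qed

text \<open>Injectivity rests on both matchings covering the same vertices: a vertex that stays
  fixed because one matching misses it is missed by the other as well, so it is not the image of a
  different vertex.\<close>

lemma pipe_perm_alternating:
  assumes s: "same_support E M1 M2"
  shows "pipe_perm n (M1, M2) \<in> alternating_perms E n m"
proof -
  let ?\<sigma> = "pipe_perm n (M1, M2)"
  note u = same_support_unique[OF s]
  have supp: "(\<exists>j. (i, j) \<in> M1) \<longleftrightarrow> (\<exists>j. (i, j) \<in> M2)" "(\<exists>i. (i, j) \<in> M1) \<longleftrightarrow> (\<exists>i. (i, j) \<in> M2)" for i j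
  proof -
    have "i \<in> fst ` M1 \<longleftrightarrow> i \<in> fst ` M2" "j \<in> snd ` M1 \<longleftrightarrow> j \<in> snd ` M2" using s by (auto simp: same_support_def)
    moreover have "a \<in> fst ` M \<longleftrightarrow> (\<exists>b. (a, b) \<in> M)" "b \<in> snd ` M \<longleftrightarrow> (\<exists>a. (a, b) \<in> M)"
      for a b and M :: "(nat \<times> nat) set" by force+
    ultimately show "(\<exists>j. (i, j) \<in> M1) \<longleftrightarrow> (\<exists>j. (i, j) \<in> M2)" "(\<exists>i. (i, j) \<in> M1) \<longleftrightarrow> (\<exists>i. (i, j) \<in> M2)"
      by simp_all
  qed
  have out: "?\<sigma> k = k" if "k \<notin> {0..<n + m}" for k
    by (rule pipe_perm_cases[OF s, of k]) (use that in auto)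
  have "inj_on ?\<sigma> {0..<n + m}"
  proof (rule inj_onI)
    fix x y assume xy: "?\<sigma> x = ?\<sigma> y"
    show "x = y"
      using s
    proof (cases rule: pipe_perm_cases[where k = x])
      case x: (white j)
      show ?thesis
        using s
      proof (cases rule: pipe_perm_cases[where k = y])
        case (white j') then show ?thesis using x xy u(4) by auto
      next
        case (black i' j') then show ?thesis using x xy by auto
      next
        case fixed
        then have "y = n + j" using x xy by simp
        moreover obtain i where "(i, j) \<in> M1" using supp(2)[of j] x(1) by blast
        ultimately show ?thesis using fixed(2)[of i] by simp
      qed
    next
      case x: (black i j)
      show ?thesis
        using s
      proof (cases rule: pipe_perm_cases[where k = y])
        case (white j') then show ?thesis using x xy by auto
      next
        case (black i' j') then show ?thesis using x xy u(1) by auto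
      next
        case fixed
        then have "y = i" using x xy by simp
        moreover obtain j' where "(i, j') \<in> M2" using supp(1)[of i] x(1) by blast
        ultimately show ?thesis using fixed(3) by blast
      qed
    next
      case x: fixed
      show ?thesis
        using s
      proof (cases rule: pipe_perm_cases[where k = y])
        case (white j)
        then have "x = n + j" using x xy by simp
        moreover obtain i where "(i, j) \<in> M1" using supp(2)[of j] white(1) by blast
        ultimately show ?thesis using x(2)[of i] by simp
      next
        case (black i j)
        then have "x = i" using x xy by simp
        moreover obtain j' where "(i, j') \<in> M2" using supp(1)[of i] black(1) by blast
        ultimately show ?thesis using x(3) by blast
      next
        case fixed then show ?thesis using x xy by simp
      qed
    qed
  qed
  moreover have "?\<sigma> ` {0..<n + m} \<subseteq> {0..<n + m}"
  proof
    fix y assume "y \<in> ?\<sigma> ` {0..<n + m}"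
    then obtain k where k: "k < n + m" "y = ?\<sigma> k" by auto
    show "y \<in> {0..<n + m}" using s by (cases rule: pipe_perm_cases[where k = k]) (use k in auto)
  qed
  ultimately have "bij_betw ?\<sigma> {0..<n + m} {0..<n + m}"
    by (simp add: bij_betw_def endo_inj_surj)
  then have "?\<sigma> permutes {0..<n + m}" using out by (rule bij_imp_permutes)
  moreover have "adj E (index_vertex n k) (index_vertex n (?\<sigma> k))" if "?\<sigma> k \<noteq> k" for k
    using s
  proof (cases rule: pipe_perm_cases[where k = k])
    case (white j)
    then have "(k, j) \<in> E" using s by (auto simp: same_support_def)
    then show ?thesis using white by (auto simp: index_vertex_def adj_def)
  next
    case (black i j)
    then have "(i, j) \<in> E" using s by (auto simp: same_support_def)
    then show ?thesis using black by (auto simp: index_vertex_def adj_def)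
  qed (use that in simp)
  ultimately show ?thesis by (simp add: alternating_perms_def)
qed

lemma perm_pipe_pipe_perm:
  assumes s: "same_support E M1 M2"
  shows "perm_pipe n (pipe_perm n (M1, M2)) = (M1, M2)"
proof -
  let ?\<sigma> = "pipe_perm n (M1, M2)"
  have "i < n \<and> ?\<sigma> (n + j) = i \<longleftrightarrow> (i, j) \<in> M1" for i j
  proof
    assume *: "i < n \<and> ?\<sigma> (n + j) = i"
    show "(i, j) \<in> M1" using s by (cases rule: pipe_perm_cases[where k = "n + j"]) (use * in auto)
  next
    assume "(i, j) \<in> M1"
    then show "i < n \<and> ?\<sigma> (n + j) = i" using pipe_perm_simps(2)[OF s] E s by (auto simp: same_support_def)
  qed
  moreover have "i < n \<and> ?\<sigma> i = n + j \<longleftrightarrow> (i, j) \<in> M2" for i j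
  proof
    assume *: "i < n \<and> ?\<sigma> i = n + j"
    show "(i, j) \<in> M2" using s by (cases rule: pipe_perm_cases[where k = i]) (use * in auto)
  next
    assume "(i, j) \<in> M2"
    then show "i < n \<and> ?\<sigma> i = n + j" using pipe_perm_simps(1)[OF s] E s by (auto simp: same_support_def)
  qed
  ultimately show ?thesis by (simp add: perm_pipe_def)
qed

lemma alternating_perm_step:
  assumes \<sigma>: "\<sigma> \<in> alternating_perms E n m" and "\<sigma> k \<noteq> k"
  obtains (white) j where "k < n" "\<sigma> k = n + j" "(k, j) \<in> E" | (black) i j where "k = n + j" "\<sigma> k = i" "(i, j) \<in> E"
proof -
  have "k < n + m" using assms permutes_not_in[of \<sigma> "{0..<n + m}" k] by (force simp: alternating_perms_def)
  then have "adj E (index_vertex n k) (index_vertex n (\<sigma> k))" using assms by (auto simp: alternating_perms_def)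
  then obtain i j where ij: "(i, j) \<in> E" "edge_between (index_vertex n k) (index_vertex n (\<sigma> k)) = Some (i, j)"
    by (auto simp: adj_def)
  then consider "k = i" "k < n" "\<sigma> k = n + j" | "k = n + j" "\<sigma> k = i"
    by (auto simp: edge_between_Some index_vertex_def split: if_splits)
  then show ?thesis using that ij(1) by cases auto
qed

text \<open>A permutation moves the image and the preimage of every point it moves. So a moved white
  vertex both goes to a black one and comes from a black one, and is covered by both matchings;
  likewise for black vertices.\<close>

lemma perm_pipe_same_support:
  assumes \<sigma>: "\<sigma> \<in> alternating_perms E n m"
  shows "same_support E (fst (perm_pipe n \<sigma>)) (snd (perm_pipe n \<sigma>))"
proof -
  let ?M1 = "fst (perm_pipe n \<sigma>)" and ?M2 = "snd (perm_pipe n \<sigma>)"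
  have perm: "\<sigma> permutes {0..<n + m}" using \<sigma> by (simp add: alternating_perms_def)
  then have inj: "\<sigma> x = \<sigma> y \<Longrightarrow> x = y" for x y using permutes_inj by (auto simp: inj_def)
  have M1: "(i, j) \<in> ?M1 \<longleftrightarrow> i < n \<and> \<sigma> (n + j) = i" for i j by (simp add: perm_pipe_def)
  have M2: "(i, j) \<in> ?M2 \<longleftrightarrow> i < n \<and> \<sigma> i = n + j" for i j by (simp add: perm_pipe_def)
  have 1: "(i, j) \<in> E \<and> (\<exists>j'. (i, j') \<in> ?M2) \<and> (\<exists>i'. (i', j) \<in> ?M2)" if "(i, j) \<in> ?M1" for i j
  proof -
    have ij: "i < n" "\<sigma> (n + j) = i" using that M1 by auto
    then have ne: "\<sigma> (n + j) \<noteq> n + j" by simp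
    have "(i, j) \<in> E" using alternating_perm_step[OF \<sigma> ne] ij(2) by (metis add_left_cancel not_add_less1)
    have "\<sigma> i \<noteq> i" using ij inj[of "n + j" i] by auto
    then have "\<exists>j'. (i, j') \<in> ?M2" using alternating_perm_step[OF \<sigma> \<open>\<sigma> i \<noteq> i\<close>] ij(1) M2
      by (metis not_add_less1)
    moreover have "\<exists>i'. (i', j) \<in> ?M2"
    proof -
      obtain x where x: "\<sigma> x = n + j" using permutes_surj[OF perm] by (metis surjD)
      then have "\<sigma> x \<noteq> x" using ne by auto
      then show ?thesis using alternating_perm_step[OF \<sigma>, of x] x M2 E
        by (metis add_left_cancel mem_Sigma_iff lessThan_iff not_add_less1 subsetD)
    qed
    ultimately show ?thesis using \<open>(i, j) \<in> E\<close> by blast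
  qed
  have 2: "(i, j) \<in> E \<and> (\<exists>j'. (i, j') \<in> ?M1) \<and> (\<exists>i'. (i', j) \<in> ?M1)" if "(i, j) \<in> ?M2" for i j
  proof -
    have ij: "i < n" "\<sigma> i = n + j" using that M2 by auto
    then have ne: "\<sigma> i \<noteq> i" by simp
    have "(i, j) \<in> E" using alternating_perm_step[OF \<sigma> ne] ij by (metis add_left_cancel not_add_less1)
    have "\<sigma> (n + j) \<noteq> n + j" using ij inj[of i "n + j"] by auto
    then have "\<exists>i'. (i', j) \<in> ?M1" using alternating_perm_step[OF \<sigma>, of "n + j"] M1 E
      by (metis add_left_cancel mem_Sigma_iff lessThan_iff not_add_less1 subsetD)
    moreover have "\<exists>j'. (i, j') \<in> ?M1"
    proof -
      obtain x where x: "\<sigma> x = i" using permutes_surj[OF perm] by (metis surjD)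
      then have "\<sigma> x \<noteq> x" using ne by auto
      then show ?thesis using alternating_perm_step[OF \<sigma>, of x] x M1 ij(1)
        by (metis not_add_less1)
    qed
    ultimately show ?thesis using \<open>(i, j) \<in> E\<close> by blast
  qed
  have "fst ` ?M1 = fst ` ?M2" "snd ` ?M1 = snd ` ?M2" using 1 2 by force+
  moreover have "inj_on fst ?M1 \<and> inj_on snd ?M1 \<and> inj_on fst ?M2 \<and> inj_on snd ?M2"
    unfolding perm_pipe_def by (auto simp: inj_on_def dest: inj) (metis inj)
  ultimately show ?thesis using 1 2 by (auto simp: same_support_def)
qed

lemma pipe_perm_perm_pipe:
  assumes \<sigma>: "\<sigma> \<in> alternating_perms E n m"
  shows "pipe_perm n (perm_pipe n \<sigma>) = \<sigma>"
proof
  fix k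
  define M1 M2 where "M1 = fst (perm_pipe n \<sigma>)" and "M2 = snd (perm_pipe n \<sigma>)"
  have s: "same_support E M1 M2" using perm_pipe_same_support[OF \<sigma>] by (simp add: M1_def M2_def)
  have M: "(i, j) \<in> M1 \<longleftrightarrow> i < n \<and> \<sigma> (n + j) = i" "(i, j) \<in> M2 \<longleftrightarrow> i < n \<and> \<sigma> i = n + j" for i j
    by (simp_all add: M1_def M2_def perm_pipe_def)
  have "pipe_perm n (M1, M2) k = \<sigma> k"
    using s
  proof (cases rule: pipe_perm_cases[where k = k])
    case (white j) then show ?thesis using M(2) by simp
  next
    case (black i j) then show ?thesis using M(1) by simp
  next
    case fixed
    have "\<sigma> k = k"
    proof (rule ccontr)
      assume "\<sigma> k \<noteq> k"
      with \<sigma> show False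
      proof (cases rule: alternating_perm_step)
        case (white j) then show ?thesis using fixed(3) M(2) by blast
      next
        case (black i j)
        then have "(i, j) \<in> M1" using M(1) E by auto
        then show ?thesis using fixed(2)[of i] black by simp
      qed
    qed
    then show ?thesis using fixed by simp
  qed
  then show "pipe_perm n (perm_pipe n \<sigma>) k = \<sigma> k" by (simp add: M1_def M2_def)
qed

text \<open>Covered vertices contribute the entries of their edges, an uncovered white vertex the
  variable, and an uncovered black one 1. So the exponent is the number of uncovered white
  vertices.\<close>

lemma prod_block_mat:
  fixes A B :: "'a::comm_ring_1 mat"
  assumes A: "A \<in> carrier_mat n m" and B: "B \<in> carrier_mat m n" and s: "same_support E M1 M2"
  shows "(\<Prod>k = 0..<n + m. block_mat A B $$ (k, pipe_perm n (M1, M2) k)) =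
    monom ((\<Prod>e\<in>M2. A $$ e) * (\<Prod>e\<in>M1. B $$ (snd e, fst e))) (n - card M1)"
proof -
  let ?\<sigma> = "pipe_perm n (M1, M2)"
  let ?F = "\<lambda>k. block_mat A B $$ (k, ?\<sigma> k)"
  have sE: "M1 \<subseteq> E" "M2 \<subseteq> E" and inj: "inj_on fst M1" "inj_on snd M1" "inj_on fst M2" "inj_on snd M2"
    and sup: "fst ` M1 = fst ` M2" "snd ` M1 = snd ` M2" using s by (auto simp: same_support_def)
  have W: "fst ` M2 \<subseteq> {0..<n}" and Bl: "snd ` M1 \<subseteq> {0..<m}" using sE E by force+
  have cW: "card (fst ` M2) = card M1" using card_image[OF inj(1)] sup by simp
  have \<sigma>_lt: "?\<sigma> k < n + m" if "k < n + m" for k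
    using s by (cases rule: pipe_perm_cases[where k = k]) (use that in auto)
  have entry: "?F k = (if k < n then if ?\<sigma> k < n then (if k = ?\<sigma> k then [:0, 1:] else 0) else [:A $$ (k, ?\<sigma> k - n):]
     else if ?\<sigma> k < n then [:B $$ (k - n, ?\<sigma> k):] else (if k = ?\<sigma> k then 1 else 0))" if "k < n + m" for k
    by (rule block_mat_index[OF A B that \<sigma>_lt[OF that]])
  have const_prod: "(\<Prod>x\<in>S. [:f x:]) = [:\<Prod>x\<in>S. f x:]" for S :: "(nat \<times> nat) set" and f :: "_ \<Rightarrow> 'a"
    by (induction S rule: infinite_finite_induct) (auto simp: one_pCons)
  have "(\<Prod>k = 0..<n + m. ?F k) = (\<Prod>k = 0..<n. ?F k) * (\<Prod>k = n..<n + m. ?F k)"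
    by (rule prod.atLeastLessThan_concat[symmetric]) auto
  also have "(\<Prod>k = 0..<n. ?F k) = (\<Prod>k\<in>fst ` M2. ?F k) * (\<Prod>k\<in>{0..<n} - fst ` M2. ?F k)"
    using prod.subset_diff[OF W] by (simp add: mult.commute)
  also have "(\<Prod>k\<in>{0..<n} - fst ` M2. ?F k) = (\<Prod>k\<in>{0..<n} - fst ` M2. [:0, 1:])"
  proof (rule prod.cong[OF refl])
    fix k assume "k \<in> {0..<n} - fst ` M2"
    then have "?\<sigma> k = k" "k < n" using pipe_perm_simps(3)[OF s] by auto
    then show "?F k = [:0, 1:]" using entry[of k] by simp
  qed
  also have "\<dots> = [:0, 1:] ^ (n - card M1)"
    using W cW by (simp add: card_Diff_subset finite_subset[OF W])
  also have "(\<Prod>k\<in>fst ` M2. ?F k) = (\<Prod>e\<in>M2. [:A $$ e:])"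
    unfolding prod.reindex[OF inj(3)]
  proof (rule prod.cong[OF refl])
    fix e assume e: "e \<in> M2"
    then have "?\<sigma> (fst e) = n + snd e" "fst e < n" using pipe_perm_simps(1)[OF s, of "fst e" "snd e"] W by auto
    then show "(?F \<circ> fst) e = [:A $$ e:]" using entry[of "fst e"] by simp
  qed
  also have "(\<Prod>k = n..<n + m. ?F k) = (\<Prod>j = 0..<m. ?F (n + j))"
    using prod.shift_bounds_nat_ivl[of ?F 0 n m] by (simp add: add.commute)
  also have "\<dots> = (\<Prod>j\<in>snd ` M1. ?F (n + j))"
  proof (rule prod.mono_neutral_right)
    show "\<forall>j\<in>{0..<m} - snd ` M1. ?F (n + j) = 1"
    proof
      fix j assume "j \<in> {0..<m} - snd ` M1"
      then have "?\<sigma> (n + j) = n + j" "j < m" using pipe_perm_simps(4)[OF s] by auto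
      then show "?F (n + j) = 1" using entry[of "n + j"] by simp
    qed
  qed (use Bl in auto)
  also have "\<dots> = (\<Prod>e\<in>M1. [:B $$ (snd e, fst e):])"
    unfolding prod.reindex[OF inj(2)]
  proof (rule prod.cong[OF refl])
    fix e assume e: "e \<in> M1"
    then have "snd e \<in> snd ` M1" "fst e \<in> fst ` M1" by simp_all
    then have "snd e < m" "fst e < n" using Bl W sup by auto
    moreover have "?\<sigma> (n + snd e) = fst e" using e pipe_perm_simps(2)[OF s, of "fst e" "snd e"] by simp
    ultimately show "((\<lambda>j. ?F (n + j)) \<circ> snd) e = [:B $$ (snd e, fst e):]" using entry[of "n + snd e"] by simp
  qed
  finally have "(\<Prod>k = 0..<n + m. ?F k) = [:\<Prod>e\<in>M2. A $$ e:] * [:0, 1:] ^ (n - card M1) * [:\<Prod>e\<in>M1. B $$ (snd e, fst e):]"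
    by (simp only: const_prod)
  also have "\<dots> = monom ((\<Prod>e\<in>M2. A $$ e) * (\<Prod>e\<in>M1. B $$ (snd e, fst e))) (n - card M1)"
    by (simp add: monom_altdef mult.commute)
  finally show ?thesis .
qed

lemma det_block_mat:
  fixes A B :: "'a::comm_ring_1 mat"
  assumes A: "A \<in> carrier_mat n m" and B: "B \<in> carrier_mat m n"
    and A0: "\<And>i j. i < n \<Longrightarrow> j < m \<Longrightarrow> (i, j) \<notin> E \<Longrightarrow> A $$ (i, j) = 0"
    and B0: "\<And>i j. i < n \<Longrightarrow> j < m \<Longrightarrow> (i, j) \<notin> E \<Longrightarrow> B $$ (j, i) = 0"
  shows "det (block_mat A B) = (\<Sum>\<nu> | same_support E (fst \<nu>) (snd \<nu>).
    of_int (sign (pipe_perm n \<nu>)) * monom ((\<Prod>e\<in>snd \<nu>. A $$ e) * (\<Prod>e\<in>fst \<nu>. B $$ (snd e, fst e))) (n - card (fst \<nu>)))"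
proof -
  let ?F = "block_mat A B"
  have F: "?F \<in> carrier_mat (n + m) (n + m)" using block_mat_carrier[OF A B] .
  let ?t = "\<lambda>\<sigma>. of_int (sign \<sigma>) * (\<Prod>k = 0..<n + m. ?F $$ (k, \<sigma> k))"
  have "det ?F = (\<Sum>\<sigma> | \<sigma> permutes {0..<n + m}. ?t \<sigma>)" by (rule det_def'[OF F])
  also have "\<dots> = (\<Sum>\<sigma>\<in>alternating_perms E n m. ?t \<sigma>)"
  proof (rule sum.mono_neutral_right)
    show "finite {\<sigma>. \<sigma> permutes {0..<n + m}}" by (simp add: finite_permutations)
    show "alternating_perms E n m \<subseteq> {\<sigma>. \<sigma> permutes {0..<n + m}}" by (auto simp: alternating_perms_def)
    show "\<forall>\<sigma>\<in>{\<sigma>. \<sigma> permutes {0..<n + m}} - alternating_perms E n m. ?t \<sigma> = 0"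
    proof
      fix \<sigma> assume "\<sigma> \<in> {\<sigma>. \<sigma> permutes {0..<n + m}} - alternating_perms E n m"
      then obtain k where \<sigma>: "\<sigma> permutes {0..<n + m}" and k: "k < n + m" "\<sigma> k \<noteq> k"
        "\<not> adj E (index_vertex n k) (index_vertex n (\<sigma> k))"
        by (auto simp: alternating_perms_def)
      have sk: "\<sigma> k < n + m" using permutes_in_image[OF \<sigma>, of k] k(1) by simp
      have adjI: "adj E (White i) (Black j)" "adj E (Black j) (White i)" if "(i, j) \<in> E" for i j
        using that by (auto simp: adj_def)
      have "?F $$ (k, \<sigma> k) = 0"
      proof -
        consider "k < n" "\<sigma> k < n" | "k < n" "\<not> \<sigma> k < n" | "\<not> k < n" "\<sigma> k < n" | "\<not> k < n" "\<not> \<sigma> k < n" by blast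
        then show ?thesis
        proof cases
          case 2
          then have "(k, \<sigma> k - n) \<notin> E" using k(3) adjI(1) by (auto simp: index_vertex_def)
          then have "A $$ (k, \<sigma> k - n) = 0" using A0 2 sk by auto
          then show ?thesis using block_mat_index[OF A B k(1) sk] 2 by simp
        next
          case 3
          then have "(\<sigma> k, k - n) \<notin> E" using k(3) adjI(2) by (auto simp: index_vertex_def)
          then have "B $$ (k - n, \<sigma> k) = 0" using B0 3 k(1) by auto
          then show ?thesis using block_mat_index[OF A B k(1) sk] 3 by simp
        qed (use block_mat_index[OF A B k(1) sk] k(2) in auto)
      qed
      then have "(\<Prod>k = 0..<n + m. ?F $$ (k, \<sigma> k)) = 0"
        using k(1) by (intro prod_zero) auto
      then show "?t \<sigma> = 0" by simp
    qed
  qed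
  also have "\<dots> = (\<Sum>\<nu> | same_support E (fst \<nu>) (snd \<nu>). ?t (pipe_perm n \<nu>))"
  proof (rule sum.reindex_bij_witness[of _ "pipe_perm n" "perm_pipe n"])
    fix \<sigma> assume \<sigma>: "\<sigma> \<in> alternating_perms E n m"
    show "pipe_perm n (perm_pipe n \<sigma>) = \<sigma>" using pipe_perm_perm_pipe[OF \<sigma>] .
    show "perm_pipe n \<sigma> \<in> {\<nu>. same_support E (fst \<nu>) (snd \<nu>)}" using perm_pipe_same_support[OF \<sigma>] by simp
    show "?t (pipe_perm n (perm_pipe n \<sigma>)) = ?t \<sigma>" using pipe_perm_perm_pipe[OF \<sigma>] by simp
  next
    fix \<nu> assume \<nu>: "\<nu> \<in> {\<nu>. same_support E (fst \<nu>) (snd \<nu>)}"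
    show "perm_pipe n (pipe_perm n \<nu>) = \<nu>" using perm_pipe_pipe_perm[of "fst \<nu>" "snd \<nu>"] \<nu> by simp
    show "pipe_perm n \<nu> \<in> alternating_perms E n m" using pipe_perm_alternating[of "fst \<nu>" "snd \<nu>"] \<nu> by simp
  qed
  also have "\<dots> = (\<Sum>\<nu> | same_support E (fst \<nu>) (snd \<nu>).
    of_int (sign (pipe_perm n \<nu>)) * monom ((\<Prod>e\<in>snd \<nu>. A $$ e) * (\<Prod>e\<in>fst \<nu>. B $$ (snd e, fst e))) (n - card (fst \<nu>)))"
  proof (intro sum.cong refl)
    fix \<nu> assume "\<nu> \<in> {\<nu>. same_support E (fst \<nu>) (snd \<nu>)}"
    then have s: "same_support E (fst \<nu>) (snd \<nu>)" by simp
    show "?t (pipe_perm n \<nu>) = of_int (sign (pipe_perm n \<nu>)) *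
      monom ((\<Prod>e\<in>snd \<nu>. A $$ e) * (\<Prod>e\<in>fst \<nu>. B $$ (snd e, fst e))) (n - card (fst \<nu>))"
      using prod_block_mat[OF A B s] by simp
  qed
  finally show ?thesis .
qed

end

section \<open>The singular \<open>q\<close>-polynomial\<close>

lemma pairing_sum: "pairing E \<phi> (\<lambda>e. \<Sum>a\<in>A. w a * f a e) = (\<Sum>a\<in>A. int_scale (w a) (pairing E \<phi> (f a)))"
  by (induction A rule: infinite_finite_induct) (simp_all add: pairing_add pairing_mult)

text \<open>Since vertices are dropped, the crossing condition becomes stronger. It persists because
  two edges meet only in common ends, and the ends of the remaining edges are kept.\<close>

lemma plane_graph_induced:
  assumes "plane_graph G" "W \<subseteq> whites G" "B \<subseteq> blacks G"
  shows "plane_graph (induced_subgraph G W B)"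
proof -
  interpret plane_graph G by (rule assms(1))
  let ?H = "induced_subgraph G W B"
  note p = plane[unfolded plane_bigraph_def]
  have fin: "finite W" "finite B"
    using p[THEN conjunct1] p[THEN conjunct2, THEN conjunct1] assms(2,3) by (auto intro: finite_subset)
  have V: "vertices ?H = White ` W \<union> Black ` B" by (simp add: vertices_def induced_subgraph_def)
  have VG: "vertices ?H \<subseteq> vertices G" using assms(2,3) unfolding V by (auto simp: vertices_def)
  have H: "whites ?H = W" "blacks ?H = B" "edges ?H = edges G \<inter> W \<times> B" "place ?H = place G" "curve ?H = curve G"
    by (simp_all add: induced_subgraph_def)
  have e: "path_image (curve G (i, j)) \<inter> place G ` vertices ?H = {place G (White i), place G (Black j)}"
    if "(i, j) \<in> edges ?H" for i j
  proof
    have ij: "(i, j) \<in> edges G" "i \<in> W" "j \<in> B" using that H by auto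
    note c = edge_curve(4)[OF ij(1), simplified]
    show "path_image (curve G (i, j)) \<inter> place G ` vertices ?H \<subseteq> {place G (White i), place G (Black j)}"
      using VG c by blast
    have "White i \<in> vertices ?H" "Black j \<in> vertices ?H" unfolding V using ij by auto
    moreover have "{place G (White i), place G (Black j)} \<subseteq> path_image (curve G (i, j))" unfolding c[symmetric] by blast
    ultimately show "{place G (White i), place G (Black j)} \<subseteq> path_image (curve G (i, j)) \<inter> place G ` vertices ?H"
      by simp
  qed
  have "path_image (curve G d) \<inter> path_image (curve G d') \<subseteq> place G ` vertices ?H"
    if "d \<in> edges ?H" "d' \<in> edges ?H" "d \<noteq> d'" for d d'
  proof -
    have dd: "d \<in> edges G" "d' \<in> edges G" using that H by auto
    have "path_image (curve G d) \<inter> path_image (curve G d') \<subseteq> place G ` (ends {d} \<inter> ends {d'})"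
      using img_Int[of "{d}" "{d'}"] dd that(3) by (simp add: img_insert)
    moreover have "ends {d} \<subseteq> vertices ?H" unfolding V using that(1) H by (auto simp: ends_insert)
    ultimately show ?thesis by blast
  qed
  moreover have "inj_on (place G) (vertices ?H)" using inj_on_subset[OF inj_place VG] .
  moreover have "\<forall>(i, j) \<in> edges ?H. arc (curve G (i, j)) \<and> pathstart (curve G (i, j)) = place G (Black j) \<and>
        pathfinish (curve G (i, j)) = place G (White i) \<and>
        path_image (curve G (i, j)) \<inter> place G ` vertices ?H = {place G (White i), place G (Black j)}"
  proof (intro ballI, clarify)
    fix i j assume ij: "(i, j) \<in> edges ?H"
    then have "(i, j) \<in> edges G" using H by auto
    from edge_curve(1-3)[OF this] e[OF ij]
    show "arc (curve G (i, j)) \<and> pathstart (curve G (i, j)) = place G (Black j) \<and>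
        pathfinish (curve G (i, j)) = place G (White i) \<and>
        path_image (curve G (i, j)) \<inter> place G ` vertices ?H = {place G (White i), place G (Black j)}" by simp
  qed
  ultimately show ?thesis
    unfolding plane_graph_def plane_bigraph_def H using fin by (intro conjI) (simp_all only:, auto)
qed

section \<open>Size, parity, sign and area of a pipe system\<close>

locale numbered_plane_graph = plane_graph +
  fixes n m :: nat
  assumes whites_eq: "whites G = {..<n}" and blacks_eq: "blacks G = {..<m}"
begin

lemma edges_numbered: "edges G \<subseteq> {..<n} \<times> {..<m}"
  using edges_subset by (simp add: whites_eq blacks_eq)

lemma pipe_systems_eq: "pipe_systems G = {\<nu>. same_support (edges G) (fst \<nu>) (snd \<nu>)}"
proof (intro equalityI subsetI)
  fix \<nu> assume "\<nu> \<in> pipe_systems G"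
  then obtain M1 M2 W B where "\<nu> = (M1, M2)" "perfect_matching (induced_subgraph G W B) M1"
      "perfect_matching (induced_subgraph G W B) M2"
    by (auto simp: pipe_systems_def)
  then show "\<nu> \<in> {\<nu>. same_support (edges G) (fst \<nu>) (snd \<nu>)}"
    by (simp add: perfect_matching_induced same_support_def)
next
  fix \<nu> assume "\<nu> \<in> {\<nu>. same_support (edges G) (fst \<nu>) (snd \<nu>)}"
  then obtain M1 M2 where \<nu>: "\<nu> = (M1, M2)" and s: "same_support (edges G) M1 M2" by (cases \<nu>) auto
  have "M1 \<subseteq> whites G \<times> blacks G" using s edges_subset by (auto simp: same_support_def)
  then have "fst ` M1 \<subseteq> whites G" "snd ` M1 \<subseteq> blacks G" by force+
  moreover have "perfect_matching (induced_subgraph G (fst ` M1) (snd ` M1)) M1"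
    "perfect_matching (induced_subgraph G (fst ` M1) (snd ` M1)) M2"
    using s by (simp_all add: perfect_matching_induced same_support_def)
  ultimately show "\<nu> \<in> pipe_systems G" unfolding \<nu> pipe_systems_def by blast
qed

lemma pipe_size_eq:
  assumes "same_support (edges G) M1 M2" shows "pipe_size G (M1, M2) = card M1"
proof -
  have "finite M1" using assms finite_subset[OF _ finite_edges] by (auto simp: same_support_def)
  have "vertices (pipe_support G (M1, M2)) = White ` fst ` M1 \<union> Black ` snd ` M1"
    by (simp add: pipe_support_def induced_subgraph_def vertices_def)
  also have "card \<dots> = card (White ` fst ` M1) + card (Black ` snd ` M1)"
    using \<open>finite M1\<close> by (intro card_Un_disjoint) auto
  also have "\<dots> = card M1 + card M1"
  proof -
    have inj: "inj_on fst M1" "inj_on snd M1" using assms by (simp_all add: same_support_def)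
    have "card (White ` S) = card S" "card (Black ` S) = card S" for S
      by (simp_all add: card_image inj_on_def)
    then show ?thesis using card_image[OF inj(1)] card_image[OF inj(2)] by simp
  qed
  finally show ?thesis by (simp add: pipe_size_def)
qed

lemma pipe_support_facts:
  assumes "same_support (edges G) M1 M2"
  defines "H \<equiv> pipe_support G (M1, M2)"
  shows "plane_graph H" "same_support (edges H) M1 M2" "edges H \<subseteq> edges G"
    "vertices H = White ` fst ` M1 \<union> Black ` snd ` M1"
proof -
  have sub: "fst ` M1 \<subseteq> whites G" "snd ` M1 \<subseteq> blacks G"
    using assms(1) edges_subset by (force simp: same_support_def)+
  show "plane_graph H" unfolding H_def pipe_support_def
    using sub by (intro plane_graph_induced) (auto intro: plane_graph_axioms)
  have eH: "edges H = edges G \<inter> fst ` M1 \<times> snd ` M1" by (simp add: H_def pipe_support_def induced_subgraph_def)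
  then show "edges H \<subseteq> edges G" by blast
  have "M1 \<subseteq> fst ` M1 \<times> snd ` M1" "M2 \<subseteq> fst ` M2 \<times> snd ` M2" by force+
  then show "same_support (edges H) M1 M2" using assms(1) unfolding eH same_support_def by auto
  show "vertices H = White ` fst ` M1 \<union> Black ` snd ` M1"
    by (simp add: H_def pipe_support_def induced_subgraph_def vertices_def)
qed

text \<open>The pipe chain is closed both in the graph and in its support, so neither value depends
  on the representative. Restricting a cochain to the support does not change its value, since the
  chain vanishes on all other edges.\<close>

lemma pipe_parity_eq:
  assumes s: "same_support (edges G) M1 M2"
    and k: "k \<in> cochains G" "kasteleyn_class G = cohomologous G `` {k}"
    and kH: "kH \<in> cochains (pipe_support G (M1, M2))"
      "kasteleyn_class (pipe_support G (M1, M2)) = cohomologous (pipe_support G (M1, M2)) `` {kH}"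
  shows "pipe_parity G (M1, M2) = pairing (edges G) k (pipe_chain (M1, M2)) -
    pairing (edges (pipe_support G (M1, M2))) kH (pipe_chain (M1, M2))"
proof -
  define H where "H = pipe_support G (M1, M2)"
  note H = pipe_support_facts[OF s, folded H_def]
  interpret H: plane_graph H by (rule H(1))
  let ?c = "pipe_chain (M1, M2)"
  have cG: "closed_chain (edges G) ?c" using closed_pipe_chain[OF finite_edges s] .
  have cH: "closed_chain (edges H) ?c" using closed_pipe_chain[OF H.finite_edges H(2)] .
  show ?thesis unfolding pipe_parity_def H_def[symmetric] restriction_defect_def
  proof (rule H.evaluate_eq)
    have "k \<in> kasteleyn_class G" unfolding k(2) using equiv_class_self[OF equiv_cohomologous k(1)] .
    moreover have "kH \<in> kasteleyn_class H"
      using kH unfolding H_def[symmetric] using equiv_class_self[OF H.equiv_cohomologous, of kH] by simp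
    ultimately show "class_diff (restrict_class H (kasteleyn_class G)) (kasteleyn_class H) \<noteq> {}"
      unfolding class_diff_def restrict_class_def by blast
    fix \<phi> assume "\<phi> \<in> class_diff (restrict_class H (kasteleyn_class G)) (kasteleyn_class H)"
    then obtain a b where ab: "a \<in> kasteleyn_class G" "b \<in> kasteleyn_class H"
      "\<phi> = (\<lambda>e. (if e \<in> edges H then a e else 0) - b e)"
      unfolding class_diff_def restrict_class_def by blast
    have "pairing (edges H) \<phi> ?c = pairing (edges H) (\<lambda>e. if e \<in> edges H then a e else 0) ?c - pairing (edges H) b ?c"
      unfolding ab(3) by (rule pairing_diff_left)
    also have "pairing (edges H) (\<lambda>e. if e \<in> edges H then a e else 0) ?c = pairing (edges H) a ?c"
      unfolding pairing_def by (intro sum.cong) auto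
    also have "\<dots> = pairing (edges G) a ?c"
      using pairing_superset[OF finite_edges H(3)] closed_chain_outside[OF cH] by metis
    also have "\<dots> = pairing (edges G) k ?c"
      using pairing_cohomologous[OF _ cG, of k a] ab(1) k(2) by simp
    also have "pairing (edges H) b ?c = pairing (edges H) kH ?c"
      using H.pairing_cohomologous[OF _ cH, of kH b] ab(2) kH(2) by (simp add: H_def)
    finally show "pairing (edges H) \<phi> ?c = pairing (edges G) k ?c - pairing (edges H) kH ?c" .
  qed
qed

text \<open>Restricted to the indices \<open>S\<close> of the covered vertices, the permutation
  moves every point along an edge of the support, so the sign formula for alternating permutations
  applies with the support as the graph.\<close>

lemma sign_pipe_perm:
  assumes s: "same_support (edges G) M1 M2"
    and kH: "\<And>C. is_cyc (edges (pipe_support G (M1, M2))) C \<Longrightarrow>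
      (\<Sum>e\<in>cyc_edges C. kH e) = plane_graph.kasteleyn_sign (pipe_support G (M1, M2)) (cyc_edges C)"
  shows "sign (pipe_perm n (M1, M2)) = (- 1) ^ card M1 *
    sgn_bit (pairing (edges (pipe_support G (M1, M2))) kH (pipe_chain (M1, M2)))"
proof -
  define H where "H = pipe_support G (M1, M2)"
  note H = pipe_support_facts[OF s, folded H_def]
  interpret H: plane_graph H by (rule H(1))
  let ?\<sigma> = "pipe_perm n (M1, M2)"
  have sE: "M1 \<subseteq> edges G" "M2 \<subseteq> edges G" "M1 \<subseteq> edges H" "M2 \<subseteq> edges H"
    and inj: "inj_on fst M1" "inj_on snd M1" "inj_on fst M2" "inj_on snd M2"
    and sup: "fst ` M1 = fst ` M2" "snd ` M1 = snd ` M2" using s H(2) by (auto simp: same_support_def)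
  have fin: "finite M1" "finite M2" using sE finite_subset[OF _ finite_edges] by auto
  have W: "fst ` M1 \<subseteq> {..<n}" using sE(1) edges_numbered by force
  define S where "S = fst ` M1 \<union> (\<lambda>j. n + j) ` snd ` M1"
  have disj: "fst ` M1 \<inter> (\<lambda>j. n + j) ` snd ` M1 = {}" using W by auto
  have finS: "finite S" using fin by (simp add: S_def)
  note ps = pipe_perm_simps[OF edges_numbered s]
  have perm: "?\<sigma> permutes {0..<n + m}"
    using pipe_perm_alternating[OF edges_numbered s] by (simp add: alternating_perms_def)
  have permS: "?\<sigma> permutes S"
  proof (rule permutes_superset[OF perm])
    fix x assume x: "x \<in> {0..<n + m} - S"
    show "?\<sigma> x = x"
    proof (cases "x < n")
      case True
      then show ?thesis using x ps(3) sup(1) by (auto simp: S_def)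
    next
      case False
      then obtain j where "x = n + j" by (metis le_Suc_ex not_less)
      then show ?thesis using x ps(4) by (auto simp: S_def)
    qed
  qed
  have iv: "index_vertex n i = White i" if "i \<in> fst ` M1" for i using that W by (auto simp: index_vertex_def)
  have ivb: "index_vertex n (n + j) = Black j" for j by (simp add: index_vertex_def)
  have bij: "bij_betw (index_vertex n) S (vertices H)"
  proof (rule bij_betw_imageI)
    show "inj_on (index_vertex n) S"
      by (auto simp: inj_on_def index_vertex_def split: if_splits)
    show "index_vertex n ` S = vertices H"
      unfolding S_def H(4) image_Un image_image using iv by (simp add: ivb image_image)
  qed
  have w_edge: "edge_between (index_vertex n (fst e)) (index_vertex n (?\<sigma> (fst e))) = Some e" if "e \<in> M2" for e
    using that ps(1)[of "fst e" "snd e"] iv[of "fst e"] sup(1) by (simp add: ivb)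
  have b_edge: "edge_between (index_vertex n (n + snd e)) (index_vertex n (?\<sigma> (n + snd e))) = Some e" if "e \<in> M1" for e
    using that ps(2)[of "fst e" "snd e"] iv[of "fst e"] by (simp add: ivb)
  have adj: "adj (edges H) (index_vertex n x) (index_vertex n (?\<sigma> x))" if "x \<in> S" for x
  proof -
    from that consider e where "e \<in> M2" "x = fst e" | e where "e \<in> M1" "x = n + snd e"
      unfolding S_def sup(1) by blast
    then show ?thesis
    proof cases
      case 1 then show ?thesis using w_edge sE unfolding adj_def by blast
    next
      case 2 then show ?thesis using b_edge sE unfolding adj_def by blast
    qed
  qed
  let ?k = "\<lambda>x. kH (the (edge_between (index_vertex n x) (index_vertex n (?\<sigma> x))))"
  have "(\<Sum>x\<in>S. ?k x) = (\<Sum>x\<in>fst ` M2. ?k x) + (\<Sum>x\<in>(\<lambda>e. n + snd e) ` M1. ?k x)"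
    unfolding S_def using disj fin by (subst sum.union_disjoint) (auto simp: sup(1) image_image)
  also have "(\<Sum>x\<in>fst ` M2. ?k x) = (\<Sum>e\<in>M2. kH e)"
    unfolding sum.reindex[OF inj(3)] using w_edge by (intro sum.cong) auto
  also have "(\<Sum>x\<in>(\<lambda>e. n + snd e) ` M1. ?k x) = (\<Sum>e\<in>M1. kH e)"
  proof -
    have "inj_on (\<lambda>e. n + snd e) M1" using inj(2) by (simp add: inj_on_def)
    then show ?thesis using b_edge by (subst sum.reindex) (auto intro: sum.cong)
  qed
  also have "(\<Sum>e\<in>M2. kH e) + (\<Sum>e\<in>M1. kH e) = pairing (edges H) kH (pipe_chain (M1, M2))"
  proof -
    \<comment> \<open>The sum over the points of \<open>S\<close> adds the two matchings, while the
      pipe chain subtracts them; modulo 2 this is the same.\<close>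
    have "a + b = a - b" for a b :: bit by (cases a; cases b) simp_all
    then show ?thesis by (simp only: sum_pipe_chain[OF H.finite_edges sE(3,4)])
  qed
  finally have ksum: "(\<Sum>x\<in>S. ?k x) = pairing (edges H) kH (pipe_chain (M1, M2))" .
  have "{x \<in> S. is_white (index_vertex n x)} = fst ` M1"
  proof -
    have "is_white (index_vertex n x) \<longleftrightarrow> x < n" for x by (simp add: index_vertex_def)
    then show ?thesis unfolding S_def using W by auto
  qed
  then have card_w: "card {x \<in> S. is_white (index_vertex n x)} = card M1"
    using inj(1) by (simp add: card_image)
  have "sign ?\<sigma> = (- 1) ^ card {x \<in> S. is_white (index_vertex n x)} * sgn_bit (\<Sum>x\<in>S. ?k x)"
    by (rule H.sign_alternating_permutation[OF _ bij finS permS adj]) (use kH H_def in auto)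
  then show ?thesis unfolding ksum card_w H_def .
qed

lemma pipe_chain_area:
  assumes s: "same_support (edges G) M1 M2" and k: "k \<in> cochains G"
    and \<alpha>: "\<And>F. F \<in> bounded_faces G \<Longrightarrow> pairing (edges G) \<alpha> (face_boundary G F) =
      q_circle_of_bit (pairing (edges G) k (face_boundary G F)) + gen_q"
  shows "pairing (edges G) \<alpha> (pipe_chain (M1, M2)) =
    q_circle_of_bit (pairing (edges G) k (pipe_chain (M1, M2))) + (0, pipe_area G (M1, M2))"
proof -
  let ?c = "pipe_chain (M1, M2)"
  let ?w = "\<lambda>F. chain_winding G ?c (SOME z. z \<in> F)"
  have cl: "closed_chain (edges G) ?c" using closed_pipe_chain[OF finite_edges s] .
  \<comment> \<open>The expansion is stated for any coefficient group, as it serves both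
    \<open>\<alpha>\<close> and \<open>k\<close>.\<close>
  have ex: "pairing (edges G) \<phi> ?c = (\<Sum>F\<in>bounded_faces G. int_scale (?w F) (pairing (edges G) \<phi> (face_boundary G F)))"
    for \<phi> :: "nat \<times> nat \<Rightarrow> 'b::ab_group_add"
    using arg_cong[OF closed_chain_expand[OF cl], of "pairing (edges G) \<phi>"] by (simp only: pairing_sum)
  have "pairing (edges G) \<alpha> ?c = (\<Sum>F\<in>bounded_faces G. q_circle_of_bit (int_scale (?w F) (pairing (edges G) k (face_boundary G F))))
      + (\<Sum>F\<in>bounded_faces G. int_scale (?w F) gen_q)"
    unfolding ex[of \<alpha>] sum.distrib[symmetric]
    by (intro sum.cong refl) (simp add: \<alpha> int_scale_add_right q_circle_of_bit_scale)
  also have "(\<Sum>F\<in>bounded_faces G. int_scale (?w F) gen_q) = int_scale (pipe_area G (M1, M2)) gen_q"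
    by (simp add: pipe_area_def int_scale_sum)
  finally show ?thesis by (simp add: ex[of k] q_circle_of_bit_sum int_scale_gen_q)
qed

text \<open>An entry of norm 1 has the form \<open>eta s\<close> by \<open>laurent_norm_one\<close>,
  with only one possible \<open>s\<close>; an entry of norm 0 vanishes.\<close>

lemma matrix_cochain_eta:
  assumes "generalized_kasteleyn_q_matrix G A"
  shows "matrix_cochain G A \<in> cochains G"
    "e \<in> edges G \<Longrightarrow> eta (matrix_cochain G A e) = A $$ e"
    "i < n \<Longrightarrow> j < m \<Longrightarrow> (i, j) \<notin> edges G \<Longrightarrow> A $$ (i, j) = 0"
    "A \<in> carrier_mat n m"
proof -
  have A: "A \<in> carrier_mat n m" "\<And>i j. i < n \<Longrightarrow> j < m \<Longrightarrow>
      A $$ (i, j) * laurent_cnj (A $$ (i, j)) = (if (i, j) \<in> edges G then 1 else 0)"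
    using assms by (auto simp: generalized_kasteleyn_q_matrix_def whites_eq blacks_eq)
  show "A \<in> carrier_mat n m" by (rule A(1))
  show "matrix_cochain G A \<in> cochains G" by (simp add: matrix_cochain_def cochains_def)
  show "A $$ (i, j) = 0" if "i < n" "j < m" "(i, j) \<notin> edges G"
  proof (rule laurent_norm_zero)
    show "A $$ (i, j) * laurent_cnj (A $$ (i, j)) = 0" unfolding A(2)[OF that(1,2)] using that(3) by simp
  qed
  assume e: "e \<in> edges G"
  then have "A $$ e * laurent_cnj (A $$ e) = 1" using A(2)[of "fst e" "snd e"] edges_numbered by force
  then obtain s where s: "eta s = A $$ e" using laurent_norm_one by blast
  have "(THE s. eta s = A $$ e) = s"
    by (rule the_equality[where P = "\<lambda>s. eta s = A $$ e", OF s]) (use s eta_inj in metis)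
  then show "eta (matrix_cochain G A e) = A $$ e" using s e by (simp add: matrix_cochain_def)
qed

lemma char_poly_kasteleyn:
  assumes A: "kasteleyn_q_matrix G A"
  shows "char_poly (A * adjoint_mat A) =
    (\<Sum>\<nu> \<in> pipe_systems G.
       monom ((- 1) ^ pipe_size G \<nu> * q_power (pipe_area G \<nu>)
                * eta (q_circle_of_bit (pipe_parity G \<nu>)))
             (n - pipe_size G \<nu>))"
proof -
  have gen: "generalized_kasteleyn_q_matrix G A" using A by (simp add: kasteleyn_q_matrix_def)
  define \<alpha> where "\<alpha> = matrix_cochain G A"
  note \<alpha>A = matrix_cochain_eta[OF gen, folded \<alpha>_def]
  obtain k :: "nat \<times> nat \<Rightarrow> bit" where k: "k \<in> cochains G" "kasteleyn_class G = cohomologous G `` {k}"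
    "\<And>C. is_cyc (edges G) C \<Longrightarrow> (\<Sum>e\<in>cyc_edges C. k e) = kasteleyn_sign (cyc_edges C)"
    by (rule kasteleyn_class) (rule that; assumption)
  have face: "pairing (edges G) \<alpha> (face_boundary G F) =
      q_circle_of_bit (pairing (edges G) k (face_boundary G F)) + gen_q" if F: "F \<in> bounded_faces G" for F
  proof -
    have cl: "closed_chain (edges G) (face_boundary G F)" using face_boundary(1)[OF F] .
    have "evaluate G (matrix_class G A) (face_boundary G F)
          = q_circle_of_bit (evaluate G (kasteleyn_class G) (face_boundary G F)) + gen_q"
      using A F by (simp add: kasteleyn_q_matrix_def)
    then show ?thesis
      unfolding matrix_class_def k(2) \<alpha>_def[symmetric] evaluate_class[OF \<alpha>A(1) cl] evaluate_class[OF k(1) cl] .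
  qed
  have Bc: "adjoint_mat A \<in> carrier_mat m n" using \<alpha>A(4) by (simp add: adjoint_mat_def)
  have Bij: "adjoint_mat A $$ (j, i) = laurent_cnj (A $$ (i, j))" if "i < n" "j < m" for i j
    using that \<alpha>A(4) by (simp add: adjoint_mat_def)
  have "char_poly (A * adjoint_mat A) = det (block_mat A (adjoint_mat A))"
    by (rule char_poly_mult_eq_det[OF \<alpha>A(4) Bc])
  also have "\<dots> = (\<Sum>\<nu> | same_support (edges G) (fst \<nu>) (snd \<nu>). of_int (sign (pipe_perm n \<nu>)) *
      monom ((\<Prod>e\<in>snd \<nu>. A $$ e) * (\<Prod>e\<in>fst \<nu>. adjoint_mat A $$ (snd e, fst e))) (n - card (fst \<nu>)))"
    by (rule det_block_mat[OF edges_numbered \<alpha>A(4) Bc \<alpha>A(3)]) (simp_all add: Bij \<alpha>A(3))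
  also have "\<dots> = (\<Sum>\<nu> \<in> pipe_systems G.
       monom ((- 1) ^ pipe_size G \<nu> * q_power (pipe_area G \<nu>)
                * eta (q_circle_of_bit (pipe_parity G \<nu>)))
             (n - pipe_size G \<nu>))"
    unfolding pipe_systems_eq
  proof (rule sum.cong[OF refl])
    fix \<nu> assume "\<nu> \<in> {\<nu>. same_support (edges G) (fst \<nu>) (snd \<nu>)}"
    then obtain M1 M2 where \<nu>: "\<nu> = (M1, M2)" and s: "same_support (edges G) M1 M2" by (cases \<nu>) auto
    have sE: "M1 \<subseteq> edges G" "M2 \<subseteq> edges G" using s by (auto simp: same_support_def)
    define H where "H = pipe_support G (M1, M2)"
    interpret H: plane_graph H using pipe_support_facts(1)[OF s] by (simp add: H_def)
    obtain kH :: "nat \<times> nat \<Rightarrow> bit" where kH: "kH \<in> cochains H" "kasteleyn_class H = cohomologous H `` {kH}"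
      "\<And>C. is_cyc (edges H) C \<Longrightarrow> (\<Sum>e\<in>cyc_edges C. kH e) = H.kasteleyn_sign (cyc_edges C)"
      by (rule H.kasteleyn_class) (rule that; assumption)
    let ?c = "pipe_chain (M1, M2)"
    let ?g = "pairing (edges G) k ?c" and ?h = "pairing (edges H) kH ?c"
    have "(\<Prod>e\<in>M2. A $$ e) * (\<Prod>e\<in>M1. adjoint_mat A $$ (snd e, fst e)) = eta (pairing (edges G) \<alpha> ?c)"
    proof -
      have "(\<Prod>e\<in>M2. A $$ e) = eta (\<Sum>e\<in>M2. \<alpha> e)"
        unfolding eta_sum using \<alpha>A(2) sE by (intro prod.cong) auto
      \<comment> \<open>Conjugation replaces \<open>eta\<close> of a value by \<open>eta\<close> of
        its negative, in agreement with the coefficient -1 of the edges of \<open>M1\<close> in the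
        pipe chain.\<close>
      moreover have "(\<Prod>e\<in>M1. adjoint_mat A $$ (snd e, fst e)) = eta (- (\<Sum>e\<in>M1. \<alpha> e))"
        unfolding sum_negf[symmetric] eta_sum
      proof (rule prod.cong[OF refl])
        fix e assume "e \<in> M1"
        then have e: "e \<in> edges G" "fst e < n" "snd e < m" using sE edges_numbered by force+
        then show "adjoint_mat A $$ (snd e, fst e) = eta (- \<alpha> e)"
          using Bij[OF e(2,3)] \<alpha>A(2)[OF e(1)] by (simp flip: laurent_cnj_eta)
      qed
      ultimately show ?thesis
        by (simp add: sum_pipe_chain[OF finite_edges sE] flip: eta_add)
    qed
    also have "\<dots> = of_int (sgn_bit ?g) * q_power (pipe_area G (M1, M2))"
    proof -
      have "pairing (edges G) \<alpha> ?c = q_circle_of_bit ?g + (0, pipe_area G (M1, M2))"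
        by (rule pipe_chain_area[OF s k(1) face])
      then show ?thesis by (simp only: eta_add eta_bit q_power_eta)
    qed
    finally have prod: "(\<Prod>e\<in>M2. A $$ e) * (\<Prod>e\<in>M1. adjoint_mat A $$ (snd e, fst e)) =
      of_int (sgn_bit ?g) * q_power (pipe_area G (M1, M2))" .
    \<comment> \<open>The matrix entries supply the sign \<open>?g\<close> and the permutation the
      sign \<open>?h\<close>; their product is \<open>eta\<close> of the parity.\<close>
    have par: "eta (q_circle_of_bit (pipe_parity G (M1, M2))) = of_int (sgn_bit ?g) * of_int (sgn_bit ?h)"
    proof -
      have "a - b = a + b" for a b :: bit by (cases a; cases b) simp_all
      then have "pipe_parity G (M1, M2) = ?g + ?h"
        using pipe_parity_eq[OF s k(1,2), of kH] kH(1,2) by (simp only: H_def)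
      then show ?thesis by (simp only: eta_bit sgn_bit_add of_int_mult)
    qed
    have sg: "sign (pipe_perm n (M1, M2)) = (- 1) ^ card M1 * sgn_bit ?h"
      unfolding H_def by (rule sign_pipe_perm[OF s]) (use kH(3) H_def in simp)
    have const: "of_int z * monom c d = monom (of_int z * c) d" for z :: int and c :: laurent and d
      by (simp add: of_int_poly smult_monom)
    show "of_int (sign (pipe_perm n \<nu>)) *
      monom ((\<Prod>e\<in>snd \<nu>. A $$ e) * (\<Prod>e\<in>fst \<nu>. adjoint_mat A $$ (snd e, fst e))) (n - card (fst \<nu>)) =
      monom ((- 1) ^ pipe_size G \<nu> * q_power (pipe_area G \<nu>) * eta (q_circle_of_bit (pipe_parity G \<nu>)))
             (n - pipe_size G \<nu>)"
      unfolding \<nu> fst_conv snd_conv pipe_size_eq[OF s] const prod par sg by (simp add: mult_ac)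
  qed
  finally show ?thesis .
qed

text \<open>The required values are prescribed on all closed chains at once by a homomorphism
  \<open>h\<close>: the Kasteleyn class, plus the sum of the winding numbers over all faces as power
  of q. This sum is 1 on the boundary of a face. The homomorphism extends to a cochain, and applying
  \<open>eta\<close> to its values gives the matrix.\<close>

lemma kasteleyn_q_matrix_exists: "\<exists>A. kasteleyn_q_matrix G A"
proof -
  obtain k :: "nat \<times> nat \<Rightarrow> bit" where k: "k \<in> cochains G" "kasteleyn_class G = cohomologous G `` {k}"
    by (rule kasteleyn_class) (rule that; assumption)
  let ?pt = "\<lambda>F :: complex set. SOME z. z \<in> F"
  define h where "h = (\<lambda>c. q_circle_of_bit (pairing (edges G) k c) +
    ((0 :: circle), \<Sum>F\<in>bounded_faces G. chain_winding G c (?pt F)))"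
  have off: "S \<inter> supp (edges G) = {} \<Longrightarrow> z \<in> S \<Longrightarrow> z \<notin> img {e. c e \<noteq> 0}"
    if "closed_chain (edges G) c" for c S z using wind_off_support[OF that] by blast
  have pt: "?pt F \<notin> img {e. c e \<noteq> 0}" if "closed_chain (edges G) c" "F \<in> bounded_faces G" for c F
    using off[OF that(1), of "{?pt F}"] face_point[OF that(2)] by simp
  have "chain_winding G (\<lambda>e. c e + d e) (?pt F) = chain_winding G c (?pt F) + chain_winding G d (?pt F)"
    if "closed_chain (edges G) c" "closed_chain (edges G) d" "F \<in> bounded_faces G" for c d F
    using of_int_chain_winding[OF that(1) pt[OF that(1,3)]] of_int_chain_winding[OF that(2) pt[OF that(2,3)]]
    by (intro chain_winding_eq) (simp add: wind_add)
  then have cw: "(\<Sum>F\<in>bounded_faces G. chain_winding G (\<lambda>e. c e + d e) (?pt F)) =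
      (\<Sum>F\<in>bounded_faces G. chain_winding G c (?pt F)) + (\<Sum>F\<in>bounded_faces G. chain_winding G d (?pt F))"
    if "closed_chain (edges G) c" "closed_chain (edges G) d" for c d
    unfolding sum.distrib[symmetric] using that by (intro sum.cong) auto
  have split: "((0 :: circle), x + y) = (0, x) + (0, y)" for x y :: int by simp
  have "h (\<lambda>e. c e + d e) = h c + h d" if "closed_chain (edges G) c" "closed_chain (edges G) d" for c d
    unfolding h_def pairing_add q_circle_of_bit_add cw[OF that] split by (simp only: add_ac)
  then obtain \<phi> where \<phi>: "\<And>e. e \<notin> edges G \<Longrightarrow> \<phi> e = 0" "\<And>c. closed_chain (edges G) c \<Longrightarrow> pairing (edges G) \<phi> c = h c"
    using hom_closed_chains_extends[OF finite_edges, of h] by blast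
  define A where "A = mat n m (\<lambda>e. if e \<in> edges G then eta (\<phi> e) else 0)"
  have Ae: "A $$ e = eta (\<phi> e)" if "e \<in> edges G" for e
    using that edges_numbered by (cases e) (auto simp: A_def)
  have gen: "generalized_kasteleyn_q_matrix G A"
    by (auto simp: generalized_kasteleyn_q_matrix_def whites_eq blacks_eq A_def eta_mult_cnj)
  have mc: "matrix_cochain G A = \<phi>"
  proof
    fix e
    show "matrix_cochain G A e = \<phi> e"
    proof (cases "e \<in> edges G")
      case True
      then show ?thesis using matrix_cochain_eta(2)[OF gen True] Ae eta_inj by metis
    next
      case False
      then show ?thesis using \<phi>(1) by (simp add: matrix_cochain_def)
    qed
  qed
  have "evaluate G (matrix_class G A) (face_boundary G F)
          = q_circle_of_bit (evaluate G (kasteleyn_class G) (face_boundary G F)) + gen_q"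
    if F: "F \<in> bounded_faces G" for F
  proof -
    let ?\<beta> = "face_boundary G F"
    have cl: "closed_chain (edges G) ?\<beta>" using face_boundary(1)[OF F] .
    have "chain_winding G ?\<beta> (?pt K) = of_bool (K = F)" if K: "K \<in> bounded_faces G" for K
    proof (rule chain_winding_eq)
      have "?pt K \<in> F \<longleftrightarrow> K = F"
        using components_nonoverlap[of K "- supp (edges G)" F] face_point(1)[OF K] F K
        by (auto simp: bounded_faces_eq faces_def)
      then show "wind ?\<beta> (?pt K) = of_int (of_bool (K = F))"
        using face_boundary(2)[OF F face_point(2)[OF K face_point(1)[OF K]]] by simp
    qed
    then have "(\<Sum>K\<in>bounded_faces G. chain_winding G ?\<beta> (?pt K)) = (\<Sum>K\<in>bounded_faces G. if K = F then 1 else 0)"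
      by (intro sum.cong) auto
    also have "\<dots> = 1" using finite_bounded_faces F by simp
    finally have "h ?\<beta> = q_circle_of_bit (pairing (edges G) k ?\<beta>) + gen_q" by (simp add: h_def gen_q_def)
    moreover have "\<phi> \<in> cochains G" using \<phi>(1) by (simp add: cochains_def)
    ultimately show ?thesis
      unfolding matrix_class_def mc k(2) evaluate_class[OF k(1) cl]
      using evaluate_class[OF _ cl, of \<phi>] \<phi>(2)[OF cl] by simp
  qed
  then show ?thesis using gen unfolding kasteleyn_q_matrix_def by blast
qed

end

theorem theorem4p1:
  fixes G :: bigraph and n n' :: nat
  assumes "plane_bigraph G"
    and "whites G = {..<n}" and "blacks G = {..<n'}"
  shows "singular_q_polynomial G =
    (\<Sum>\<nu> \<in> pipe_systems G.
       monom ((- 1) ^ pipe_size G \<nu> * q_power (pipe_area G \<nu>)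
                * eta (q_circle_of_bit (pipe_parity G \<nu>)))
             (n - pipe_size G \<nu>))"
proof -
  interpret numbered_plane_graph G n n' by unfold_locales (rule assms)+
  \<comment> \<open>The sum over pipe systems does not mention the matrix, so all Kasteleyn matrices
    have the same polynomial, and one such matrix exists.\<close>
  show ?thesis unfolding singular_q_polynomial_def
    using kasteleyn_q_matrix_exists char_poly_kasteleyn by (intro the_equality) auto
qed

end
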